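(* Let $\mathbf W$ be the AWGN channel with signal power $P>0$ and noise power $N>0$ (defined below). Then for all $\varepsilon,\delta,\mu,\lambda\ge0$ with $\varepsilon<1$, $\mu+\lambda<1$, $\delta<1$, $$C_s(\varepsilon,P|\mathbf W)=D(\mu,\lambda,P|\mathbf W)=S(\delta,P|\mathbf W)=C_s(P|\mathbf W)=\tfrac12\log\left(1+\tfrac PN\right).$$
   Context: The AWGN channel: input and output alphabets $\mathbb R$, memoryless with $W^n(\mathbf y|\mathbf x)=\prod_{i=1}^n\frac1{\sqrt{2\pi N}}e^{-(y_i-x_i)^2/(2N)}$ (density), cost $c_n(\mathbf x)=x_1^2+\cdots+x_n^2$, and cost level $\Gamma=P$, so $\mathcal X^n(P)=\{\mathbf x\in\mathbb R^n:\frac1n\sum x_i^2\le P\}$. $\mathcal S_P$ is the set of input processes $\mathbf X=\{X^n\}$ with $\Pr\{X^n\in\mathcal X^n(P)\}=1$ for all $n$; $Y^n$ is the channel output for input $X^n$. For a distribution $Q$ on $\mathbb R^n$, $QW^n(B)=\int W^n(B|\mathbf x)Q(d\mathbf x)$. Transmission codes: an $(n,M_n,\varepsilon_n,P)$ code is an encoder $\varphi_n:\{1,\dots,M_n\}\to\mathcal X^n(P)$ and a decoder $\psi_n:\mathbb R^n\to\{1,\dots,M_n\}$, with $\varepsilon_n=\frac1{M_n}\sum_iW^n(\mathcal D_i^c|\varphi_n(i))$, $\mathcal D_i=\psi_n^{-1}(i)$. $R$ is $(\varepsilon,P)$-achievable if such codes exist with $\limsup\varepsilon_n\le\varepsilon$,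 $\liminf\frac1n\log M_n\ge R$; $C_s(\varepsilon,P|\mathbf W)$ is the supremum of such $R$, $C_s(P|\mathbf W)=C_s(0,P|\mathbf W)$. Identification codes: an $(n,N_n,\mu_n,\lambda_n,P)$ code consists of distributions $Q_1,\dots,Q_{N_n}$ with $Q_i(\mathcal X^n(P))=1$ and (not necessarily disjoint) sets $\mathcal D_1,\dots,\mathcal D_{N_n}\subset\mathbb R^n$, with $\mu_n=\max_iQ_iW^n(\mathcal D_i^c)$, $\lambda_n=\max_{i\ne j}Q_jW^n(\mathcal D_i)$. $R$ is $(\mu,\lambda,P)$-achievable if such codes exist with $\limsup\mu_n\le\mu$, $\limsup\lambda_n\le\lambda$, $\liminf\frac1n\log\log N_n\ge R$; $D(\mu,\lambda,P|\mathbf W)$ is the supremum of such $R$. Resolvability: $d(P_1,P_2)=2\sup_B|P_1(B)-P_2(B)|$; $U_M$ is uniform on $\{1,\dots,M\}$. For $\mathbf X\in\mathcal S_P$, $R$ is $(\delta,P)$-achievable for $\mathbf X$ if there are $M_n$ and maps $\varphi_n:\{1,\dots,M_n\}\to\mathcal X^n(P)$ such that, with $\tilde Y^n$ the output for input $\varphi_n(U_{M_n})$, $\limsup d(P_{Y^n},P_{\tilde Y^n})\le\delta$ and $\limsup\frac1n\log M_n\le R$. $R$ is $(\delta,P)$-achievable if so for all $\mathbf X\in\mathcal S_P$; $S(\delta,P|\mathbf W)$ is the infimum of such $R$. *)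

theory Defs
  imports "HOL-Probability.Probability"
begin

text \<open>Vectors in R^n are represented as extensional functions nat => real on {..<n},
  i.e. the points of the product measure space Rn n.  Logarithms are natural.\<close>

definition Rn :: "nat \<Rightarrow> (nat \<Rightarrow> real) measure" where
  "Rn n = PiM {..<n} (\<lambda>_. lborel)"

definition awgn :: "real \<Rightarrow> nat \<Rightarrow> (nat \<Rightarrow> real) \<Rightarrow> (nat \<Rightarrow> real) measure" where
  "awgn N n x = density (Rn n)
     (\<lambda>y. ennreal (\<Prod>i<n. 1 / sqrt (2 * pi * N) * exp (- ((y i - x i)^2) / (2 * N))))"

definition cost_set :: "nat \<Rightarrow> real \<Rightarrow> (nat \<Rightarrow> real) set" where
  "cost_set n P = {x \<in> space (Rn n). (\<Sum>i<n. (x i)^2) / real n \<le> P}"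

definition QW :: "real \<Rightarrow> nat \<Rightarrow> (nat \<Rightarrow> real) measure \<Rightarrow> (nat \<Rightarrow> real) set \<Rightarrow> real" where
  "QW N n Q B = (\<integral>x. measure (awgn N n x) B \<partial>Q)"

definition tx_code :: "real \<Rightarrow> nat \<Rightarrow> nat \<Rightarrow> real \<Rightarrow> real
    \<Rightarrow> (nat \<Rightarrow> nat \<Rightarrow> real) \<Rightarrow> ((nat \<Rightarrow> real) \<Rightarrow> nat) \<Rightarrow> bool" where
  "tx_code N n M eps P \<phi> \<psi> \<longleftrightarrow>
     M \<ge> 1 \<and> (\<forall>i\<in>{1..M}. \<phi> i \<in> cost_set n P) \<and>
     \<psi> \<in> measurable (Rn n) (count_space UNIV) \<and>
     (\<forall>y\<in>space (Rn n). \<psi> y \<in> {1..M}) \<and>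
     eps = (\<Sum>i=1..M. measure (awgn N n (\<phi> i)) (space (Rn n) - \<psi> -` {i})) / real M"

definition Cs_achievable :: "real \<Rightarrow> real \<Rightarrow> real \<Rightarrow> real \<Rightarrow> bool" where
  "Cs_achievable N eps P R \<longleftrightarrow>
     (\<exists>M \<phi> \<psi> e. (\<forall>n. tx_code N n (M n) (e n) P (\<phi> n) (\<psi> n)) \<and>
        limsup (\<lambda>n. ereal (e n)) \<le> ereal eps \<and>
        liminf (\<lambda>n. ereal (ln (real (M n)) / real n)) \<ge> ereal R)"

definition Cs :: "real \<Rightarrow> real \<Rightarrow> real \<Rightarrow> ereal" where
  "Cs N eps P = Sup (ereal ` {R. Cs_achievable N eps P R})"

text \<open>(n, Nn, mu, lam, P) identification code (Q_i, D_i), i = 1..Nn.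
  For Nn = 1 the maximum defining lam is over an empty set and is taken to be 0.\<close>
definition id_code :: "real \<Rightarrow> nat \<Rightarrow> nat \<Rightarrow> real \<Rightarrow> real \<Rightarrow> real
    \<Rightarrow> (nat \<Rightarrow> (nat \<Rightarrow> real) measure) \<Rightarrow> (nat \<Rightarrow> (nat \<Rightarrow> real) set) \<Rightarrow> bool" where
  "id_code N n Nn mu lam P Q D \<longleftrightarrow>
     Nn \<ge> 1 \<and>
     (\<forall>i\<in>{1..Nn}. prob_space (Q i) \<and> sets (Q i) = sets (Rn n) \<and>
        measure (Q i) (cost_set n P) = 1 \<and> D i \<in> sets (Rn n)) \<and>
     mu = Max ((\<lambda>i. QW N n (Q i) (space (Rn n) - D i)) ` {1..Nn}) \<and>
     lam = Max ({0} \<union> {QW N n (Q j) (D i) | i j. i \<in> {1..Nn} \<and> j \<in> {1..Nn} \<and> i \<noteq> j})"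

definition D_achievable :: "real \<Rightarrow> real \<Rightarrow> real \<Rightarrow> real \<Rightarrow> real \<Rightarrow> bool" where
  "D_achievable N mu lam P R \<longleftrightarrow>
     (\<exists>Nn Q D m l. (\<forall>n. id_code N n (Nn n) (m n) (l n) P (Q n) (D n)) \<and>
        limsup (\<lambda>n. ereal (m n)) \<le> ereal mu \<and>
        limsup (\<lambda>n. ereal (l n)) \<le> ereal lam \<and>
        liminf (\<lambda>n. ereal (ln (ln (real (Nn n))) / real n)) \<ge> ereal R)"

definition Did :: "real \<Rightarrow> real \<Rightarrow> real \<Rightarrow> real \<Rightarrow> ereal" where
  "Did N mu lam P = Sup (ereal ` {R. D_achievable N mu lam P R})"

definition input_process :: "real \<Rightarrow> (nat \<Rightarrow> (nat \<Rightarrow> real) measure) \<Rightarrow> bool" where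
  "input_process P X \<longleftrightarrow>
     (\<forall>n. prob_space (X n) \<and> sets (X n) = sets (Rn n) \<and> measure (X n) (cost_set n P) = 1)"

definition var_dist :: "nat \<Rightarrow> ((nat \<Rightarrow> real) set \<Rightarrow> real) \<Rightarrow> ((nat \<Rightarrow> real) set \<Rightarrow> real) \<Rightarrow> real" where
  "var_dist n P1 P2 = 2 * (SUP B\<in>sets (Rn n). \<bar>P1 B - P2 B\<bar>)"

definition unif_out :: "real \<Rightarrow> nat \<Rightarrow> nat \<Rightarrow> (nat \<Rightarrow> nat \<Rightarrow> real) \<Rightarrow> (nat \<Rightarrow> real) set \<Rightarrow> real" where
  "unif_out N n M \<phi> B = (\<Sum>i=1..M. measure (awgn N n (\<phi> i)) B) / real M"

definition res_achievable_for :: "real \<Rightarrow> real \<Rightarrow> real \<Rightarrow> (nat \<Rightarrow> (nat \<Rightarrow> real) measure) \<Rightarrow> real \<Rightarrow> bool" where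
  "res_achievable_for N \<delta> P X R \<longleftrightarrow>
     (\<exists>M \<phi>. (\<forall>n. M n \<ge> 1 \<and> (\<forall>i\<in>{1..M n}. \<phi> n i \<in> cost_set n P)) \<and>
        limsup (\<lambda>n. ereal (var_dist n (QW N n (X n)) (unif_out N n (M n) (\<phi> n)))) \<le> ereal \<delta> \<and>
        limsup (\<lambda>n. ereal (ln (real (M n)) / real n)) \<le> ereal R)"

definition Sres :: "real \<Rightarrow> real \<Rightarrow> real \<Rightarrow> ereal" where
  "Sres N \<delta> P = Inf (ereal ` {R. \<forall>X. input_process P X \<longrightarrow> res_achievable_for N \<delta> P X R})"

end

(* Everything reduces to pointwise comparison of Gaussian densities. Let q be the centred Gaussian
   with variance P + N, the output of a Gaussian input of variance P, and C the capacity. A Chernoff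
   bound shows that for every x in the cost set the density ratio w(y|x)/q(y) is at most
   exp(n(C + eta)) except with exponentially small probability, and for x of norm close to nP it is
   also at least exp(n(C - eta)).

   The lower bound on the ratio yields codes with small maximal error (Feinstein's greedy
   construction), and from these identification codes: a codebook of L * 4^s words is read as an
   L x 4^s array, messages are functions from rows to columns that pairwise agree in few rows
   (Gilbert's greedy bound), and a message is sent through a random row.
   The upper bound yields the strong converse for transmission and soft covering: truncating the
   ratio at K = exp(n(C + eta)), a greedy choice of M words approximates the mean of w(.|x)/q in
   L2(q) with squared error K/M. Soft covering bounds resolvability from above, and also the number
   of identification messages, because codebooks quantized to a grid are few and distinct messages
   need distinct codebooks. Finally, a codebook of rate below capacity cannot simulate an almost
   Gaussian input, since its output lives on exp(nR) noise balls of negligible q-measure. *)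

theory Submission
  imports Defs "HOL-Real_Asymp.Real_Asymp"
begin

section \<open>Gaussian densities on product space\<close>

text \<open>A Gaussian input of variance P breaks the power constraint with probability that does
  not vanish. Every lower bound therefore works with a variance slightly below P, cut down to the
  cost set, and uses that capacity is continuous in the power. The upper bounds need no such room:
  the mean of the logarithm of w/q under the channel grows with the norm of x, so short inputs are
  covered as well.

  Truncation is essential for soft covering. The second moment of w/q under q is governed by rare
  outputs and is in general exponentially larger than exp(nC); after truncation the square is at
  most K times the ratio itself, whose q-mean is at most 1.

  The continuous alphabet is the obstacle to counting codebooks. A grid of mesh 1/n moves a word by
  squared distance at most 1/n, invisible under noise of variance N, and meets the relevant range of
  each coordinate in polynomially many points. A codebook of M words then has poly(n)^(Mn) quantized
  versions, whose iterated logarithm is ln M up to O(log n). So the doubly exponential growth rate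
  of messages is the covering rate.\<close>

definition sqd :: "nat \<Rightarrow> (nat \<Rightarrow> real) \<Rightarrow> (nat \<Rightarrow> real) \<Rightarrow> real" where
  "sqd n x y = (\<Sum>i<n. (y i - x i)\<^sup>2)"

text \<open>The variance \<open>v\<close> is left free because the channel (\<open>v = N\<close>),
  the Gaussian input (centre 0) and its output (centre 0, \<open>v = P + N\<close>) are all compared
  within this one family.\<close>

definition gd :: "real \<Rightarrow> nat \<Rightarrow> (nat \<Rightarrow> real) \<Rightarrow> (nat \<Rightarrow> real) \<Rightarrow> real" where
  "gd v n x y = (\<Prod>i<n. 1 / sqrt (2 * pi * v) * exp (- ((y i - x i)\<^sup>2) / (2 * v)))"

lemma gd_exp:
  assumes "v > 0"
  shows "gd v n x y = exp (- (real n * ln (2 * pi * v) + sqd n x y / v) / 2)"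
proof (induction n)
  case 0
  show ?case by (simp add: gd_def sqd_def)
next
  case (Suc n)
  have p: "2 * pi * v > 0" using assms by simp
  have "1 / sqrt (2 * pi * v) = exp (- (ln (2 * pi * v) / 2))"
  proof -
    have "exp (ln (sqrt (2 * pi * v))) = sqrt (2 * pi * v)" using p by (intro exp_ln) simp
    then have "exp (ln (2 * pi * v) / 2) = sqrt (2 * pi * v)"
      using p by (subst (asm) ln_sqrt) simp_all
    then show ?thesis by (simp add: exp_minus inverse_eq_divide)
  qed
  then have "gd v (Suc n) x y = gd v n x y * exp (- (ln (2 * pi * v) / 2)) * exp (- ((y n - x n)\<^sup>2) / (2 * v))"
    unfolding gd_def by simp
  also have "\<dots> = exp (- (real n * ln (2 * pi * v) + sqd n x y / v) / 2
      + - (ln (2 * pi * v) / 2) + - ((y n - x n)\<^sup>2) / (2 * v))"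
    unfolding Suc exp_add ..
  also have "- (real n * ln (2 * pi * v) + sqd n x y / v) / 2
      + - (ln (2 * pi * v) / 2) + - ((y n - x n)\<^sup>2) / (2 * v)
     = - (real (Suc n) * ln (2 * pi * v) + sqd (Suc n) x y / v) / 2"
    using assms by (simp add: sqd_def field_simps)
  finally show ?case .
qed

lemma gd_pos [simp]: "v > 0 \<Longrightarrow> gd v n x y > 0"
  by (simp add: gd_exp)

lemma awgn_gd: "awgn v n x = density (Rn n) (\<lambda>y. ennreal (gd v n x y))"
  by (simp add: awgn_def gd_def)

lemma Rn_component [measurable (raw)]:
  assumes f: "f \<in> measurable M (Rn n)" and i: "i < n"
  shows "(\<lambda>z. f z i) \<in> borel_measurable M"
proof -
  have "(\<lambda>y. y i) \<in> measurable (Rn n) lborel"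
    unfolding Rn_def using i by (intro measurable_component_singleton) auto
  from measurable_compose[OF f this] show ?thesis by simp
qed

lemma sqd_measurable [measurable (raw)]:
  assumes [measurable]: "f \<in> measurable M (Rn n)" "g \<in> measurable M (Rn n)"
  shows "(\<lambda>z. sqd n (f z) (g z)) \<in> borel_measurable M"
  unfolding sqd_def by (intro borel_measurable_sum) (auto intro!: measurable)

lemma sqd_measurable_const [measurable (raw)]:
  assumes [measurable]: "g \<in> measurable M (Rn n)"
  shows "(\<lambda>z. sqd n x (g z)) \<in> borel_measurable M"
  unfolding sqd_def by (intro borel_measurable_sum) auto

lemma gd_measurable [measurable (raw)]:
  assumes [measurable]: "f \<in> measurable M (Rn n)" "g \<in> measurable M (Rn n)"
  shows "(\<lambda>z. gd v n (f z) (g z)) \<in> borel_measurable M"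
  unfolding gd_def by (intro borel_measurable_prod) auto

lemma gd_measurable_const [measurable (raw)]:
  assumes [measurable]: "g \<in> measurable M (Rn n)"
  shows "(\<lambda>z. gd v n x (g z)) \<in> borel_measurable M"
  unfolding gd_def by (intro borel_measurable_prod) auto

lemma sets_awgn [simp, measurable_cong]: "sets (awgn v n x) = sets (Rn n)"
  by (simp add: awgn_def)

lemma space_awgn [simp]: "space (awgn v n x) = space (Rn n)"
  by (simp add: awgn_def)

lemma sigma_finite_Rn: "sigma_finite_measure (Rn n)"
proof -
  interpret finite_product_sigma_finite "\<lambda>_. lborel :: real measure" "{..<n}"
    by standard auto
  show ?thesis unfolding Rn_def by (rule sigma_finite_measure_axioms)
qed

lemma nn_integral_Rn_prod:
  assumes "\<And>i. i < n \<Longrightarrow> f i \<in> borel_measurable borel"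
  shows "(\<integral>\<^sup>+y. (\<Prod>i<n. f i (y i)) \<partial>Rn n) = (\<Prod>i<n. \<integral>\<^sup>+t. f i t \<partial>lborel)"
proof -
  interpret product_sigma_finite "\<lambda>_. lborel :: real measure" by standard
  show ?thesis unfolding Rn_def
    by (rule product_nn_integral_prod) (use assms in auto)
qed

lemma emeasure_awgn:
  assumes "B \<in> sets (Rn n)"
  shows "emeasure (awgn v n x) B = (\<integral>\<^sup>+y. ennreal (gd v n x y) * indicator B y \<partial>Rn n)"
  unfolding awgn_gd using assms by (intro emeasure_density) auto

lemma gauss_normal:
  assumes "v > 0"
  shows "1 / sqrt (2 * pi * v) * exp (- ((y - x)\<^sup>2) / (2 * v)) = normal_density x (sqrt v) y"
  using assms by (simp add: normal_density_def)

lemma prob_space_awgn: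
  assumes v: "v > 0"
  shows "prob_space (awgn v n x)"
proof
  have "emeasure (awgn v n x) (space (Rn n)) = (\<integral>\<^sup>+y. ennreal (gd v n x y) \<partial>Rn n)"
    by (subst emeasure_awgn) (auto intro!: nn_integral_cong)
  also have "\<dots> = (\<integral>\<^sup>+y. (\<Prod>i<n. ennreal (normal_density (x i) (sqrt v) (y i))) \<partial>Rn n)"
    unfolding gd_def gauss_normal[OF v] by (simp add: prod_ennreal)
  also have "\<dots> = (\<Prod>i<n. \<integral>\<^sup>+t. ennreal (normal_density (x i) (sqrt v) t) \<partial>lborel)"
    by (rule nn_integral_Rn_prod) auto
  also have "\<dots> = 1"
  proof -
    have "(\<integral>\<^sup>+t. ennreal (normal_density m (sqrt v) t) \<partial>lborel) = 1" for m
      using integral_normal_density[of "sqrt v" m] integrable_normal_density[of "sqrt v" m] v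
      by (subst nn_integral_eq_integral) auto
    then show ?thesis by simp
  qed
  finally show "emeasure (awgn v n x) (space (awgn v n x)) = 1" by simp
qed

lemma awgn_le:
  assumes v: "v > 0" "v' > 0" and B: "B \<in> sets (Rn n)" and "c \<ge> 0"
    and le: "\<And>y. y \<in> B \<Longrightarrow> gd v n x y \<le> c * gd v' n x' y"
  shows "measure (awgn v n x) B \<le> c * measure (awgn v' n x') B"
proof -
  interpret A: prob_space "awgn v n x" by (rule prob_space_awgn[OF v(1)])
  interpret A': prob_space "awgn v' n x'" by (rule prob_space_awgn[OF v(2)])
  have "emeasure (awgn v n x) B \<le> (\<integral>\<^sup>+y. ennreal c * (ennreal (gd v' n x' y) * indicator B y) \<partial>Rn n)"
    unfolding emeasure_awgn[OF B]
    by (intro nn_integral_mono) (use le v \<open>c \<ge> 0\<close> in \<open>auto simp: indicator_def ennreal_mult[symmetric] less_imp_le intro!: ennreal_leI\<close>)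
  also have "\<dots> = ennreal c * emeasure (awgn v' n x') B"
    unfolding emeasure_awgn[OF B] using B by (intro nn_integral_cmult) auto
  finally show ?thesis
    using \<open>c \<ge> 0\<close> by (simp add: A.emeasure_eq_measure A'.emeasure_eq_measure ennreal_mult[symmetric])
qed

text \<open>The comparison law gives \<open>B\<close> mass at most 1, so a pointwise inequality
  between densities is already a probability bound. This takes the place of Markov's inequality:
  every tail estimate amounts to finding a suitable comparison Gaussian.\<close>

lemma awgn_le_const:
  assumes v: "v > 0" "v' > 0" and B: "B \<in> sets (Rn n)" and "c \<ge> 0"
    and le: "\<And>y. y \<in> B \<Longrightarrow> gd v n x y \<le> c * gd v' n x' y"
  shows "measure (awgn v n x) B \<le> c"
proof -
  interpret A': prob_space "awgn v' n x'" by (rule prob_space_awgn[OF v(2)])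
  have "measure (awgn v n x) B \<le> c * measure (awgn v' n x') B" by (rule awgn_le) fact+
  also have "\<dots> \<le> c * 1" using \<open>c \<ge> 0\<close> by (intro mult_left_mono) auto
  finally show ?thesis by simp
qed

lemma awgn_measurable [measurable (raw)]:
  assumes v: "v > 0" and B [measurable]: "B \<in> sets (Rn n)"
  shows "(\<lambda>x. measure (awgn v n x) B) \<in> borel_measurable (Rn n)"
proof -
  interpret sigma_finite_measure "Rn n" by (rule sigma_finite_Rn)
  have "(\<lambda>x. emeasure (awgn v n x) B) \<in> borel_measurable (Rn n)"
    unfolding emeasure_awgn[OF B] by measurable
  then show ?thesis unfolding measure_def by measurable
qed

lemma gauss_mix_1:
  assumes v: "v > 0" "u > 0"
  shows "(\<integral>\<^sup>+t. ennreal (normal_density 0 (sqrt u) t * normal_density t (sqrt v) y) \<partial>lborel)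
    = ennreal (normal_density 0 (sqrt (u + v)) y)"
proof -
  have "(\<integral>\<^sup>+t. ennreal (normal_density 0 (sqrt v) (y - t) * normal_density 0 (sqrt u) t) \<partial>lborel)
     = ennreal (normal_density 0 (sqrt ((sqrt v)\<^sup>2 + (sqrt u)\<^sup>2)) y)"
    using fun_cong[OF conv_normal_density_zero_mean[of "sqrt v" "sqrt u"], of y] v by simp
  then show ?thesis using v
    by (simp add: normal_density_def power2_commute mult.commute add.commute)
qed

lemma gd_mix:
  assumes v: "v > 0" "u > 0"
  shows "(\<integral>\<^sup>+x. ennreal (gd u n (\<lambda>_. 0) x) * ennreal (gd v n x y) \<partial>Rn n)
    = ennreal (gd (u + v) n (\<lambda>_. 0) y)"
proof -
  have uv: "u + v > 0" using v by simp
  have "(\<integral>\<^sup>+x. ennreal (gd u n (\<lambda>_. 0) x) * ennreal (gd v n x y) \<partial>Rn n) =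
     (\<integral>\<^sup>+x. (\<Prod>i<n. ennreal (normal_density 0 (sqrt u) (x i) * normal_density (x i) (sqrt v) (y i))) \<partial>Rn n)"
    unfolding gd_def gauss_normal[OF v(1)] gauss_normal[OF v(2)]
    by (simp add: prod_ennreal prod.distrib prod_nonneg ennreal_mult)
  also have "\<dots> = (\<Prod>i<n. \<integral>\<^sup>+t. ennreal (normal_density 0 (sqrt u) t * normal_density t (sqrt v) (y i)) \<partial>lborel)"
    by (rule nn_integral_Rn_prod) (auto simp: normal_density_def)
  also have "\<dots> = ennreal (gd (u + v) n (\<lambda>_. 0) y)"
    unfolding gd_def gauss_normal[OF uv] gauss_mix_1[OF v] by (simp add: prod_ennreal)
  finally show ?thesis .
qed

text \<open>Fubini reduces the output of the Gaussian input to \<open>gd_mix\<close>, where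
  variances add coordinate by coordinate. The nonnegative integral is the form in which
  \<open>feinstein\<close> asks for the output law.\<close>

lemma QW_gauss:
  assumes v: "v > 0" "u > 0" and B [measurable]: "B \<in> sets (Rn n)"
  shows "(\<integral>\<^sup>+x. ennreal (measure (awgn v n x) B) \<partial>awgn u n (\<lambda>_. 0)) = emeasure (awgn (u + v) n (\<lambda>_. 0)) B"
proof -
  interpret sigma_finite_measure "Rn n" by (rule sigma_finite_Rn)
  interpret pair_sigma_finite "Rn n" "Rn n" ..
  have "(\<integral>\<^sup>+x. ennreal (measure (awgn v n x) B) \<partial>awgn u n (\<lambda>_. 0)) =
     (\<integral>\<^sup>+x. emeasure (awgn v n x) B \<partial>awgn u n (\<lambda>_. 0))"
    using prob_space_awgn[OF v(1)] by (simp add: prob_space_def finite_measure.emeasure_eq_measure)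
  also have "\<dots> = (\<integral>\<^sup>+x. ennreal (gd u n (\<lambda>_. 0) x) * (\<integral>\<^sup>+y. ennreal (gd v n x y) * indicator B y \<partial>Rn n) \<partial>Rn n)"
    unfolding awgn_gd[of u] emeasure_awgn[OF B] by (subst nn_integral_density) auto
  also have "\<dots> = (\<integral>\<^sup>+x. (\<integral>\<^sup>+y. ennreal (gd u n (\<lambda>_. 0) x) * (ennreal (gd v n x y) * indicator B y) \<partial>Rn n) \<partial>Rn n)"
    by (intro nn_integral_cong nn_integral_cmult[symmetric]) auto
  also have "\<dots> = (\<integral>\<^sup>+y. (\<integral>\<^sup>+x. ennreal (gd u n (\<lambda>_. 0) x) * (ennreal (gd v n x y) * indicator B y) \<partial>Rn n) \<partial>Rn n)"
    by (rule Fubini'[symmetric]) auto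
  also have "\<dots> = (\<integral>\<^sup>+y. (\<integral>\<^sup>+x. ennreal (gd u n (\<lambda>_. 0) x) * ennreal (gd v n x y) \<partial>Rn n) * indicator B y \<partial>Rn n)"
    by (intro nn_integral_cong, subst nn_integral_multc[symmetric]) (auto simp: mult.assoc)
  also have "\<dots> = emeasure (awgn (u + v) n (\<lambda>_. 0)) B"
    unfolding gd_mix[OF v] emeasure_awgn[OF B] ..
  finally show ?thesis .
qed

section \<open>Chernoff bounds for the information density\<close>

abbreviation (input) awgn_capacity :: "real \<Rightarrow> real \<Rightarrow> real" where
  "awgn_capacity P N \<equiv> 1/2 * ln (1 + P / N)"

definition nsq :: "nat \<Rightarrow> (nat \<Rightarrow> real) \<Rightarrow> real" where
  "nsq n x = (\<Sum>i<n. (x i)\<^sup>2)"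

lemma nsq_measurable [measurable (raw)]:
  assumes [measurable]: "f \<in> measurable M (Rn n)"
  shows "(\<lambda>z. nsq n (f z)) \<in> borel_measurable M"
  unfolding nsq_def by (intro borel_measurable_sum) auto

lemma nsq_nonneg [simp]: "nsq n x \<ge> 0"
  by (simp add: nsq_def sum_nonneg)

lemma sqd_zero [simp]: "sqd n (\<lambda>_. 0) y = nsq n y"
  by (simp add: sqd_def nsq_def)

lemma cost_set_nsq: "x \<in> cost_set n P \<Longrightarrow> nsq n x \<le> real n * P"
  by (cases "n = 0") (auto simp: cost_set_def nsq_def field_simps)

lemma cost_setI: "x \<in> space (Rn n) \<Longrightarrow> nsq n x \<le> real n * P \<Longrightarrow> P > 0 \<Longrightarrow> x \<in> cost_set n P"
  by (cases "n = 0") (auto simp: cost_set_def nsq_def field_simps)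

text \<open>The exponent is the information density. Its mean under the channel from x is n times
  the capacity plus (\<open>nsq n x\<close> - n P) / (2 (P + N)). Upper deviations are thus
  controlled as soon as the squared norm is at most n P, while lower deviations need it not much
  below n P.\<close>

lemma gd_ratio_zero:
  assumes "P > 0" "N > 0"
  shows "gd N n x y = exp (real n * awgn_capacity P N + (nsq n y / (P + N) - sqd n x y / N) / 2)
    * gd (P + N) n (\<lambda>_. 0) y"
proof -
  have "ln (1 + P / N) = ln (2 * pi * (P + N)) - ln (2 * pi * N)"
  proof -
    have "1 + P / N = (2 * pi * (P + N)) / (2 * pi * N)" using assms by (simp add: field_simps)
    then show ?thesis using assms ln_div[of "2 * pi * (P + N)" "2 * pi * N"] by simp
  qed
  moreover have "- (real n * b + s) / 2 = real n * (1/2 * (a - b)) + (q - s) / 2 + - (real n * a + q) / 2"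
    for a b s q :: real by (simp add: field_simps)
  ultimately have "- (real n * ln (2 * pi * N) + sqd n x y / N) / 2 =
      real n * awgn_capacity P N + (nsq n y / (P + N) - sqd n x y / N) / 2
      + - (real n * ln (2 * pi * (P + N)) + nsq n y / (P + N)) / 2"
    by (simp only:)
  then show ?thesis using assms by (simp only: gd_exp add_pos_pos exp_add[symmetric] sqd_zero)
qed

text \<open>Completing the square: tilting a Gaussian density by the exponential of a multiple of the
  information density gives, up to a constant, another Gaussian density. The bounds on the
  information density are Chernoff bounds obtained from this identity.\<close>

lemma gd_tilt:
  assumes "N > 0" and c: "1 + b * P > 0"
  shows "gd N n x y * exp (b / 2 * (nsq n y - (P + N) * sqd n x y / N)) =
    exp (- real n * ln (1 + b * P) / 2 + b * (1 + b * (P + N)) / (2 * (1 + b * P)) * nsq n x)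
    * gd (N / (1 + b * P)) n (\<lambda>i. (1 + b * (P + N)) / (1 + b * P) * x i) y"
proof -
  define k where "k = 1 + b * P"
  define d where "d = k + b * N"
  have k: "k > 0" using c by (simp add: k_def)
  have d: "1 + b * (P + N) = d" by (simp add: d_def k_def algebra_simps)
  have 1: "(Y - X)\<^sup>2 / N * d - b * Y\<^sup>2 = k / N * (Y - d / k * X)\<^sup>2 - b * d / k * X\<^sup>2" for X Y :: real
  proof -
    have "k * d * (Y - X)\<^sup>2 - b * k * N * Y\<^sup>2 = (k * Y - d * X)\<^sup>2 - b * N * d * X\<^sup>2"
      unfolding d_def by (simp add: power2_eq_square algebra_simps)
    moreover have "(k * Y - d * X)\<^sup>2 = k\<^sup>2 * (Y - d / k * X)\<^sup>2"
      using k by (simp add: power_mult_distrib[symmetric] algebra_simps)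
    ultimately have "k * d * (Y - X)\<^sup>2 - b * k * N * Y\<^sup>2 = k\<^sup>2 * (Y - d / k * X)\<^sup>2 - b * N * d * X\<^sup>2"
      by simp
    then have "(k * d * (Y - X)\<^sup>2 - b * k * N * Y\<^sup>2) / (k * N) = (k\<^sup>2 * (Y - d / k * X)\<^sup>2 - b * N * d * X\<^sup>2) / (k * N)"
      by simp
    then show ?thesis using k \<open>N > 0\<close> by (simp add: diff_divide_distrib power2_eq_square mult_ac)
  qed
  have 2: "sqd n x y / N * d - b * nsq n y = k / N * sqd n (\<lambda>i. d / k * x i) y - b * d / k * nsq n x"
    unfolding sqd_def nsq_def sum_distrib_left sum_distrib_right sum_divide_distrib sum_subtractf[symmetric]
    by (intro sum.cong refl 1)
  have dk: "(P + N) * b = d - 1" using d by (simp add: algebra_simps)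
  have lnk: "ln (2 * pi * (N / k)) = ln (2 * pi * N) - ln k"
    using k \<open>N > 0\<close> ln_div[of "2 * pi * N" k] by simp
  have "- (real n * ln (2 * pi * N) + sqd n x y / N) / 2 + b / 2 * (nsq n y - (P + N) * sqd n x y / N)
    = - real n * ln (2 * pi * N) / 2 - (sqd n x y / N * (1 + (P + N) * b) - b * nsq n y) / 2"
    by (simp add: algebra_simps add_divide_distrib diff_divide_distrib)
  also have "\<dots> = - real n * ln (2 * pi * N) / 2 - (k / N * sqd n (\<lambda>i. d / k * x i) y - b * d / k * nsq n x) / 2"
    unfolding dk 2[symmetric] by simp
  also have "\<dots> = - real n * ln k / 2 + b * d / (2 * k) * nsq n x
      + - (real n * ln (2 * pi * (N / k)) + sqd n (\<lambda>i. d / k * x i) y / (N / k)) / 2"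
    unfolding lnk by (simp add: algebra_simps add_divide_distrib diff_divide_distrib)
  finally have E: "- (real n * ln (2 * pi * N) + sqd n x y / N) / 2 + b / 2 * (nsq n y - (P + N) * sqd n x y / N)
    = - real n * ln k / 2 + b * d / (2 * k) * nsq n x
      + - (real n * ln (2 * pi * (N / k)) + sqd n (\<lambda>i. d / k * x i) y / (N / k)) / 2" .
  have g1: "gd N n x y = exp (- (real n * ln (2 * pi * N) + sqd n x y / N) / 2)"
    by (rule gd_exp) fact
  have g2: "gd (N / k) n (\<lambda>i. d / k * x i) y =
     exp (- (real n * ln (2 * pi * (N / k)) + sqd n (\<lambda>i. d / k * x i) y / (N / k)) / 2)"
    by (rule gd_exp) (use k \<open>N > 0\<close> in simp)
  show ?thesis
    unfolding d unfolding k_def[symmetric] unfolding g1 g2 exp_add[symmetric] E ..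
qed

text \<open>Chernoff's bound in density form: \<open>a\<close> is the threshold of the tilted
  exponent, \<open>e\<close> bounds its logarithmic moment generating function, and the tilted
  Gaussian carries the remaining mass 1.\<close>

lemma gd_tilt_le:
  assumes "N > 0" and c: "1 + b * P > 0"
    and a: "a \<le> b / 2 * (nsq n y - (P + N) * sqd n x y / N)"
    and e: "- real n * ln (1 + b * P) / 2 + b * (1 + b * (P + N)) / (2 * (1 + b * P)) * nsq n x \<le> e"
  shows "gd N n x y \<le> exp (e - a) * gd (N / (1 + b * P)) n (\<lambda>i. (1 + b * (P + N)) / (1 + b * P) * x i) y"
proof -
  have g: "gd N n x y \<ge> 0" "gd (N / (1 + b * P)) n (\<lambda>i. (1 + b * (P + N)) / (1 + b * P) * x i) y \<ge> 0"
    using assms by (auto intro!: less_imp_le gd_pos)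
  have "gd N n x y * exp a \<le> gd N n x y * exp (b / 2 * (nsq n y - (P + N) * sqd n x y / N))"
    using a g by (intro mult_left_mono) auto
  also have "\<dots> \<le> exp e * gd (N / (1 + b * P)) n (\<lambda>i. (1 + b * (P + N)) / (1 + b * P) * x i) y"
    unfolding gd_tilt[OF assms(1,2)] using e g by (intro mult_right_mono) auto
  finally show ?thesis by (simp add: exp_diff field_simps)
qed

text \<open>Applied with z = b P for tilts b of either sign. The bound is exact to first order, so
  at squared norm n P the terms linear in b cancel and a multiple of b^2 remains.\<close>

lemma ln_ge_frac: "(1::real) + z > 0 \<Longrightarrow> z / (1 + z) \<le> ln (1 + z)"
  using ln_le_minus_one[of "1 / (1 + z)"] by (simp add: ln_div field_simps)

definition info_above :: "real \<Rightarrow> real \<Rightarrow> nat \<Rightarrow> real \<Rightarrow> (nat \<Rightarrow> real) \<Rightarrow> (nat \<Rightarrow> real) set" where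
  "info_above N P n r x = {y \<in> space (Rn n). gd N n x y > exp (real n * r) * gd (P + N) n (\<lambda>_. 0) y}"

lemma info_above_sets [measurable]: "info_above N P n r x \<in> sets (Rn n)"
  unfolding info_above_def by measurable

lemma awgn_info_upper:
  assumes "P > 0" "N > 0" "\<eta> > 0" and x: "nsq n x \<le> real n * P"
  shows "measure (awgn N n x) (info_above N P n (awgn_capacity P N + \<eta>) x)
    \<le> exp (- real n * ((P + N) * \<eta>\<^sup>2 / (2 * P)))"
proof -
  define T where "T = P + N"
  \<comment> \<open>This tilt minimizes b^2 P T / 2 - b T \<eta>, the exponent per coordinate that
    results below.\<close>
  define b where "b = \<eta> / P"
  have b: "b > 0" "b * P = \<eta>" and T: "T > 0" using assms by (auto simp: b_def T_def)
  then have c: "1 + b * P > 0" using assms by simp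
  have "- real n * ln (1 + b * P) / 2 + b * (1 + b * T) / (2 * (1 + b * P)) * nsq n x
      \<le> - real n * ((b * P) / (1 + b * P)) / 2 + b * (1 + b * T) / (2 * (1 + b * P)) * (real n * P)"
  proof (rule add_mono)
    show "- real n * ln (1 + b * P) / 2 \<le> - real n * ((b * P) / (1 + b * P)) / 2"
      using mult_left_mono[OF ln_ge_frac[OF c], of "real n / 2"] by (simp add: mult_ac)
    show "b * (1 + b * T) / (2 * (1 + b * P)) * nsq n x \<le> b * (1 + b * T) / (2 * (1 + b * P)) * (real n * P)"
      using x b(1) c T by (intro mult_left_mono) auto
  qed
  also have "\<dots> = real n * (b\<^sup>2 * P * T / 2) / (1 + b * P)"
  proof -
    have "- m * ((b * P) / k) / 2 + b * (1 + b * T) / (2 * k) * (m * P) = m * (b\<^sup>2 * P * T / 2) / k"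
      if "k > 0" for m k :: real
      using that by (simp add: field_simps power2_eq_square)
    from this[OF c] show ?thesis .
  qed
  also have "\<dots> \<le> real n * (b\<^sup>2 * P * T / 2)"
    using assms b T c by (simp add: pos_divide_le_eq mult_left_le)
       (simp add: algebra_simps)
  finally have e: "- real n * ln (1 + b * P) / 2 + b * (1 + b * (P + N)) / (2 * (1 + b * P)) * nsq n x
      \<le> real n * (b\<^sup>2 * P * T / 2)" by (simp add: T_def)
  have id: "real n * (b\<^sup>2 * P * T / 2) - real n * (b * T * \<eta>) = - real n * ((P + N) * \<eta>\<^sup>2 / (2 * P))"
    using assms by (simp add: b_def T_def field_simps power2_eq_square)
  show ?thesis
  proof (rule awgn_le_const[where v' = "N / (1 + b * P)" and x' = "\<lambda>i. (1 + b * (P + N)) / (1 + b * P) * x i"])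
    fix y assume "y \<in> info_above N P n (awgn_capacity P N + \<eta>) x"
    then have "exp (real n * (awgn_capacity P N + \<eta>)) * gd (P + N) n (\<lambda>_. 0) y <
       exp (real n * awgn_capacity P N + (nsq n y / (P + N) - sqd n x y / N) / 2) * gd (P + N) n (\<lambda>_. 0) y"
      using gd_ratio_zero[OF assms(1,2)] by (simp add: info_above_def)
    then have "real n * \<eta> \<le> (nsq n y / T - sqd n x y / N) / 2"
      using assms by (simp add: T_def distrib_left)
    then have "b * T * (real n * \<eta>) \<le> b * T * ((nsq n y / T - sqd n x y / N) / 2)"
      using b T by (intro mult_left_mono) auto
    also have "\<dots> = b / 2 * (nsq n y - (P + N) * sqd n x y / N)"
      using T by (simp add: T_def[symmetric] right_diff_distrib)
    finally have a: "real n * (b * T * \<eta>) \<le> b / 2 * (nsq n y - (P + N) * sqd n x y / N)"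
      by (simp add: mult_ac)
    show "gd N n x y \<le> exp (- real n * ((P + N) * \<eta>\<^sup>2 / (2 * P))) *
       gd (N / (1 + b * P)) n (\<lambda>i. (1 + b * (P + N)) / (1 + b * P) * x i) y"
      using gd_tilt_le[OF assms(2) c a e] unfolding id .
  qed (use assms c in \<open>auto\<close>)
qed

definition info_below :: "real \<Rightarrow> real \<Rightarrow> nat \<Rightarrow> real \<Rightarrow> (nat \<Rightarrow> real) \<Rightarrow> (nat \<Rightarrow> real) set" where
  "info_below N P n r x = {y \<in> space (Rn n). gd N n x y < exp (real n * r) * gd (P + N) n (\<lambda>_. 0) y}"

lemma info_below_sets [measurable]: "info_below N P n r x \<in> sets (Rn n)"
  unfolding info_below_def by measurable

lemma awgn_info_lower:
  assumes "P > 0" "N > 0" "\<eta> > 0"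
  obtains c t where "c > 0" "t > 0"
    "\<And>n x. nsq n x \<ge> real n * (P - t) \<Longrightarrow>
      measure (awgn N n x) (info_below N P n (awgn_capacity P N - \<eta>) x) \<le> exp (- real n * c)"
proof
  define T where "T = P + N"
  \<comment> \<open>The tilt is now -\<beta>, and the event gains n \<beta> T \<eta>. The conditions
    t \<le> T \<eta> / 4 and \<beta> P \<le> \<eta> / 4 keep the cost \<open>e\<close> at half of
    this gain. The bound 1 / (2 T) on \<beta> keeps k at least 1/2 and the coefficient of
    \<open>nsq n x\<close> negative.\<close>
  define t where "t = min (P / 2) (T * \<eta> / 4)"
  define \<beta> where "\<beta> = min (\<eta> / (4 * P)) (1 / (2 * T))"
  have T: "T > 0" "T > P" using assms by (auto simp: T_def)
  have t: "t > 0" using assms T by (auto simp: t_def)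
  have tP: "P - t \<ge> 0" and tT: "t \<le> T * \<eta> / 4" using assms by (auto simp: t_def)
  have \<beta>: "\<beta> > 0" using assms T by (auto simp: \<beta>_def)
  have "\<beta> * T \<le> 1 / (2 * T) * T" using T by (intro mult_right_mono) (auto simp: \<beta>_def)
  then have bT: "\<beta> * T \<le> 1 / 2" using T by simp
  have "\<beta> * P \<le> \<beta> * T" using T \<beta> by simp
  then have bP: "\<beta> * P \<le> 1 / 2" using bT by simp
  have "\<beta> * P \<le> \<eta> / (4 * P) * P" using assms by (intro mult_right_mono) (auto simp: \<beta>_def)
  then have bP2: "\<beta> * P \<le> \<eta> / 4" using assms by simp
  show "\<beta> * T * \<eta> / 2 > 0" using \<beta> T assms by simp
  show "t > 0" by (rule t)
  fix n x assume x: "nsq n x \<ge> real n * (P - t)"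
  define k where "k = 1 - \<beta> * P"
  have k: "k \<ge> 1 / 2" "k > 0" using bP by (auto simp: k_def)
  then have c: "1 + (- \<beta>) * P > 0" by (simp add: k_def)
  have l: "- ln k \<le> \<beta> * P / k" using ln_ge_frac[OF c] k by (simp add: k_def)
  have "- real n * ln k / 2 + (- \<beta>) * (1 + (- \<beta>) * T) / (2 * k) * nsq n x
     = real n / 2 * (- ln k) - \<beta> * (1 - \<beta> * T) / (2 * k) * nsq n x"
    by simp
  also have "\<dots> \<le> real n / 2 * (\<beta> * P / k) - \<beta> * (1 - \<beta> * T) / (2 * k) * (real n * (P - t))"
    using l x \<beta> bT k by (intro diff_mono mult_left_mono) auto
  also have "\<dots> = real n * \<beta> * ((t + \<beta> * T * (P - t)) / (2 * k))"
    using k by (simp add: field_simps)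
  also have "\<dots> \<le> real n * \<beta> * ((t + \<beta> * T * (P - t)) / 1)"
    using k t tP \<beta> T by (intro mult_left_mono divide_left_mono) auto
  also have "\<dots> \<le> real n * \<beta> * (T * \<eta> / 4 + T * (\<eta> / 4))"
  proof -
    have "\<beta> * T * (P - t) \<le> T * (\<beta> * P)" using t \<beta> T by (simp add: mult_ac)
    also have "\<dots> \<le> T * (\<eta> / 4)" using bP2 T by (intro mult_left_mono) auto
    finally show ?thesis using tT \<beta> by (intro mult_left_mono) auto
  qed
  also have "\<dots> = real n * (\<beta> * T * \<eta> / 2)" by simp
  finally have e: "- real n * ln (1 + (- \<beta>) * P) / 2 + (- \<beta>) * (1 + (- \<beta>) * (P + N)) / (2 * (1 + (- \<beta>) * P)) * nsq n x
      \<le> real n * (\<beta> * T * \<eta> / 2)" by (simp add: T_def k_def)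
  show "measure (awgn N n x) (info_below N P n (awgn_capacity P N - \<eta>) x) \<le> exp (- real n * (\<beta> * T * \<eta> / 2))"
  proof (rule awgn_le_const[where v' = "N / (1 + (- \<beta>) * P)" and x' = "\<lambda>i. (1 + (- \<beta>) * (P + N)) / (1 + (- \<beta>) * P) * x i"])
    fix y assume "y \<in> info_below N P n (awgn_capacity P N - \<eta>) x"
    then have "exp (real n * (awgn_capacity P N - \<eta>)) * gd (P + N) n (\<lambda>_. 0) y >
       exp (real n * awgn_capacity P N + (nsq n y / (P + N) - sqd n x y / N) / 2) * gd (P + N) n (\<lambda>_. 0) y"
      using gd_ratio_zero[OF assms(1,2)] by (simp add: info_below_def)
    then have "real n * \<eta> \<le> - (nsq n y / T - sqd n x y / N) / 2"
      using assms by (simp add: T_def right_diff_distrib)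
    then have "\<beta> * T * (real n * \<eta>) \<le> \<beta> * T * (- (nsq n y / T - sqd n x y / N) / 2)"
      using \<beta> T by (intro mult_left_mono) auto
    also have "\<dots> = (- \<beta>) / 2 * (nsq n y - (P + N) * sqd n x y / N)"
      using T by (simp add: T_def[symmetric] right_diff_distrib)
    finally have a: "real n * (\<beta> * T * \<eta>) \<le> (- \<beta>) / 2 * (nsq n y - (P + N) * sqd n x y / N)"
      by (simp add: mult_ac)
    have id: "real n * (\<beta> * T * \<eta> / 2) - real n * (\<beta> * T * \<eta>) = - real n * (\<beta> * T * \<eta> / 2)" by simp
    show "gd N n x y \<le> exp (- real n * (\<beta> * T * \<eta> / 2)) *
       gd (N / (1 + (- \<beta>) * P)) n (\<lambda>i. (1 + (- \<beta>) * (P + N)) / (1 + (- \<beta>) * P) * x i) y"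
      using gd_tilt_le[OF assms(2) c a e] unfolding id .
  qed (use assms c in auto)
qed

section \<open>Concentration of the squared distance to the centre\<close>

text \<open>The ratio of the densities with variances v and v' is monotone in
  \<open>sqd n x y\<close>, so on the side selected by the sign condition it is at most its value at
  squared distance n v'. The condition treats both tails at once. The rate is the relative entropy
  of the centred normal law of variance v' with respect to that of variance v.\<close>

lemma awgn_sqd_tail:
  assumes v: "v > 0" "v' > 0" and B: "B \<in> sets (Rn n)"
    and le: "\<And>y. y \<in> B \<Longrightarrow> (sqd n x y - real n * v') * (1 / v - 1 / v') \<ge> 0"
  shows "measure (awgn v n x) B \<le> exp (- real n * ((v' / v - 1 - ln (v' / v)) / 2))"
proof (rule awgn_le_const[OF v B])
  fix y assume "y \<in> B"
  have "(sqd n x y - real n * v') * (1 / v - 1 / v') = sqd n x y / v - sqd n x y / v' - real n * (v' / v) + real n"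
    using v by (simp add: field_simps)
  with le[OF \<open>y \<in> B\<close>] have *: "sqd n x y / v' + real n * (v' / v) - real n \<le> sqd n x y / v"
    by simp
  have "ln (2 * pi * v') = ln (2 * pi * v) + ln (v' / v)"
    using v by (subst ln_mult_pos[symmetric]) auto
  moreover have "- (real n * L + B) / 2 \<le> - real n * ((r - 1 - l) / 2) + - (real n * L' + A) / 2"
    if "A + real n * r - real n \<le> B" "L' = L + l" for A B r l L L' :: real
    using that by (simp add: field_simps)
  ultimately have "- (real n * ln (2 * pi * v) + sqd n x y / v) / 2 \<le>
      - real n * ((v' / v - 1 - ln (v' / v)) / 2) + - (real n * ln (2 * pi * v') + sqd n x y / v') / 2"
    using * by blast
  then show "gd v n x y \<le> exp (- real n * ((v' / v - 1 - ln (v' / v)) / 2)) * gd v' n x y"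
    unfolding gd_exp[OF v(1)] gd_exp[OF v(2)] exp_add[symmetric] exp_le_cancel_iff .
qed auto

lemma tail_exponent_pos:
  assumes "v > 0" "v' > 0" "v \<noteq> (v'::real)"
  shows "(v' / v - 1 - ln (v' / v)) / 2 > 0"
proof -
  have "ln (v' / v) \<noteq> v' / v - 1"
    using ln_eq_minus_one[of "v' / v"] assms by auto
  then show ?thesis using ln_le_minus_one[of "v' / v"] assms by (simp add: less_le)
qed

lemma awgn_upper_tail:
  assumes v: "0 < v" "v < v'"
  obtains c where "c > 0"
    "\<And>n x. measure (awgn v n x) {y \<in> space (Rn n). sqd n x y \<ge> real n * v'} \<le> exp (- real n * c)"
proof
  show "(v' / v - 1 - ln (v' / v)) / 2 > 0" by (rule tail_exponent_pos) (use v in auto)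
  fix n x
  show "measure (awgn v n x) {y \<in> space (Rn n). sqd n x y \<ge> real n * v'} \<le>
    exp (- real n * ((v' / v - 1 - ln (v' / v)) / 2))"
  proof (rule awgn_sqd_tail)
    fix y assume "y \<in> {y \<in> space (Rn n). sqd n x y \<ge> real n * v'}"
    then show "0 \<le> (sqd n x y - real n * v') * (1 / v - 1 / v')"
      using v by (intro mult_nonneg_nonneg) (auto simp: field_simps)
  qed (use v in auto)
qed

lemma awgn_lower_tail:
  assumes v: "0 < v'" "v' < v"
  obtains c where "c > 0"
    "\<And>n x. measure (awgn v n x) {y \<in> space (Rn n). sqd n x y \<le> real n * v'} \<le> exp (- real n * c)"
proof
  show "(v' / v - 1 - ln (v' / v)) / 2 > 0" by (rule tail_exponent_pos) (use v in auto)
  fix n x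
  show "measure (awgn v n x) {y \<in> space (Rn n). sqd n x y \<le> real n * v'} \<le>
    exp (- real n * ((v' / v - 1 - ln (v' / v)) / 2))"
  proof (rule awgn_sqd_tail)
    fix y assume "y \<in> {y \<in> space (Rn n). sqd n x y \<le> real n * v'}"
    then show "0 \<le> (sqd n x y - real n * v') * (1 / v - 1 / v')"
      using v by (intro mult_nonpos_nonpos) (auto simp: field_simps)
  qed (use v in auto)
qed

section \<open>Transmission codes\<close>

lemma awgn_Diff:
  assumes "v > 0" "B \<in> sets (Rn n)"
  shows "measure (awgn v n x) (space (Rn n) - B) = 1 - measure (awgn v n x) B"
  using prob_space.prob_compl[OF prob_space_awgn[OF assms(1)], of B n x] assms by simp

text \<open>The room between P' and P lets a Gaussian input of variance P' meet the power constraint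
  P except with exponentially small probability, without giving up the rate R.\<close>

lemma ex_lower_power:
  assumes "P > 0" "N > 0" and R: "R < awgn_capacity P N"
  obtains P' where "0 < P'" "P' < P" "R < awgn_capacity P' N"
proof -
  define R' where "R' = (R + awgn_capacity P N) / 2"
  \<comment> \<open>\<open>N * (exp (2 * R') - 1)\<close> is the power whose capacity is R'; the
    alternative P / 2 keeps P' positive when R' is not.\<close>
  define P' where "P' = max (P / 2) (N * (exp (2 * R') - 1))"
  have R': "R < R'" "R' < awgn_capacity P N" using R by (auto simp: R'_def)
  have "exp (2 * R') < exp (ln (1 + P / N))" using R'(2) by (subst exp_less_cancel_iff) simp
  then have "exp (2 * R') < 1 + P / N" using assms by (simp add: add_pos_pos)
  then have lt: "P' < P" using assms by (simp add: P'_def field_simps)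
  have pos: "P' > 0" using assms by (simp add: P'_def less_max_iff_disj)
  have "N * (exp (2 * R') - 1) \<le> P'" by (simp add: P'_def)
  then have "exp (2 * R') \<le> 1 + P' / N" using assms by (simp add: field_simps)
  then have "2 * R' \<le> ln (1 + P' / N)"
    using pos assms by (subst ln_ge_iff) (auto simp: add_pos_pos)
  then show thesis using R' pos lt by (intro that) auto
qed

text \<open>If no further codeword fits, each x in G loses more than \<epsilon> - \<tau> of its set
  \<open>E x\<close> to the region U already occupied. Hence U has mass at least \<gamma>
  (\<epsilon> - \<tau>) under q, the output of Q. But U is covered by m sets of q-mass at most
  \<beta>, which is too little.\<close>

lemma feinstein:
  assumes "prob_space Q" "sets Q = sets (Rn n)" "N > 0" "prob_space q" "sets q = sets (Rn n)"
    and out: "\<And>B. B \<in> sets (Rn n) \<Longrightarrow> (\<integral>\<^sup>+x. ennreal (measure (awgn N n x) B) \<partial>Q) = emeasure q B"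
    and G: "G \<in> sets (Rn n)" "measure Q G \<ge> \<gamma>"
    and E: "\<And>x. x \<in> G \<Longrightarrow> E x \<in> sets (Rn n)" "\<And>x. x \<in> G \<Longrightarrow> measure (awgn N n x) (E x) \<ge> 1 - \<tau>"
      "\<And>x. x \<in> G \<Longrightarrow> measure q (E x) \<le> \<beta>"
    and \<beta>: "\<beta> > 0" "\<tau> < \<epsilon>" and M: "real M * \<beta> \<le> \<gamma> * (\<epsilon> - \<tau>)"
  shows "\<exists>\<phi> D. (\<forall>i<M. \<phi> i \<in> G \<and> D i \<in> sets (Rn n) \<and> D i \<subseteq> E (\<phi> i) \<and> measure (awgn N n (\<phi> i)) (D i) \<ge> 1 - \<epsilon>)
    \<and> disjoint_family_on D {..<M}"
  using M
proof (induction M)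
  case 0
  show ?case by (auto simp: disjoint_family_on_def)
next
  case (Suc m)
  interpret Q: prob_space Q by fact
  interpret q: prob_space q by fact
  \<comment> \<open>The budget was granted for m + 1 words; the spare summand \<beta> makes the
    inequality for m words strict.\<close>
  have "real m * \<beta> < real (Suc m) * \<beta>" using \<beta> by simp
  with Suc have lt: "real m * \<beta> < \<gamma> * (\<epsilon> - \<tau>)" by linarith
  with Suc obtain \<phi> D where D: "\<And>i. i < m \<Longrightarrow> \<phi> i \<in> G" "\<And>i. i < m \<Longrightarrow> D i \<in> sets (Rn n)"
      "\<And>i. i < m \<Longrightarrow> D i \<subseteq> E (\<phi> i)" "\<And>i. i < m \<Longrightarrow> measure (awgn N n (\<phi> i)) (D i) \<ge> 1 - \<epsilon>"
    and disj: "disjoint_family_on D {..<m}" by auto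
  define U where "U = (\<Union>i<m. D i)"
  have U [measurable]: "U \<in> sets (Rn n)" unfolding U_def using D(2) by auto
  have "measure q U \<le> (\<Sum>i<m. measure q (D i))"
    unfolding U_def by (intro measure_UNION_le) (use D(2) assms in auto)
  also have "\<dots> \<le> (\<Sum>i<m. \<beta>)"
    using D E assms(5) by (intro sum_mono order.trans[OF q.finite_measure_mono E(3)]) auto
  finally have qU: "measure q U \<le> real m * \<beta>" by simp
  have "\<exists>x\<in>G. measure (awgn N n x) (E x - U) \<ge> 1 - \<epsilon>"
  proof (rule ccontr)
    assume "\<not> ?thesis"
    then have small: "measure (awgn N n x) (E x - U) < 1 - \<epsilon>" if "x \<in> G" for x using that by force
    have ge: "measure (awgn N n x) U \<ge> \<epsilon> - \<tau>" if x: "x \<in> G" for x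
    proof -
      interpret W: prob_space "awgn N n x" by (rule prob_space_awgn) fact
      have "measure (awgn N n x) (E x) \<le> measure (awgn N n x) ((E x - U) \<union> U)"
        using E(1)[OF x] by (intro W.finite_measure_mono) auto
      also have "\<dots> \<le> measure (awgn N n x) (E x - U) + measure (awgn N n x) U"
        using E(1)[OF x] by (intro measure_Un_le) auto
      finally show ?thesis using E(2)[OF x] small[OF x] by linarith
    qed
    have "ennreal (\<epsilon> - \<tau>) * emeasure Q G = (\<integral>\<^sup>+x. ennreal (\<epsilon> - \<tau>) * indicator G x \<partial>Q)"
      using G(1) assms(2) by (subst nn_integral_cmult_indicator) auto
    also have "\<dots> \<le> (\<integral>\<^sup>+x. ennreal (measure (awgn N n x) U) \<partial>Q)"
      by (intro nn_integral_mono) (auto simp: indicator_def intro!: ennreal_leI ge)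
    also have "\<dots> = emeasure q U" by (rule out) simp
    finally have "(\<epsilon> - \<tau>) * measure Q G \<le> measure q U"
      using \<beta> by (simp add: Q.emeasure_eq_measure q.emeasure_eq_measure ennreal_mult[symmetric])
    moreover have "\<gamma> * (\<epsilon> - \<tau>) \<le> (\<epsilon> - \<tau>) * measure Q G"
      using G \<beta> by (subst mult.commute) (intro mult_left_mono, auto)
    ultimately show False using qU lt by linarith
  qed
  then obtain x where x: "x \<in> G" "measure (awgn N n x) (E x - U) \<ge> 1 - \<epsilon>" by auto
  show ?case
  proof (intro exI conjI allI impI)
    fix i assume i: "i < Suc m"
    show "(\<phi>(m := x)) i \<in> G" "(D(m := E x - U)) i \<in> sets (Rn n)"
      "(D(m := E x - U)) i \<subseteq> E ((\<phi>(m := x)) i)"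
      "1 - \<epsilon> \<le> measure (awgn N n ((\<phi>(m := x)) i)) ((D(m := E x - U)) i)"
      using i D x E(1)[OF x(1)] by (auto simp: less_Suc_eq)
  next
    have new: "D i \<inter> (E x - U) = {}" "(E x - U) \<inter> D i = {}" if "i < m" for i
      using that by (auto simp: U_def)
    have old: "D i \<inter> D j = {}" if "i < m" "j < m" "i \<noteq> j" for i j
      using disj that by (simp add: disjoint_family_on_def)
    show "disjoint_family_on (D(m := E x - U)) {..<Suc m}"
      unfolding disjoint_family_on_def lessThan_iff less_Suc_eq using new old by force
  qed
qed

text \<open>The factor n + 1 is there so that exponential terms can be compared with error
  probabilities of order 1 / (n + 1).\<close>

lemma eventually_exp_small:
  assumes "(c::real) > 0" "K > 0"
  shows "eventually (\<lambda>n. exp (- real n * c) * (real n + 1) \<le> K) sequentially"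
proof -
  have "(\<lambda>n. exp (- real n * c) * (real n + 1)) \<longlonglongrightarrow> 0" using assms(1) by real_asymp
  from order_tendstoD(2)[OF this assms(2)] show ?thesis by eventually_elim simp
qed

text \<open>One threshold for n serves all sizes M at once; identification later asks for M of the
  form \<open>L * 4 ^ s\<close>. The maximal error is prescribed as 1 / (n + 1), which vanishes but
  decays slower than every exponential term.\<close>

lemma max_error_codes:
  assumes "P > 0" "N > 0" and R: "R < awgn_capacity P N"
  shows "eventually (\<lambda>n. \<forall>M. real M \<le> exp (real n * R) \<longrightarrow>
    (\<exists>\<phi> D. (\<forall>i<M. \<phi> i \<in> cost_set n P \<and> D i \<in> sets (Rn n) \<and>
        measure (awgn N n (\<phi> i)) (D i) \<ge> 1 - 1 / (real n + 1)) \<and> disjoint_family_on D {..<M})) sequentially"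
proof -
  obtain P' where P': "0 < P'" "P' < P" "R < awgn_capacity P' N"
    using ex_lower_power[OF assms] by blast
  define \<eta> where "\<eta> = (awgn_capacity P' N - R) / 2"
  have \<eta>: "\<eta> > 0" "awgn_capacity P' N - \<eta> = R + \<eta>" using P' by (auto simp: \<eta>_def field_simps)
  obtain c t where ct: "c > 0" "t > 0" and low: "\<And>n x. nsq n x \<ge> real n * (P' - t) \<Longrightarrow>
      measure (awgn N n x) (info_below N P' n (R + \<eta>) x) \<le> exp (- real n * c)"
    using awgn_info_lower[OF P'(1) assms(2) \<eta>(1)] unfolding \<eta>(2) by blast
  define t' where "t' = min t (P' / 2)"
  have t': "t' > 0" "t' < P'" "t' \<le> t" using ct P' by (auto simp: t'_def)
  obtain c1 where c1: "c1 > 0" and up1: "\<And>n x. measure (awgn P' n x) {y \<in> space (Rn n). sqd n x y \<ge> real n * P} \<le> exp (- real n * c1)"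
    using awgn_upper_tail[OF P'(1,2)] by blast
  obtain c2 where c2: "c2 > 0" and up2: "\<And>n x. measure (awgn P' n x) {y \<in> space (Rn n). sqd n x y \<le> real n * (P' - t')} \<le> exp (- real n * c2)"
    using awgn_lower_tail[of "P' - t'" P'] t' by auto
  have "eventually (\<lambda>n. exp (- real n * c1) * (real n + 1) \<le> 1 / 4) sequentially"
       "eventually (\<lambda>n. exp (- real n * c2) * (real n + 1) \<le> 1 / 4) sequentially"
       "eventually (\<lambda>n. exp (- real n * c) * (real n + 1) \<le> 1 / 2) sequentially"
       "eventually (\<lambda>n. exp (- real n * \<eta>) * (real n + 1) \<le> 1 / 4) sequentially"
    by (intro eventually_exp_small; use c1 c2 ct \<eta> in simp)+
  then show ?thesis
  proof eventually_elim
    case (elim n)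
    have e1: "exp (- real n * c1) \<le> 1 / 4" "exp (- real n * c2) \<le> 1 / 4"
    proof -
      have "exp (- real n * a) \<le> exp (- real n * a) * (real n + 1)" for a by simp
      from this[of c1] this[of c2] show "exp (- real n * c1) \<le> 1 / 4" "exp (- real n * c2) \<le> 1 / 4"
        using elim(1,2) by linarith+
    qed
    \<comment> \<open>The shell reaches up to the true power P, so its points are admissible
      codewords, and down to P' - t', where the lower bound on the information density for power P'
      still applies.\<close>
    define G where "G = {x \<in> space (Rn n). real n * (P' - t') \<le> nsq n x \<and> nsq n x \<le> real n * P}"
    define Q where "Q = awgn P' n (\<lambda>_. 0)"
    define q where "q = awgn (P' + N) n (\<lambda>_. 0)"
    define E where "E = (\<lambda>x. space (Rn n) - info_below N P' n (R + \<eta>) x)"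
    have PN: "P' + N > 0" using P' assms by simp
    interpret Q: prob_space Q unfolding Q_def by (rule prob_space_awgn) fact
    interpret q: prob_space q unfolding q_def by (rule prob_space_awgn) fact
    have sets: "sets Q = sets (Rn n)" "sets q = sets (Rn n)" by (auto simp: Q_def q_def)
    have G [measurable]: "G \<in> sets (Rn n)" unfolding G_def by measurable
    have "space Q - G \<subseteq> {y \<in> space (Rn n). sqd n (\<lambda>_. 0) y \<ge> real n * P} \<union> {y \<in> space (Rn n). sqd n (\<lambda>_. 0) y \<le> real n * (P' - t')}"
      by (auto simp: G_def Q_def)
    then have "measure Q (space Q - G) \<le> measure Q ({y \<in> space (Rn n). sqd n (\<lambda>_. 0) y \<ge> real n * P} \<union> {y \<in> space (Rn n). sqd n (\<lambda>_. 0) y \<le> real n * (P' - t')})"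
      by (intro Q.finite_measure_mono) (auto simp: sets)
    also have "\<dots> \<le> measure Q {y \<in> space (Rn n). sqd n (\<lambda>_. 0) y \<ge> real n * P} + measure Q {y \<in> space (Rn n). sqd n (\<lambda>_. 0) y \<le> real n * (P' - t')}"
      by (intro measure_Un_le) (auto simp: sets)
    also have "\<dots> \<le> 1 / 4 + 1 / 4"
      using up1[of n "\<lambda>_. 0"] up2[of n "\<lambda>_. 0"] e1 unfolding Q_def by linarith
    finally have QG: "measure Q G \<ge> 1 / 2"
      using Q.prob_compl[of G] sets by simp
    show ?case
    proof (intro allI impI)
      fix M :: nat assume M: "real M \<le> exp (real n * R)"
      have "\<exists>\<phi> D. (\<forall>i<M. \<phi> i \<in> G \<and> D i \<in> sets (Rn n) \<and> D i \<subseteq> E (\<phi> i) \<and>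
           measure (awgn N n (\<phi> i)) (D i) \<ge> 1 - 1 / (real n + 1)) \<and> disjoint_family_on D {..<M}"
      proof (rule feinstein)
        show "measure Q G \<ge> 1 / 2" by (rule QG)
        show "(\<integral>\<^sup>+ x. ennreal (measure (awgn N n x) B) \<partial>Q) = emeasure q B" if "B \<in> sets (Rn n)" for B
          unfolding Q_def q_def by (rule QW_gauss) (use assms P' that in auto)
        show "E x \<in> sets (Rn n)" for x unfolding E_def by simp
        show "1 - exp (- real n * c) \<le> measure (awgn N n x) (E x)" if "x \<in> G" for x
        proof -
          have "real n * (P' - t) \<le> real n * (P' - t')" using t' by (intro mult_left_mono) auto
          also have "\<dots> \<le> nsq n x" using that by (simp add: G_def)
          finally show ?thesis using low[of n x] assms(2) by (simp add: E_def awgn_Diff)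
        qed
        \<comment> \<open>Change of measure: on \<open>E x\<close> the density of q is at most
          exp(-n (R + \<eta>)) times the channel density, which has total mass 1.\<close>
        show "measure q (E x) \<le> exp (- (real n * (R + \<eta>)))" for x
          unfolding q_def
        proof (rule awgn_le_const[where v' = N and x' = x])
          fix y assume "y \<in> E x"
          then have "exp (real n * (R + \<eta>)) * gd (P' + N) n (\<lambda>_. 0) y \<le> gd N n x y"
            by (auto simp: E_def info_below_def)
          then show "gd (P' + N) n (\<lambda>_. 0) y \<le> exp (- (real n * (R + \<eta>))) * gd N n x y"
            unfolding exp_minus by (simp add: field_simps)
        qed (use PN assms in \<open>auto simp: E_def\<close>)
        show "exp (- real n * c) < 1 / (real n + 1)"
        proof -
          have "exp (- real n * c) * (real n + 1) < 1" using elim(3) by linarith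
          then show ?thesis by (simp add: field_simps)
        qed
        have "real M * exp (- (real n * (R + \<eta>))) \<le> exp (real n * R) * exp (- (real n * (R + \<eta>)))"
          using M by (intro mult_right_mono) auto
        also have "\<dots> = exp (- real n * \<eta>)" by (simp add: exp_add[symmetric] algebra_simps)
        also have "\<dots> \<le> 1 / 4 / (real n + 1)" using elim(4) by (simp add: field_simps)
        \<comment> \<open>This is the budget \<open>\<gamma> * (\<epsilon> - \<tau>)\<close> with
          \<gamma> = 1/2 and \<epsilon> = 1 / (n + 1), half of \<epsilon> being reserved for
          \<tau>.\<close>
        also have "\<dots> = 1 / 2 * (1 / (real n + 1) - 1 / 2 / (real n + 1))" by (simp add: field_simps)
        also have "\<dots> \<le> 1 / 2 * (1 / (real n + 1) - exp (- real n * c))"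
        proof -
          have "exp (- real n * c) \<le> 1 / 2 / (real n + 1)" using elim(3) by (subst pos_le_divide_eq) auto
          then show ?thesis by simp
        qed
        finally show "real M * exp (- (real n * (R + \<eta>))) \<le> 1 / 2 * (1 / (real n + 1) - exp (- real n * c))" .
      qed (use sets assms Q.prob_space_axioms q.prob_space_axioms in auto)
      moreover have "G \<subseteq> cost_set n P" using assms by (auto simp: G_def intro: cost_setI)
      ultimately show "\<exists>\<phi> D. (\<forall>i<M. \<phi> i \<in> cost_set n P \<and> D i \<in> sets (Rn n) \<and>
           measure (awgn N n (\<phi> i)) (D i) \<ge> 1 - 1 / (real n + 1)) \<and> disjoint_family_on D {..<M}"
        by blast
    qed
  qed
qed

lemma eventually_gt_liminf:
  assumes "ereal R \<le> liminf (\<lambda>n. ereal (f n))" "r < R"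
  shows "eventually (\<lambda>n. r < f n) sequentially"
proof -
  have "ereal r < liminf (\<lambda>n. ereal (f n))" using assms by (intro less_le_trans[OF _ assms(1)]) simp
  from less_LiminfD[OF this] show ?thesis by simp
qed

lemma eventually_lt_limsup:
  assumes "limsup (\<lambda>n. ereal (f n)) \<le> ereal R" "R < r"
  shows "eventually (\<lambda>n. f n < r) sequentially"
proof -
  have "limsup (\<lambda>n. ereal (f n)) < ereal r" using assms by (intro le_less_trans[OF assms(1)]) simp
  from Limsup_lessD[OF this] show ?thesis by simp
qed

lemma limsup_le_of_tendsto:
  assumes "eventually (\<lambda>n. f n \<le> g n) sequentially" "g \<longlonglongrightarrow> (a::real)" "a \<le> b"
  shows "limsup (\<lambda>n. ereal (f n)) \<le> ereal b"
proof -
  have "limsup (\<lambda>n. ereal (f n)) \<le> limsup (\<lambda>n. ereal (g n))"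
    by (intro Limsup_mono) (use assms(1) in simp)
  also have "\<dots> = ereal a" using assms(2) by (intro lim_imp_Limsup) auto
  finally show ?thesis using assms(3) by (metis ereal_less_eq(3) order_trans)
qed

lemma awgn_capacity_nonneg: "P > 0 \<Longrightarrow> N > 0 \<Longrightarrow> 0 < awgn_capacity P N"
  by (simp add: ln_gt_zero)

lemma zero_in_cost_set: "P > 0 \<Longrightarrow> (\<lambda>i\<in>{..<n}. 0) \<in> cost_set n P"
  by (auto simp: cost_set_def Rn_def space_PiM)

lemma floor_exp_bounds:
  assumes "x \<ge> 0"
  shows "nat \<lfloor>exp x\<rfloor> \<ge> 1" "real (nat \<lfloor>exp x\<rfloor>) \<le> exp x" "exp x / 2 \<le> real (nat \<lfloor>exp x\<rfloor>)"
proof -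
  have e: "exp x \<ge> (1::real)" using assms by simp
  then show 1: "nat \<lfloor>exp x\<rfloor> \<ge> 1" by (simp add: le_nat_iff)
  show "real (nat \<lfloor>exp x\<rfloor>) \<le> exp x" using e by (simp add: of_nat_nat)
  have "real (nat \<lfloor>exp x\<rfloor>) \<ge> exp x - 1" using e by (simp add: of_nat_nat)
  moreover have "real (nat \<lfloor>exp x\<rfloor>) \<ge> 1" using 1 by linarith
  ultimately show "exp x / 2 \<le> real (nat \<lfloor>exp x\<rfloor>)" by linarith
qed

lemma tx_code_of_sets:
  assumes "N > 0" "M \<ge> 1" and \<phi>: "\<And>i. i < M \<Longrightarrow> \<phi> i \<in> cost_set n P"
    and D: "\<And>i. i < M \<Longrightarrow> D i \<in> sets (Rn n)" "disjoint_family_on D {..<M}"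
    and err: "\<And>i. i < M \<Longrightarrow> measure (awgn N n (\<phi> i)) (D i) \<ge> 1 - \<epsilon>"
  shows "\<exists>\<phi> \<psi> e. tx_code N n M e P \<phi> \<psi> \<and> e \<le> \<epsilon>"
proof -
  \<comment> \<open>The alternative \<open>M \<le> Suc i\<close> stops the search at M - 1, so
    outputs outside all decoding sets are sent to message M and the decoder is total. The outer
    \<open>Suc\<close> passes from indices below M to messages in 1..M.\<close>
  define \<psi> where "\<psi> = (\<lambda>y. Suc (LEAST i. M \<le> Suc i \<or> (i < M \<and> y \<in> D i)))"
  define \<phi>' where "\<phi>' = (\<lambda>i. \<phi> (i - 1))"
  define e where "e = (\<Sum>i=1..M. measure (awgn N n (\<phi>' i)) (space (Rn n) - \<psi> -` {i})) / real M"
  have meas: "(\<lambda>y. i < M \<and> y \<in> D i) \<in> measurable (Rn n) (count_space UNIV)" for i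
    using D(1)[of i] by (cases "i < M") auto
  have \<psi>_meas [measurable]: "\<psi> \<in> measurable (Rn n) (count_space UNIV)"
    unfolding \<psi>_def using meas by measurable
  have \<psi>_le: "\<psi> y \<in> {1..M}" for y
  proof -
    have "(LEAST i. M \<le> Suc i \<or> (i < M \<and> y \<in> D i)) \<le> M - 1" using assms(2) by (intro Least_le) auto
    then show ?thesis using assms(2) by (auto simp: \<psi>_def)
  qed
  have \<psi>_eq: "\<psi> y = Suc i" if i: "i < M" and y: "y \<in> D i" for i y
  proof -
    have "(LEAST i. M \<le> Suc i \<or> (i < M \<and> y \<in> D i)) = i"
    proof (rule Least_equality)
      fix j assume j: "M \<le> Suc j \<or> (j < M \<and> y \<in> D j)"
      show "i \<le> j"
      proof (cases "j < M \<and> y \<in> D j")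
        case True
        then have "i = j" using D(2) i y by (auto simp: disjoint_family_on_def)
        then show ?thesis by simp
      qed (use i j in auto)
    qed (use i y in auto)
    then show ?thesis by (simp add: \<psi>_def)
  qed
  have "measure (awgn N n (\<phi>' i)) (space (Rn n) - \<psi> -` {i}) \<le> \<epsilon>" if i: "i \<in> {1..M}" for i
  proof -
    interpret prob_space "awgn N n (\<phi>' i)" by (rule prob_space_awgn) fact
    have im: "i - 1 < M" "Suc (i - 1) = i" using i by auto
    have "space (Rn n) - (\<psi> -` {i} \<inter> space (Rn n)) \<in> sets (Rn n)" by measurable
    moreover have "space (Rn n) - (\<psi> -` {i} \<inter> space (Rn n)) = space (Rn n) - \<psi> -` {i}" by auto
    ultimately have V: "space (Rn n) - \<psi> -` {i} \<in> sets (Rn n)" by simp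
    have "measure (awgn N n (\<phi>' i)) (space (Rn n) - \<psi> -` {i}) \<le> measure (awgn N n (\<phi>' i)) (space (Rn n) - D (i - 1))"
      using \<psi>_eq[OF im(1)] im(2) V D(1)[OF im(1)] by (intro finite_measure_mono) auto
    also have "\<dots> \<le> \<epsilon>" using err[OF im(1)] awgn_Diff[OF assms(1) D(1)[OF im(1)]] by (simp add: \<phi>'_def)
    finally show ?thesis .
  qed
  then have "(\<Sum>i=1..M. measure (awgn N n (\<phi>' i)) (space (Rn n) - \<psi> -` {i})) \<le> (\<Sum>i=1..M. \<epsilon>)"
    by (rule sum_mono)
  then have "e \<le> \<epsilon>" using assms(2) by (simp add: e_def field_simps)
  moreover have "tx_code N n M e P \<phi>' \<psi>"
    unfolding tx_code_def using assms(2) \<phi> \<psi>_meas \<psi>_le by (auto simp: e_def \<phi>'_def)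
  ultimately show ?thesis by blast
qed

lemma Cs_achievable_below_capacity:
  assumes "P > 0" "N > 0" "eps \<ge> 0" and R: "R < awgn_capacity P N"
  shows "Cs_achievable N eps P R"
proof -
  \<comment> \<open>R may be negative, whereas a positive R' makes the floor of exp(n R') at least
    1. The gap between R and R' absorbs the loss of ln 2 from rounding down.\<close>
  obtain R' where R': "max R 0 < R'" "R' < awgn_capacity P N"
    using dense[of "max R 0" "awgn_capacity P N"] R awgn_capacity_nonneg[OF assms(1,2)]
    by (metis max_less_iff_conj)
  define good where "good = (\<lambda>n M e. M = nat \<lfloor>exp (real n * R')\<rfloor> \<and> e \<le> 1 / (real n + 1))"
  have ev: "eventually (\<lambda>n. \<exists>M \<phi> \<psi> e. tx_code N n M e P \<phi> \<psi> \<and> good n M e) sequentially"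
    using max_error_codes[OF assms(1,2) R'(2)]
  proof eventually_elim
    case (elim n)
    have M: "nat \<lfloor>exp (real n * R')\<rfloor> \<ge> 1" "real (nat \<lfloor>exp (real n * R')\<rfloor>) \<le> exp (real n * R')"
      by (intro floor_exp_bounds; use R' in simp)+
    from elim M(2) obtain \<phi> D where D: "\<forall>i<nat \<lfloor>exp (real n * R')\<rfloor>. \<phi> i \<in> cost_set n P \<and> D i \<in> sets (Rn n) \<and>
        measure (awgn N n (\<phi> i)) (D i) \<ge> 1 - 1 / (real n + 1)" "disjoint_family_on D {..<nat \<lfloor>exp (real n * R')\<rfloor>}"
      by blast
    have "\<exists>\<phi> \<psi> e. tx_code N n (nat \<lfloor>exp (real n * R')\<rfloor>) e P \<phi> \<psi> \<and> e \<le> 1 / (real n + 1)"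
      by (rule tx_code_of_sets[where \<phi> = \<phi> and D = D]) (use assms D M in auto)
    then show ?case unfolding good_def by blast
  qed
  \<comment> \<open>Achievability asks for a code at every n. Where the construction does not apply
    yet, a one-message code fills in; this concerns finitely many n and leaves the limits
    unchanged.\<close>
  have triv: "\<exists>M \<phi> \<psi> e. tx_code N n M e P \<phi> \<psi>" for n
  proof -
    have "\<exists>\<phi> \<psi> e. tx_code N n 1 e P \<phi> \<psi> \<and> e \<le> 1"
      by (rule tx_code_of_sets[where \<phi> = "\<lambda>_. \<lambda>i\<in>{..<n}. 0" and D = "\<lambda>_. {}"])
        (use assms zero_in_cost_set in \<open>auto simp: disjoint_family_on_def\<close>)
    then show ?thesis by blast
  qed
  have "\<exists>M \<phi> \<psi> e. tx_code N n M e P \<phi> \<psi> \<and> ((\<exists>M \<phi> \<psi> e. tx_code N n M e P \<phi> \<psi> \<and> good n M e) \<longrightarrow> good n M e)" for n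
    using triv[of n] by blast
  then obtain M \<phi> \<psi> e where code: "\<And>n. tx_code N n (M n) (e n) P (\<phi> n) (\<psi> n)"
    and g: "\<And>n. (\<exists>M \<phi> \<psi> e. tx_code N n M e P \<phi> \<psi> \<and> good n M e) \<longrightarrow> good n (M n) (e n)" by metis
  have good: "eventually (\<lambda>n. good n (M n) (e n)) sequentially"
    using ev by eventually_elim (use g in blast)
  have "limsup (\<lambda>n. ereal (e n)) \<le> ereal eps"
  proof (rule limsup_le_of_tendsto)
    show "eventually (\<lambda>n. e n \<le> 1 / (real n + 1)) sequentially" using good by eventually_elim (simp add: good_def)
    show "(\<lambda>n. 1 / (real n + 1)) \<longlonglongrightarrow> 0" by real_asymp
  qed fact
  moreover have "ereal R \<le> liminf (\<lambda>n. ereal (ln (real (M n)) / real n))"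
  proof (rule Liminf_bounded)
    have "eventually (\<lambda>n. R \<le> R' - ln 2 / real n) sequentially"
    proof -
      have "(\<lambda>n. R' - ln 2 / real n) \<longlonglongrightarrow> R'" by real_asymp
      from order_tendstoD(1)[OF this, of R] R' show ?thesis by (auto elim: eventually_mono)
    qed
    with good eventually_gt_at_top[of 0]
    show "eventually (\<lambda>n. ereal R \<le> ereal (ln (real (M n)) / real n)) sequentially"
    proof eventually_elim
      case (elim n)
      have *: "exp (real n * R') / 2 \<le> real (M n)" "real (M n) > 0"
        using floor_exp_bounds[of "real n * R'"] R' elim(1) unfolding good_def by auto
      have "real n * R' - ln 2 = ln (exp (real n * R') / 2)" by (simp add: ln_div)
      also have "\<dots> \<le> ln (real (M n))" using * by (subst ln_le_cancel_iff) auto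
      finally have "(real n * R' - ln 2) / real n \<le> ln (real (M n)) / real n"
        by (rule divide_right_mono) simp
      then have "R' - ln 2 / real n \<le> ln (real (M n)) / real n"
        using elim(2) by (simp add: diff_divide_distrib)
      with elim show ?case by simp
    qed
  qed
  ultimately show ?thesis unfolding Cs_achievable_def using code by blast
qed

section \<open>Strong converse for transmission\<close>

text \<open>The set of large information density has small channel probability whatever D is; off
  that set the channel density is at most exp(n (capacity + \<eta>)) times the density of the output
  law.\<close>

lemma awgn_le_output:
  assumes "P > 0" "N > 0" "\<eta> > 0" and x: "nsq n x \<le> real n * P" and D [measurable]: "D \<in> sets (Rn n)"
  shows "measure (awgn N n x) D \<le> exp (- real n * ((P + N) * \<eta>\<^sup>2 / (2 * P)))
    + exp (real n * (awgn_capacity P N + \<eta>)) * measure (awgn (P + N) n (\<lambda>_. 0)) D"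
proof -
  define A where "A = info_above N P n (awgn_capacity P N + \<eta>) x"
  have A [measurable]: "A \<in> sets (Rn n)" unfolding A_def by measurable
  interpret W: prob_space "awgn N n x" by (rule prob_space_awgn) fact
  interpret q: prob_space "awgn (P + N) n (\<lambda>_. 0)" by (rule prob_space_awgn) (use assms in simp)
  have "measure (awgn N n x) D \<le> measure (awgn N n x) (A \<union> (D - A))"
    by (intro W.finite_measure_mono) auto
  also have "\<dots> \<le> measure (awgn N n x) A + measure (awgn N n x) (D - A)"
    by (intro measure_Un_le) auto
  also have "measure (awgn N n x) A \<le> exp (- real n * ((P + N) * \<eta>\<^sup>2 / (2 * P)))"
    unfolding A_def by (rule awgn_info_upper[OF assms(1-4)])
  also have "measure (awgn N n x) (D - A) \<le>
      exp (real n * (awgn_capacity P N + \<eta>)) * measure (awgn (P + N) n (\<lambda>_. 0)) (D - A)"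
  proof (rule awgn_le)
    fix y assume y: "y \<in> D - A"
    then have "y \<in> space (Rn n)" using sets.sets_into_space[OF D] by auto
    then show "gd N n x y \<le> exp (real n * (awgn_capacity P N + \<eta>)) * gd (P + N) n (\<lambda>_. 0) y"
      using y by (auto simp: A_def info_above_def not_less)
  qed (use assms in auto)
  also have "measure (awgn (P + N) n (\<lambda>_. 0)) (D - A) \<le> measure (awgn (P + N) n (\<lambda>_. 0)) D"
    by (intro q.finite_measure_mono) auto
  finally show ?thesis by simp
qed

text \<open>The decoding sets are disjoint, so their q-masses sum to at most 1 and the average
  success probability is at most a + K / M. For rates above capacity + \<eta> this tends to 0, which
  yields the converse at every error level below 1.\<close>

lemma tx_code_converse:
  assumes "P > 0" "N > 0" "\<eta> > 0" and code: "tx_code N n M e P \<phi> \<psi>"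
  shows "1 - e \<le> exp (- real n * ((P + N) * \<eta>\<^sup>2 / (2 * P)))
    + exp (real n * (awgn_capacity P N + \<eta>)) / real M"
proof -
  have M: "M \<ge> 1" and \<phi>: "\<And>i. i \<in> {1..M} \<Longrightarrow> \<phi> i \<in> cost_set n P"
    and \<psi> [measurable]: "\<psi> \<in> measurable (Rn n) (count_space UNIV)"
    and e: "e = (\<Sum>i=1..M. measure (awgn N n (\<phi> i)) (space (Rn n) - \<psi> -` {i})) / real M"
    using code by (auto simp: tx_code_def)
  define D where "D = (\<lambda>i. \<psi> -` {i} \<inter> space (Rn n))"
  have D [measurable]: "D i \<in> sets (Rn n)" for i unfolding D_def by measurable
  interpret q: prob_space "awgn (P + N) n (\<lambda>_. 0)" by (rule prob_space_awgn) (use assms in simp)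
  let ?a = "exp (- real n * ((P + N) * \<eta>\<^sup>2 / (2 * P)))"
  let ?K = "exp (real n * (awgn_capacity P N + \<eta>))"
  have "space (Rn n) - \<psi> -` {i} = space (Rn n) - D i" for i by (auto simp: D_def)
  then have "real M * e = (\<Sum>i=1..M. 1 - measure (awgn N n (\<phi> i)) (D i))"
    using M assms by (simp add: e awgn_Diff)
  then have "real M * (1 - e) = (\<Sum>i=1..M. measure (awgn N n (\<phi> i)) (D i))"
    by (simp add: sum_subtractf right_diff_distrib)
  also have "\<dots> \<le> (\<Sum>i=1..M. ?a + ?K * measure (awgn (P + N) n (\<lambda>_. 0)) (D i))"
    using \<phi> assms by (intro sum_mono awgn_le_output cost_set_nsq) auto
  also have "\<dots> = real M * ?a + ?K * (\<Sum>i=1..M. measure (awgn (P + N) n (\<lambda>_. 0)) (D i))"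
    by (simp add: sum.distrib sum_distrib_left)
  also have "(\<Sum>i=1..M. measure (awgn (P + N) n (\<lambda>_. 0)) (D i)) = measure (awgn (P + N) n (\<lambda>_. 0)) (\<Union>i\<in>{1..M}. D i)"
    by (rule q.finite_measure_finite_Union[symmetric]) (auto simp: D_def disjoint_family_on_def)
  also have "real M * ?a + ?K * \<dots> \<le> real M * ?a + ?K * 1"
    by (intro add_left_mono mult_left_mono) auto
  finally show ?thesis using M by (simp add: field_simps)
qed

lemma Cs_achievable_le_capacity:
  assumes "P > 0" "N > 0" "eps < 1" and R: "Cs_achievable N eps P R"
  shows "R \<le> awgn_capacity P N"
proof (rule ccontr)
  assume "\<not> ?thesis"
  then have gt: "awgn_capacity P N < R" by simp
  obtain M \<phi> \<psi> e where code: "\<And>n. tx_code N n (M n) (e n) P (\<phi> n) (\<psi> n)"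
    and e: "limsup (\<lambda>n. ereal (e n)) \<le> ereal eps"
    and M: "ereal R \<le> liminf (\<lambda>n. ereal (ln (real (M n)) / real n))"
    using R unfolding Cs_achievable_def by blast
  \<comment> \<open>One third of the gap each for the truncation level K, for the lower limit of the
    rate, and for the decay of K / M.\<close>
  define \<eta> where "\<eta> = (R - awgn_capacity P N) / 3"
  have \<eta>: "\<eta> > 0" "awgn_capacity P N + \<eta> < R - \<eta>" "R - \<eta> < R" using gt by (auto simp: \<eta>_def field_simps)
  define c where "c = (P + N) * \<eta>\<^sup>2 / (2 * P)"
  have c: "c > 0" using assms \<eta> by (simp add: c_def)
  have d: "(1 - eps) / 4 > 0" using assms by simp
  have "eventually (\<lambda>n. e n < (1 + eps) / 2) sequentially"
    by (rule eventually_lt_limsup[OF e]) (use assms in simp)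
  moreover have "eventually (\<lambda>n. R - \<eta> < ln (real (M n)) / real n) sequentially"
    by (rule eventually_gt_liminf[OF M]) (use \<eta> in simp)
  moreover have "eventually (\<lambda>n. exp (- real n * c) * (real n + 1) \<le> (1 - eps) / 4) sequentially"
     "eventually (\<lambda>n. exp (- real n * (R - \<eta> - (awgn_capacity P N + \<eta>))) * (real n + 1) \<le> (1 - eps) / 4) sequentially"
    by (intro eventually_exp_small; use c d \<eta> in simp)+
  ultimately have "eventually (\<lambda>n::nat. False) sequentially"
    using eventually_gt_at_top[of 0]
  proof eventually_elim
    case (elim n)
    have M1: "real (M n) > 0" using code[of n] by (simp add: tx_code_def)
    have "real n * (R - \<eta>) \<le> ln (real (M n))" using elim by (simp add: field_simps)
    then have M2: "exp (real n * (R - \<eta>)) \<le> real (M n)" using M1 by (metis exp_le_cancel_iff exp_ln)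
    have "exp (real n * (awgn_capacity P N + \<eta>)) / real (M n) \<le>
       exp (real n * (awgn_capacity P N + \<eta>)) / exp (real n * (R - \<eta>))"
      using M1 M2 by (intro divide_left_mono) auto
    also have "\<dots> = exp (- real n * (R - \<eta> - (awgn_capacity P N + \<eta>)))"
      by (simp add: exp_diff[symmetric] algebra_simps)
    also have "\<dots> \<le> \<dots> * (real n + 1)" by simp
    finally have 1: "exp (real n * (awgn_capacity P N + \<eta>)) / real (M n) \<le> (1 - eps) / 4" using elim(4) by linarith
    have "exp (- real n * c) \<le> exp (- real n * c) * (real n + 1)" by simp
    then have 2: "exp (- real n * c) \<le> (1 - eps) / 4" using elim(3) by linarith
    have "1 - e n \<le> (1 - eps) / 4 + (1 - eps) / 4"
      using tx_code_converse[OF assms(1,2) \<eta>(1) code[of n]] 1 2 unfolding c_def by linarith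
    then show False using elim(1) by (simp add: field_simps)
  qed
  then show False by simp
qed

lemma Sup_ereal_eq:
  assumes "\<And>R. R < c \<Longrightarrow> A R" "\<And>R. A R \<Longrightarrow> R \<le> c"
  shows "Sup (ereal ` {R. A R}) = ereal c"
proof (rule antisym)
  show "Sup (ereal ` {R. A R}) \<le> ereal c" by (rule Sup_least) (use assms(2) in auto)
  show "ereal c \<le> Sup (ereal ` {R. A R})"
  proof (rule dense_le)
    fix z assume z: "z < ereal c"
    show "z \<le> Sup (ereal ` {R. A R})"
      using z assms(1) by (cases z) (auto intro!: Sup_upper)
  qed
qed

lemma Inf_ereal_eq:
  assumes "\<And>R. R > c \<Longrightarrow> A R" "\<And>R. A R \<Longrightarrow> R \<ge> c"
  shows "Inf (ereal ` {R. A R}) = ereal c"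
proof (rule antisym)
  show "ereal c \<le> Inf (ereal ` {R. A R})" by (rule Inf_greatest) (use assms(2) in auto)
  show "Inf (ereal ` {R. A R}) \<le> ereal c"
  proof (rule dense_ge)
    fix z assume z: "ereal c < z"
    show "Inf (ereal ` {R. A R}) \<le> z"
      using z assms(1) by (cases z) (auto intro!: Inf_lower)
  qed
qed

theorem Cs_eq_capacity:
  assumes "P > 0" "N > 0" "eps \<ge> 0" "eps < 1"
  shows "Cs N eps P = ereal (awgn_capacity P N)"
  unfolding Cs_def
  using Cs_achievable_below_capacity[OF assms(1-3)] Cs_achievable_le_capacity[OF assms(1,2,4)]
  by (rule Sup_ereal_eq)

section \<open>Soft covering\<close>

text \<open>Words are chosen one at a time. For x drawn from X, g x minus its mean h averages to
  zero, so in the square of F + (g x - h) the cross term disappears and the squared norm grows on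
  average by at most the mean of g^2. This is at most K, because g^2 \<le> K g and g x has mass at
  most 1. Some x in S does no worse than the average. Dividing by M^2 turns the total M K into K /
  M.\<close>

lemma sparse_average:
  fixes g :: "'a \<Rightarrow> 'b \<Rightarrow> real"
  assumes "prob_space X" "prob_space q"
    and meas [measurable]: "(\<lambda>(x, y). g x y) \<in> borel_measurable (X \<Otimes>\<^sub>M q)"
    and g: "\<And>x y. 0 \<le> g x y" "\<And>x y. g x y \<le> K"
    and mass: "\<And>x. x \<in> S \<Longrightarrow> (\<integral>y. g x y \<partial>q) \<le> 1"
    and S: "AE x in X. x \<in> S" "S \<subseteq> space X"
  shows "\<exists>\<phi>. (\<forall>i<M. \<phi> i \<in> S) \<and>
    (\<integral>y. (\<Sum>i<M. g (\<phi> i) y - (\<integral>x. g x y \<partial>X))\<^sup>2 \<partial>q) \<le> real M * K"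
proof (induction M)
  case 0
  show ?case by auto
next
  case (Suc m)
  interpret X: prob_space X by fact
  interpret q: prob_space q by fact
  interpret pair_prob_space X q ..
  have K: "K \<ge> 0" using g order_trans by blast
  have g2: "(g x y)\<^sup>2 \<le> K\<^sup>2" for x y by (rule power_mono[OF g(2) g(1)])
  define h where "h = (\<lambda>y. \<integral>x. g x y \<partial>X)"
  have gx [measurable]: "(\<lambda>y. g x y) \<in> borel_measurable q" if "x \<in> space X" for x
    using measurable_compose[OF measurable_Pair1'[OF that] meas] by simp
  have gy [measurable]: "(\<lambda>x. g x y) \<in> borel_measurable X" if "y \<in> space q" for y
    using measurable_compose[OF measurable_Pair2'[OF that] meas] by simp
  have h_meas [measurable]: "h \<in> borel_measurable q"
  proof -
    have "(\<lambda>(y, x). g x y) \<in> borel_measurable (q \<Otimes>\<^sub>M X)"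
      using measurable_pair_swap[OF meas] by simp
    then show ?thesis unfolding h_def by (rule X.borel_measurable_lebesgue_integral)
  qed
  have h: "0 \<le> h y" "h y \<le> K" if "y \<in> space q" for y
  proof -
    show "0 \<le> h y" unfolding h_def by (intro integral_nonneg_AE) (use g in auto)
    have "h y \<le> (\<integral>x. K \<partial>X)" unfolding h_def
    proof (rule integral_mono)
      show "integrable X (\<lambda>x. g x y)"
        using gy[OF that] g by (intro X.integrable_const_bound[where B = K]) auto
    qed (use g in auto)
    then show "h y \<le> K" by (simp add: X.prob_space)
  qed
  obtain \<phi> where \<phi>: "\<And>i. i < m \<Longrightarrow> \<phi> i \<in> S" and IH: "(\<integral>y. (\<Sum>i<m. g (\<phi> i) y - h y)\<^sup>2 \<partial>q) \<le> real m * K"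
    using Suc unfolding h_def by auto
  define F where "F = (\<lambda>y. \<Sum>i<m. g (\<phi> i) y - h y)"
  have F_meas [measurable]: "F \<in> borel_measurable q"
    unfolding F_def using \<phi> S by (intro borel_measurable_sum borel_measurable_diff gx h_meas) auto
  have F: "\<bar>F y\<bar> \<le> real m * K" if "y \<in> space q" for y
  proof -
    have "\<bar>F y\<bar> \<le> (\<Sum>i<m. \<bar>g (\<phi> i) y - h y\<bar>)" unfolding F_def by (rule sum_abs)
    also have "\<dots> \<le> (\<Sum>i<m. K)"
      using g h[OF that] by (intro sum_mono) (smt (verit))
    finally show ?thesis by simp
  qed
  define L where "L = real m * K + 2 * K"
  define G where "G = (\<lambda>x y. (F y + (g x y - h y))\<^sup>2)"
  have G_bound: "\<bar>G x y\<bar> \<le> L\<^sup>2" if "y \<in> space q" for x y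
  proof -
    have "\<bar>F y + (g x y - h y)\<bar> \<le> L"
      using F[OF that] h[OF that] g[of x y] K unfolding L_def by (smt (verit))
    then show ?thesis unfolding G_def by (simp add: abs_le_square_iff[symmetric] abs_le_iff)
  qed
  have G_meas [measurable]: "(\<lambda>(x, y). G x y) \<in> borel_measurable (X \<Otimes>\<^sub>M q)"
    unfolding G_def split_beta' using meas[unfolded split_beta'] by measurable
  have G_int: "integrable (X \<Otimes>\<^sub>M q) (\<lambda>(x, y). G x y)"
    by (intro integrable_const_bound[where B = "L\<^sup>2"]) (auto simp: space_pair_measure G_bound)
  have g2_int: "integrable (X \<Otimes>\<^sub>M q) (\<lambda>(x, y). (g x y)\<^sup>2)"
  proof (intro integrable_const_bound[where B = "K\<^sup>2"])
    show "(\<lambda>(x, y). (g x y)\<^sup>2) \<in> borel_measurable (X \<Otimes>\<^sub>M q)"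
      unfolding split_beta' using meas[unfolded split_beta'] by measurable
  qed (auto simp: g2)
  have inner: "(\<integral>x. G x y \<partial>X) \<le> (F y)\<^sup>2 + (\<integral>x. (g x y)\<^sup>2 \<partial>X)" if y: "y \<in> space q" for y
  proof -
    have i1: "integrable X (\<lambda>x. g x y)"
      using gy[OF y] g by (intro X.integrable_const_bound[where B = K]) auto
    have i2: "integrable X (\<lambda>x. (g x y)\<^sup>2)"
      using gy[OF y] g by (intro X.integrable_const_bound[where B = "K\<^sup>2"]) (auto simp: g2)
    have "(\<integral>x. G x y \<partial>X) = (\<integral>x. (F y - h y)\<^sup>2 + 2 * (F y - h y) * g x y + (g x y)\<^sup>2 \<partial>X)"
      unfolding G_def by (intro Bochner_Integration.integral_cong refl) (simp add: power2_eq_square algebra_simps)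
    also have "\<dots> = (F y - h y)\<^sup>2 + 2 * (F y - h y) * h y + (\<integral>x. (g x y)\<^sup>2 \<partial>X)"
      using i1 i2 by (simp add: X.prob_space h_def)
    also have "(F y - h y)\<^sup>2 + 2 * (F y - h y) * h y = (F y)\<^sup>2 - (h y)\<^sup>2"
      by (simp add: power2_eq_square algebra_simps)
    finally show ?thesis by simp
  qed
  have F2_int: "integrable q (\<lambda>y. (F y)\<^sup>2)"
    by (intro q.integrable_const_bound[where B = "(real m * K)\<^sup>2"])
      (use F K in \<open>auto simp: abs_le_square_iff[symmetric]\<close>)
  have "(\<integral>x. (\<integral>y. G x y \<partial>q) \<partial>X) = (\<integral>y. (\<integral>x. G x y \<partial>X) \<partial>q)"
    by (rule Fubini_integral[symmetric]) (rule G_int)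
  also have "\<dots> \<le> (\<integral>y. (F y)\<^sup>2 + (\<integral>x. (g x y)\<^sup>2 \<partial>X) \<partial>q)"
    using integrable_snd[OF G_int] F2_int integrable_snd[OF g2_int]
    by (intro integral_mono inner) auto
  also have "\<dots> = (\<integral>y. (F y)\<^sup>2 \<partial>q) + (\<integral>y. (\<integral>x. (g x y)\<^sup>2 \<partial>X) \<partial>q)"
    using F2_int integrable_snd[OF g2_int] by simp
  also have "(\<integral>y. (\<integral>x. (g x y)\<^sup>2 \<partial>X) \<partial>q) = (\<integral>x. (\<integral>y. (g x y)\<^sup>2 \<partial>q) \<partial>X)"
    by (rule Fubini_integral) (rule g2_int)
  also have "\<dots> \<le> (\<integral>x. K \<partial>X)"
  proof (rule integral_mono_AE)
    show "integrable X (\<lambda>x. \<integral>y. (g x y)\<^sup>2 \<partial>q)" using integrable_fst[OF g2_int] by simp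
    show "AE x in X. (\<integral>y. (g x y)\<^sup>2 \<partial>q) \<le> K"
      using S(1)
    proof eventually_elim
      case (elim x)
      have [measurable]: "(\<lambda>y. g x y) \<in> borel_measurable q" using elim S by (intro gx) auto
      have "(\<integral>y. (g x y)\<^sup>2 \<partial>q) \<le> (\<integral>y. K * g x y \<partial>q)"
      proof (rule integral_mono)
        show "integrable q (\<lambda>y. (g x y)\<^sup>2)"
          using g by (intro q.integrable_const_bound[where B = "K\<^sup>2"]) (auto simp: g2)
        show "integrable q (\<lambda>y. K * g x y)"
          using g K by (intro q.integrable_const_bound[where B = "K * K"]) (auto intro!: AE_I2 mult_left_mono)
        show "(g x y)\<^sup>2 \<le> K * g x y" for y
          using g by (simp add: power2_eq_square mult_right_mono)
      qed
      also have "\<dots> \<le> K * 1"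
        using mass[OF elim] K by (simp add: mult_left_le)
      finally show ?case by simp
    qed
  qed simp
  finally have avg: "(\<integral>x. (\<integral>y. G x y \<partial>q) \<partial>X) \<le> (\<integral>y. (F y)\<^sup>2 \<partial>q) + K"
    by (simp add: X.prob_space)
  have "\<exists>x\<in>S. (\<integral>y. G x y \<partial>q) \<le> (\<integral>y. (F y)\<^sup>2 \<partial>q) + K"
  proof (rule ccontr)
    assume "\<not> ?thesis"
    then have "AE x in X. (\<integral>y. (F y)\<^sup>2 \<partial>q) + K < (\<integral>y. G x y \<partial>q)"
      using S(1) by (auto simp: not_le elim: eventually_mono)
    then have "(\<integral>y. (F y)\<^sup>2 \<partial>q) + K < (\<integral>x. (\<integral>y. G x y \<partial>q) \<partial>X)"
      using integrable_fst[OF G_int] by (intro X.expectation_greater) auto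
    with avg show False by simp
  qed
  then obtain x where x: "x \<in> S" "(\<integral>y. G x y \<partial>q) \<le> real m * K + K"
    using IH unfolding F_def by fastforce
  have "(\<Sum>i<Suc m. g ((\<phi>(m := x)) i) y - h y) = F y + (g x y - h y)" for y
    by (simp add: F_def)
  then have "(\<integral>y. (\<Sum>i<Suc m. g ((\<phi>(m := x)) i) y - h y)\<^sup>2 \<partial>q) \<le> real (Suc m) * K"
    using x(2) by (simp add: G_def algebra_simps)
  moreover have "\<forall>i<Suc m. (\<phi>(m := x)) i \<in> S" using \<phi> x(1) by (auto simp: less_Suc_eq)
  ultimately show ?case unfolding h_def by blast
qed

lemma (in prob_space) expectation_abs_le_sqrt:
  fixes f :: "'a \<Rightarrow> real"
  assumes "integrable M f" "integrable M (\<lambda>x. (f x)\<^sup>2)"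
  shows "(\<integral>x. \<bar>f x\<bar> \<partial>M) \<le> sqrt (\<integral>x. (f x)\<^sup>2 \<partial>M)"
proof -
  have "(\<integral>x. \<bar>f x\<bar> \<partial>M)\<^sup>2 \<le> (\<integral>x. (f x)\<^sup>2 \<partial>M)"
    using variance_positive[of "\<lambda>x. \<bar>f x\<bar>"] variance_eq[of "\<lambda>x. \<bar>f x\<bar>"] assms by simp
  then show ?thesis by (rule real_le_rsqrt)
qed

lemma QW_integrable:
  assumes "N > 0" "prob_space X" "sets X = sets (Rn n)" "B \<in> sets (Rn n)"
  shows "integrable X (\<lambda>x. measure (awgn N n x) B)"
proof -
  interpret X: prob_space X by fact
  have "(\<lambda>x. measure (awgn N n x) B) \<in> borel_measurable X"
    using awgn_measurable[OF assms(1,4)] assms(3) by (simp cong: measurable_cong_sets)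
  then show ?thesis
    by (intro X.integrable_const_bound[where B = 1])
      (auto intro!: AE_I2 prob_space.prob_le_1 prob_space_awgn assms)
qed

text \<open>The codebook is fixed before B, so the bound is uniform over events. The first term is
  the L2(q) error of the truncated ratios, passed to L1(q) by Cauchy-Schwarz; the second is the mass
  lost by truncation.\<close>

lemma soft_covering:
  assumes "P > 0" "N > 0" "\<eta> > 0" "M \<ge> 1"
    and X: "prob_space X" "sets X = sets (Rn n)" "measure X (cost_set n P) = 1"
  shows "\<exists>\<phi>. (\<forall>i\<in>{1..M}. \<phi> i \<in> cost_set n P) \<and> (\<forall>B\<in>sets (Rn n).
    \<bar>QW N n X B - unif_out N n M \<phi> B\<bar> \<le>
      sqrt (exp (real n * (awgn_capacity P N + \<eta>)) / real M) + exp (- real n * ((P + N) * \<eta>\<^sup>2 / (2 * P))))"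
proof -
  define q where "q = awgn (P + N) n (\<lambda>_. 0)"
  define K where "K = exp (real n * (awgn_capacity P N + \<eta>))"
  \<comment> \<open>Values above K are replaced by 0 rather than by K, so that \<open>g x\<close> is
    exactly the density, relative to q, of the channel law restricted to the complement of
    \<open>A x\<close>. This is what \<open>gB\<close> records.\<close>
  define g where "g = (\<lambda>x y. if gd N n x y \<le> K * gd (P + N) n (\<lambda>_. 0) y
    then gd N n x y / gd (P + N) n (\<lambda>_. 0) y else 0)"
  define A where "A = (\<lambda>x. info_above N P n (awgn_capacity P N + \<eta>) x)"
  define \<delta> where "\<delta> = exp (- real n * ((P + N) * \<eta>\<^sup>2 / (2 * P)))"
  have PN: "P + N > 0" using assms by simp
  have K: "K > 0" by (simp add: K_def)
  interpret X: prob_space X by fact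
  interpret q: prob_space q unfolding q_def by (rule prob_space_awgn) (rule PN)
  interpret pair_prob_space X q ..
  note X(2)[measurable_cong]
  have sets_q [measurable_cong]: "sets q = sets (Rn n)" by (simp add: q_def)
  have space_q: "space q = space (Rn n)" by (simp add: q_def)
  have space_X: "space X = space (Rn n)" using X(2) by (rule sets_eq_imp_space_eq)
  have gdq: "gd (P + N) n (\<lambda>_. 0) y > 0" "gd N n x y > 0" for x y using PN assms by auto
  have g: "0 \<le> g x y" "g x y \<le> K" for x y
    using gdq[of y] gdq(2)[of x y] K unfolding g_def by (auto simp: field_simps)
  have meas [measurable]: "(\<lambda>(x, y). g x y) \<in> borel_measurable (X \<Otimes>\<^sub>M q)"
    unfolding g_def split_beta' by measurable
  have gx_meas [measurable]: "g x \<in> borel_measurable q" for x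
    unfolding g_def by measurable
  have g_int: "integrable q (\<lambda>y. g x y * indicator B y)" if "B \<in> sets (Rn n)" for x B
    using that g by (intro q.integrable_const_bound[where B = K]) (auto simp: indicator_def K less_imp_le)
  have gB: "(\<integral>y. g x y * indicator B y \<partial>q) = measure (awgn N n x) (B - A x)" if B [measurable]: "B \<in> sets (Rn n)" for x B
  proof -
    interpret W: prob_space "awgn N n x" by (rule prob_space_awgn) fact
    have [measurable]: "A x \<in> sets (Rn n)" unfolding A_def by measurable
    have "(\<integral>\<^sup>+y. ennreal (g x y * indicator B y) \<partial>q) =
        (\<integral>\<^sup>+y. ennreal (gd (P + N) n (\<lambda>_. 0) y) * ennreal (g x y * indicator B y) \<partial>Rn n)"
      unfolding q_def awgn_gd using B gx_meas[of x, unfolded q_def awgn_gd]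
      by (subst nn_integral_density) auto
    also have "\<dots> = (\<integral>\<^sup>+y. ennreal (gd N n x y) * indicator (B - A x) y \<partial>Rn n)"
    proof (rule nn_integral_cong)
      fix y assume "y \<in> space (Rn n)"
      then have A: "y \<in> A x \<longleftrightarrow> \<not> gd N n x y \<le> K * gd (P + N) n (\<lambda>_. 0) y"
        by (simp add: A_def info_above_def K_def not_le)
      have "gd (P + N) n (\<lambda>_. 0) y * g x y = (if y \<in> A x then 0 else gd N n x y)"
        using gdq(1)[of y] unfolding A g_def by simp
      then show "ennreal (gd (P + N) n (\<lambda>_. 0) y) * ennreal (g x y * indicator B y) =
          ennreal (gd N n x y) * indicator (B - A x) y"
        using gdq(1)[of y] g(1)[of x y]
        by (cases "y \<in> B"; cases "y \<in> A x") (simp_all add: ennreal_mult[symmetric] less_imp_le)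
    qed
    also have "\<dots> = emeasure (awgn N n x) (B - A x)"
      by (subst emeasure_awgn) auto
    finally show ?thesis using g
      by (subst integral_eq_nn_integral) (auto simp: W.emeasure_eq_measure)
  qed
  have mass: "(\<integral>y. g x y \<partial>q) \<le> 1" for x
  proof -
    have "(\<integral>y. g x y \<partial>q) = (\<integral>y. g x y * indicator (space (Rn n)) y \<partial>q)"
      by (intro Bochner_Integration.integral_cong refl) (simp add: space_q)
    also have "\<dots> \<le> 1" unfolding gB[OF sets.top]
      by (intro prob_space.prob_le_1 prob_space_awgn assms)
    finally show ?thesis .
  qed
  have cost: "cost_set n P \<in> sets X" "AE x in X. x \<in> cost_set n P"
  proof -
    \<comment> \<open>A set outside the sigma-algebra has measure 0, so measure 1 already implies
      measurability.\<close>
    show 1: "cost_set n P \<in> sets X" using X(3) measure_notin_sets[of "cost_set n P" X] by fastforce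
    show "AE x in X. x \<in> cost_set n P" using X(3) 1 by (subst (asm) X.prob_eq_1) auto
  qed
  obtain \<phi> where \<phi>: "\<And>i. i < M \<Longrightarrow> \<phi> i \<in> cost_set n P"
    and L2: "(\<integral>y. (\<Sum>i<M. g (\<phi> i) y - (\<integral>x. g x y \<partial>X))\<^sup>2 \<partial>q) \<le> real M * K"
    using sparse_average[OF X(1) q.prob_space_axioms meas g mass cost(2), where M = M] sets.sets_into_space[OF cost(1)] by blast
  define h where "h = (\<lambda>y. \<integral>x. g x y \<partial>X)"
  define F where "F = (\<lambda>y. \<Sum>i<M. g (\<phi> i) y - h y)"
  have split: "measure (awgn N n x) B \<le> (\<integral>y. g x y * indicator B y \<partial>q) + \<delta>"
      "(\<integral>y. g x y * indicator B y \<partial>q) \<le> measure (awgn N n x) B"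
    if B [measurable]: "B \<in> sets (Rn n)" and x: "x \<in> cost_set n P" for x B
  proof -
    interpret W: prob_space "awgn N n x" by (rule prob_space_awgn) fact
    have [measurable]: "A x \<in> sets (Rn n)" unfolding A_def by measurable
    have "measure (awgn N n x) B \<le> measure (awgn N n x) ((B - A x) \<union> A x)"
      by (intro W.finite_measure_mono) auto
    also have "\<dots> \<le> measure (awgn N n x) (B - A x) + measure (awgn N n x) (A x)"
      by (intro measure_Un_le) auto
    also have "measure (awgn N n x) (A x) \<le> \<delta>"
      unfolding A_def \<delta>_def by (rule awgn_info_upper[OF assms(1-3) cost_set_nsq[OF x]])
    finally show "measure (awgn N n x) B \<le> (\<integral>y. g x y * indicator B y \<partial>q) + \<delta>" unfolding gB[OF B] by simp
    show "(\<integral>y. g x y * indicator B y \<partial>q) \<le> measure (awgn N n x) B"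
      unfolding gB[OF B] by (intro W.finite_measure_mono) auto
  qed
  have h_meas [measurable]: "h \<in> borel_measurable q"
  proof -
    have "(\<lambda>(y, x). g x y) \<in> borel_measurable (q \<Otimes>\<^sub>M X)"
      using measurable_pair_swap[OF meas] by simp
    then show ?thesis unfolding h_def by (rule X.borel_measurable_lebesgue_integral)
  qed
  have h: "0 \<le> h y" "h y \<le> K" if y: "y \<in> space q" for y
  proof -
    have [measurable]: "(\<lambda>x. g x y) \<in> borel_measurable X"
      using measurable_compose[OF measurable_Pair2'[OF y] meas] by simp
    show "0 \<le> h y" unfolding h_def by (intro integral_nonneg_AE) (use g in auto)
    have "h y \<le> (\<integral>x. K \<partial>X)" unfolding h_def
    proof (rule integral_mono)
      show "integrable X (\<lambda>x. g x y)" using g by (intro X.integrable_const_bound[where B = K]) auto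
    qed (use g in auto)
    then show "h y \<le> K" by (simp add: X.prob_space)
  qed
  have h_int: "integrable q (\<lambda>y. h y * indicator B y)" if "B \<in> sets (Rn n)" for B
    using that h K by (intro q.integrable_const_bound[where B = K]) (auto simp: indicator_def)
  have F_meas [measurable]: "F \<in> borel_measurable q" unfolding F_def by measurable
  have F_bound: "\<bar>F y\<bar> \<le> real M * K" if "y \<in> space q" for y
  proof -
    have "\<bar>F y\<bar> \<le> (\<Sum>i<M. \<bar>g (\<phi> i) y - h y\<bar>)" unfolding F_def by (rule sum_abs)
    also have "\<dots> \<le> (\<Sum>i<M. K)" using g h[OF that] by (intro sum_mono) (smt (verit))
    finally show ?thesis by simp
  qed
  have F_int: "integrable q F" "integrable q (\<lambda>y. (F y)\<^sup>2)" "integrable q (\<lambda>y. \<bar>F y\<bar>)"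
  proof -
    show 1: "integrable q F"
      by (intro q.integrable_const_bound[where B = "real M * K"]) (auto simp: F_bound)
    show "integrable q (\<lambda>y. (F y)\<^sup>2)"
      by (intro q.integrable_const_bound[where B = "(real M * K)\<^sup>2"])
        (use F_bound K in \<open>auto simp: abs_le_square_iff[symmetric]\<close>)
    show "integrable q (\<lambda>y. \<bar>F y\<bar>)" using 1 by simp
  qed
  have "(\<integral>y. \<bar>F y\<bar> \<partial>q) \<le> sqrt (real M * K)"
    using q.expectation_abs_le_sqrt[OF F_int(1,2)] L2 unfolding F_def h_def
    by (meson order_trans real_sqrt_le_mono)
  also have "sqrt (real M * K) = real M * sqrt (K / real M)"
    using assms(4) by (simp add: real_sqrt_mult real_sqrt_divide field_simps)
  finally have F1: "(\<integral>y. \<bar>F y\<bar> \<partial>q) \<le> real M * sqrt (K / real M)" .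
  define \<phi>' where "\<phi>' = (\<lambda>i. \<phi> (i - 1))"
  show ?thesis
  proof (intro exI[of _ \<phi>'] conjI ballI)
    show "\<phi>' i \<in> cost_set n P" if "i \<in> {1..M}" for i using that \<phi> by (auto simp: \<phi>'_def)
    fix B assume B [measurable]: "B \<in> sets (Rn n)"
    have gB_meas: "(\<lambda>(x, y). g x y * indicator B y) \<in> borel_measurable (X \<Otimes>\<^sub>M q)"
      using meas unfolding split_beta' by measurable
    have gB_int: "integrable (X \<Otimes>\<^sub>M q) (\<lambda>(x, y). g x y * indicator B y)"
      by (intro integrable_const_bound[where B = K] gB_meas) (use g K in \<open>auto simp: indicator_def\<close>)
    have hB: "(\<integral>x. (\<integral>y. g x y * indicator B y \<partial>q) \<partial>X) = (\<integral>y. h y * indicator B y \<partial>q)"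
      using Fubini_integral[OF gB_int] by (simp add: h_def)
    have i1: "integrable X (\<lambda>x. \<integral>y. g x y * indicator B y \<partial>q)"
      using integrable_fst[OF gB_int] by simp
    note i2 = QW_integrable[OF assms(2) X(1,2) B]
    \<comment> \<open>Truncation lowers the target output and the codebook output each by an amount
      between 0 and \<delta>, so these losses contribute at most \<delta>, not 2 \<delta>, to the
      difference.\<close>
    have "QW N n X B \<le> (\<integral>x. (\<integral>y. g x y * indicator B y \<partial>q) + \<delta> \<partial>X)"
      unfolding QW_def
      by (intro integral_mono_AE i2) (use cost(2) i1 split(1)[OF B] in \<open>auto elim: eventually_mono\<close>)
    also have "\<dots> = (\<integral>y. h y * indicator B y \<partial>q) + \<delta>" using i1 by (simp add: X.prob_space hB)
    finally have Q1: "QW N n X B \<le> (\<integral>y. h y * indicator B y \<partial>q) + \<delta>" .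
    have "(\<integral>x. (\<integral>y. g x y * indicator B y \<partial>q) \<partial>X) \<le> QW N n X B"
      unfolding QW_def
      by (intro integral_mono_AE i2) (use cost(2) i1 split(2)[OF B] in \<open>auto elim: eventually_mono\<close>)
    then have Q2: "(\<integral>y. h y * indicator B y \<partial>q) \<le> QW N n X B" by (simp add: hB)
    define s where "s = (\<Sum>i<M. \<integral>y. g (\<phi> i) y * indicator B y \<partial>q)"
    have U: "real M * unif_out N n M \<phi>' B = (\<Sum>i<M. measure (awgn N n (\<phi> i)) B)"
    proof -
      have "(\<Sum>i=1..M. measure (awgn N n (\<phi>' i)) B) = (\<Sum>i<M. measure (awgn N n (\<phi> i)) B)"
        by (rule sum.reindex_bij_witness[of _ Suc "\<lambda>i. i - 1"]) (auto simp: \<phi>'_def)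
      then show ?thesis using assms(4) by (simp add: unif_out_def)
    qed
    have "(\<Sum>i<M. measure (awgn N n (\<phi> i)) B) \<le> (\<Sum>i<M. (\<integral>y. g (\<phi> i) y * indicator B y \<partial>q) + \<delta>)"
      using split(1)[OF B] \<phi> by (intro sum_mono) auto
    then have U1: "real M * unif_out N n M \<phi>' B \<le> s + real M * \<delta>" by (simp add: U s_def sum.distrib)
    have U2: "s \<le> real M * unif_out N n M \<phi>' B"
      unfolding U s_def using split(2)[OF B] \<phi> by (intro sum_mono) auto
    have "F y * indicator B y = (\<Sum>i<M. g (\<phi> i) y * indicator B y) - real M * (h y * indicator B y)" for y
      unfolding F_def sum_distrib_right left_diff_distrib sum_subtractf by simp
    then have "(\<integral>y. F y * indicator B y \<partial>q) =
        (\<integral>y. (\<Sum>i<M. g (\<phi> i) y * indicator B y) - real M * (h y * indicator B y) \<partial>q)"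
      by (simp only:)
    also have "\<dots> = (\<integral>y. (\<Sum>i<M. g (\<phi> i) y * indicator B y) \<partial>q) - (\<integral>y. real M * (h y * indicator B y) \<partial>q)"
      using g_int[OF B] h_int[OF B]
      by (intro Bochner_Integration.integral_diff Bochner_Integration.integrable_sum integrable_mult_right)
    also have "\<dots> = s - real M * (\<integral>y. h y * indicator B y \<partial>q)"
      unfolding s_def using g_int[OF B] by (subst Bochner_Integration.integral_sum) auto
    finally have "\<bar>s - real M * (\<integral>y. h y * indicator B y \<partial>q)\<bar> = \<bar>\<integral>y. F y * indicator B y \<partial>q\<bar>"
      by simp
    also have "\<dots> \<le> (\<integral>y. \<bar>F y * indicator B y\<bar> \<partial>q)" by (rule integral_abs_bound)
    also have "\<dots> \<le> (\<integral>y. \<bar>F y\<bar> \<partial>q)"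
      using F_int(1) by (intro integral_mono integrable_abs integrable_real_mult_indicator F_int)
        (auto simp: indicator_def sets_q)
    finally have D: "\<bar>s - real M * (\<integral>y. h y * indicator B y \<partial>q)\<bar> \<le> real M * sqrt (K / real M)"
      using F1 by linarith
    have "real M * \<bar>QW N n X B - unif_out N n M \<phi>' B\<bar> = \<bar>real M * QW N n X B - real M * unif_out N n M \<phi>' B\<bar>"
      using abs_mult[of "real M" "QW N n X B - unif_out N n M \<phi>' B"] by (simp add: right_diff_distrib)
    also have "\<dots> \<le> real M * sqrt (K / real M) + real M * \<delta>"
    proof -
      have "real M * QW N n X B \<le> real M * (\<integral>y. h y * indicator B y \<partial>q) + real M * \<delta>"
        using mult_left_mono[OF Q1, of "real M"] by (simp add: distrib_left)
      moreover have "real M * (\<integral>y. h y * indicator B y \<partial>q) \<le> real M * QW N n X B"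
        using mult_left_mono[OF Q2, of "real M"] by simp
      ultimately show ?thesis using U1 U2 D by linarith
    qed
    also have "\<dots> = real M * (sqrt (K / real M) + \<delta>)" by (simp add: distrib_left)
    finally show "\<bar>QW N n X B - unif_out N n M \<phi>' B\<bar> \<le>
      sqrt (exp (real n * (awgn_capacity P N + \<eta>)) / real M) + exp (- real n * ((P + N) * \<eta>\<^sup>2 / (2 * P)))"
      using assms(4) unfolding K_def \<delta>_def by (subst (asm) mult_le_cancel_left_pos) auto
  qed
qed

section \<open>Resolvability and identification: bounds from soft covering\<close>

lemma QW_bounds:
  assumes "N > 0" "prob_space X"
  shows "0 \<le> QW N n X B" "QW N n X B \<le> 1"
proof -
  interpret X: prob_space X by fact
  show "0 \<le> QW N n X B" unfolding QW_def by (intro integral_nonneg_AE) auto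
  have "QW N n X B \<le> (\<integral>x. 1 \<partial>X)" unfolding QW_def
    by (rule Bochner_Integration.integral_mono') (auto intro!: prob_space.prob_le_1 prob_space_awgn assms)
  then show "QW N n X B \<le> 1" by (simp add: X.prob_space)
qed

lemma res_achievable_above_capacity:
  assumes "P > 0" "N > 0" "dlt \<ge> 0" and R: "R > awgn_capacity P N" and X: "input_process P X"
  shows "res_achievable_for N dlt P X R"
proof -
  define \<eta> where "\<eta> = (R - awgn_capacity P N) / 2"
  have \<eta>: "\<eta> > 0" "awgn_capacity P N + \<eta> - R = - \<eta>" using R by (auto simp: \<eta>_def field_simps)
  have R0: "R > 0" using R awgn_capacity_nonneg[OF assms(1,2)] by linarith
  define c where "c = (P + N) * \<eta>\<^sup>2 / (2 * P)"
  have c: "c > 0" using assms \<eta> by (simp add: c_def)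
  define M where "M = (\<lambda>n::nat. nat \<lfloor>exp (real n * R)\<rfloor>)"
  have M: "M n \<ge> 1" "real (M n) \<le> exp (real n * R)" "exp (real n * R) / 2 \<le> real (M n)" for n
    unfolding M_def by (intro floor_exp_bounds; use R0 in simp)+
  have "\<exists>\<phi>. (\<forall>i\<in>{1..M n}. \<phi> i \<in> cost_set n P) \<and> (\<forall>B\<in>sets (Rn n).
    \<bar>QW N n (X n) B - unif_out N n (M n) \<phi> B\<bar> \<le>
      sqrt (exp (real n * (awgn_capacity P N + \<eta>)) / real (M n)) + exp (- real n * c))" for n
    unfolding c_def by (rule soft_covering) (use assms \<eta> M X in \<open>auto simp: input_process_def\<close>)
  then obtain \<phi> where \<phi>: "\<And>n i. i \<in> {1..M n} \<Longrightarrow> \<phi> n i \<in> cost_set n P"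
    and cov: "\<And>n B. B \<in> sets (Rn n) \<Longrightarrow> \<bar>QW N n (X n) B - unif_out N n (M n) (\<phi> n) B\<bar> \<le>
      sqrt (exp (real n * (awgn_capacity P N + \<eta>)) / real (M n)) + exp (- real n * c)" by metis
  have small: "sqrt (exp (real n * (awgn_capacity P N + \<eta>)) / real (M n)) \<le> sqrt (2 * exp (- real n * \<eta>))" for n
  proof -
    have "exp (real n * (awgn_capacity P N + \<eta>)) / real (M n) \<le> exp (real n * (awgn_capacity P N + \<eta>)) / (exp (real n * R) / 2)"
      using M[of n] by (intro divide_left_mono) auto
    also have "\<dots> = 2 * exp (real n * (awgn_capacity P N + \<eta> - R))"
      by (simp add: exp_diff right_diff_distrib)
    finally show ?thesis unfolding \<eta>(2) by simp
  qed
  have "var_dist n (QW N n (X n)) (unif_out N n (M n) (\<phi> n)) \<le> 2 * (sqrt (2 * exp (- real n * \<eta>)) + exp (- real n * c))" for n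
    unfolding var_dist_def
  proof (intro mult_left_mono cSUP_least)
    fix B assume "B \<in> sets (Rn n)"
    from cov[OF this] small[of n]
    show "\<bar>QW N n (X n) B - unif_out N n (M n) (\<phi> n) B\<bar> \<le> sqrt (2 * exp (- real n * \<eta>)) + exp (- real n * c)" by linarith
  qed (use sets.top in auto)
  moreover have "(\<lambda>n. 2 * (sqrt (2 * exp (- real n * \<eta>)) + exp (- real n * c))) \<longlonglongrightarrow> 0"
  proof -
    have "(\<lambda>n. exp (- real n * \<eta>)) \<longlonglongrightarrow> 0" "(\<lambda>n. exp (- real n * c)) \<longlonglongrightarrow> 0"
      using \<eta>(1) c by real_asymp+
    moreover have "(\<lambda>n. 2 * (sqrt (2 * f n) + g n)) \<longlonglongrightarrow> 0"
      if "f \<longlonglongrightarrow> 0" "g \<longlonglongrightarrow> 0" for f g :: "nat \<Rightarrow> real"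
      using that by (auto intro!: tendsto_eq_intros)
    ultimately show ?thesis by blast
  qed
  ultimately have "limsup (\<lambda>n. ereal (var_dist n (QW N n (X n)) (unif_out N n (M n) (\<phi> n)))) \<le> ereal dlt"
    using assms(3) by (intro limsup_le_of_tendsto) auto
  moreover have "limsup (\<lambda>n. ereal (ln (real (M n)) / real n)) \<le> ereal R"
  proof (intro Limsup_bounded always_eventually allI)
    fix n
    have "ln (real (M n)) \<le> ln (exp (real n * R))" using M[of n] by (subst ln_le_cancel_iff) auto
    then have "ln (real (M n)) \<le> real n * R" by simp
    \<comment> \<open>At n = 0 the quotient is 0 by the convention for division, which is below R
      because R is positive.\<close>
    then show "ereal (ln (real (M n)) / real n) \<le> ereal R"
      using R0 by (cases "n = 0") (auto simp: field_simps)
  qed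
  ultimately show ?thesis unfolding res_achievable_for_def using \<phi> M(1) by blast
qed

section \<open>Sensitivity of the channel output to the input word\<close>

lemma awgn_le_add:
  assumes v: "v > 0" and B: "B \<in> sets (Rn n)" and "a \<ge> 0" "b \<ge> 0"
    and le: "\<And>y. y \<in> B \<Longrightarrow> gd v n x y \<le> a * gd v n x' y + b * gd v n x'' y"
  shows "measure (awgn v n x) B \<le> a * measure (awgn v n x') B + b * measure (awgn v n x'') B"
proof -
  have em: "emeasure (awgn v n x) B = ennreal (measure (awgn v n x) B)" for x
    using prob_space_awgn[OF v, of n x] by (simp add: prob_space_def finite_measure.emeasure_eq_measure)
  have pos: "gd v n x y > 0" for x y using v by simp
  have "emeasure (awgn v n x) B \<le> (\<integral>\<^sup>+y. ennreal a * (ennreal (gd v n x' y) * indicator B y)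
      + ennreal b * (ennreal (gd v n x'' y) * indicator B y) \<partial>Rn n)"
    unfolding emeasure_awgn[OF B]
  proof (rule nn_integral_mono)
    fix y
    show "ennreal (gd v n x y) * indicator B y \<le> ennreal a * (ennreal (gd v n x' y) * indicator B y)
      + ennreal b * (ennreal (gd v n x'' y) * indicator B y)"
      using le[of y] pos[of x' y] pos[of x'' y] assms(3,4)
      by (cases "y \<in> B") (auto simp: ennreal_mult[symmetric] ennreal_plus[symmetric] less_imp_le simp del: ennreal_plus intro!: ennreal_leI)
  qed
  also have "\<dots> = ennreal a * emeasure (awgn v n x') B + ennreal b * emeasure (awgn v n x'') B"
    unfolding emeasure_awgn[OF B] using B by (subst nn_integral_add) (auto simp: nn_integral_cmult)
  finally show ?thesis unfolding em
    using assms(3,4) by (simp add: ennreal_mult[symmetric] ennreal_plus[symmetric] del: ennreal_plus)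
qed

text \<open>By the parallelogram identity, the squared density divided by the density centred at x'
  is a constant times the density centred at the reflected point 2x - x'. The constant is therefore
  1 plus the chi-square distance, obtained without computing an integral.\<close>

lemma gd_square:
  assumes "N > 0"
  shows "(gd N n x y)\<^sup>2 = exp (sqd n x' x / N) * gd N n x' y * gd N n (\<lambda>i. 2 * x i - x' i) y"
proof -
  have "2 * (Y - X)\<^sup>2 + 2 * (X - Z)\<^sup>2 = (Y - Z)\<^sup>2 + (Y - (2 * X - Z))\<^sup>2" for X Y Z :: real
    by (simp add: power2_eq_square algebra_simps)
  then have "2 * sqd n x y + 2 * sqd n x' x = sqd n x' y + sqd n (\<lambda>i. 2 * x i - x' i) y"
    unfolding sqd_def sum_distrib_left sum.distrib[symmetric] by simp
  then have "sqd n x' y + sqd n (\<lambda>i. 2 * x i - x' i) y - 2 * sqd n x' x = 2 * sqd n x y" by simp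
  then have *: "(sqd n x' y + sqd n (\<lambda>i. 2 * x i - x' i) y - 2 * sqd n x' x) / N = 2 * sqd n x y / N" by simp
  have "sqd n x' x / N + - (real n * ln (2 * pi * N) + sqd n x' y / N) / 2
     + - (real n * ln (2 * pi * N) + sqd n (\<lambda>i. 2 * x i - x' i) y / N) / 2
     = - (real n * ln (2 * pi * N)) - ((sqd n x' y + sqd n (\<lambda>i. 2 * x i - x' i) y - 2 * sqd n x' x) / N) / 2"
    by (simp add: add_divide_distrib diff_divide_distrib)
  also have "\<dots> = 2 * (- (real n * ln (2 * pi * N) + sqd n x y / N) / 2)" unfolding * by simp
  finally show ?thesis
    unfolding gd_exp[OF assms] power2_eq_square exp_add[symmetric] by (simp only: mult_2)
qed

text \<open>Integrating \<open>(w - (1 + s) w')\<^sup>2 / w' \<ge> 0\<close> over \<open>B\<close>, and the same inequality with \<open>s = 0\<close>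
  over the complement, bounds the variation distance by the chi-square distance.\<close>

lemma awgn_close:
  assumes N: "N > 0" and B: "B \<in> sets (Rn n)" and s: "s > 0"
  shows "measure (awgn N n x) B - measure (awgn N n x') B \<le> (exp (sqd n x' x / N) - 1) / (2 * s) + s / 2"
proof -
  define E where "E = exp (sqd n x' x / N)"
  define x'' where "x'' = (\<lambda>i. 2 * x i - x' i)"
  have E: "E > 0" by (simp add: E_def)
  have key: "2 * (1 + r) * measure (awgn N n x) C \<le> (1 + r)\<^sup>2 * measure (awgn N n x') C + E * measure (awgn N n x'') C"
    if r: "r \<ge> 0" and C: "C \<in> sets (Rn n)" for r C
  proof -
    have "gd N n x y \<le> (1 + r) / 2 * gd N n x' y + E / (2 * (1 + r)) * gd N n x'' y" for y
    proof -
      define w w' where "w = gd N n x y" and "w' = gd N n x' y"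
      have w: "w' > 0" using N by (simp add: w'_def)
      have sq: "w\<^sup>2 = E * w' * gd N n x'' y"
        unfolding w_def w'_def E_def x''_def by (rule gd_square) fact
      have "0 \<le> (w - (1 + r) * w')\<^sup>2" by simp
      then have "2 * (1 + r) * w * w' \<le> ((1 + r)\<^sup>2 * w' + E * gd N n x'' y) * w'"
        using sq by (simp add: power2_eq_square algebra_simps)
      then have "2 * (1 + r) * w \<le> (1 + r)\<^sup>2 * w' + E * gd N n x'' y" using w by simp
      then have "w \<le> ((1 + r)\<^sup>2 * w' + E * gd N n x'' y) / (2 * (1 + r))"
        using r by (simp add: field_simps)
      also have "\<dots> = (1 + r) / 2 * w' + E / (2 * (1 + r)) * gd N n x'' y"
      proof -
        have "(t\<^sup>2 * a + E * b) / (2 * t) = t / 2 * a + E / (2 * t) * b" if "t > 0" for t a b :: real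
          using that by (simp add: field_simps power2_eq_square)
        from this[of "1 + r"] r show ?thesis by auto
      qed
      finally show ?thesis by (simp add: w_def w'_def)
    qed
    then have "measure (awgn N n x) C \<le> (1 + r) / 2 * measure (awgn N n x') C + E / (2 * (1 + r)) * measure (awgn N n x'') C"
      using r E by (intro awgn_le_add N C) auto
    then have "2 * (1 + r) * measure (awgn N n x) C \<le>
       2 * (1 + r) * ((1 + r) / 2 * measure (awgn N n x') C + E / (2 * (1 + r)) * measure (awgn N n x'') C)"
      using r by (intro mult_left_mono) auto
    also have "\<dots> = (1 + r)\<^sup>2 * measure (awgn N n x') C + E * measure (awgn N n x'') C"
    proof -
      have "2 * t * (t / 2 * a + E / (2 * t) * b) = t\<^sup>2 * a + E * b" if "t > 0" for t a b :: real
        using that by (simp add: field_simps power2_eq_square)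
      from this[of "1 + r"] r show ?thesis by auto
    qed
    finally show ?thesis .
  qed
  have c: "space (Rn n) - B \<in> sets (Rn n)" using B by auto
  let ?w = "measure (awgn N n x) B" and ?w' = "measure (awgn N n x') B" and ?w'' = "measure (awgn N n x'') B"
  have 1: "2 * (1 + s) * ?w \<le> (1 + s)\<^sup>2 * ?w' + E * ?w''" using key[OF _ B, of s] s by simp
  have 2: "2 * (1 - ?w) \<le> (1 - ?w') + E * (1 - ?w'')"
    using key[OF _ c, of 0] unfolding awgn_Diff[OF N B] by simp
  have w': "?w' \<le> 1" by (intro prob_space.prob_le_1 prob_space_awgn N)
  have "2 * s * (?w - ?w') \<le> (E - 1) + s\<^sup>2 * ?w'"
    using 1 2 by (simp add: power2_eq_square algebra_simps)
  also have "s\<^sup>2 * ?w' \<le> s\<^sup>2" using w' by (simp add: mult_left_le)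
  finally have "?w - ?w' \<le> ((E - 1) + s\<^sup>2) / (2 * s)"
    using s by (simp add: field_simps)
  also have "\<dots> = (E - 1) / (2 * s) + s / 2" using s by (simp add: add_divide_distrib power2_eq_square)
  finally show ?thesis by (simp add: E_def)
qed

lemma sqd_commute: "sqd n x y = sqd n y x"
  by (simp add: sqd_def power2_commute)

text \<open>When the chi-square distance is at most s^2, both terms in \<open>awgn_close\<close> are
  at most s / 2. The bound is symmetric in x and x', which gives the absolute value.\<close>

lemma awgn_abs_close:
  assumes N: "N > 0" and B: "B \<in> sets (Rn n)" and s: "s > 0" and d: "sqd n x' x \<le> d" "exp (d / N) \<le> 1 + s\<^sup>2"
  shows "\<bar>measure (awgn N n x) B - measure (awgn N n x') B\<bar> \<le> s"
proof -
  have "sqd n x' x / N \<le> d / N" using d N by (simp add: divide_right_mono)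
  then have "exp (sqd n x' x / N) - 1 \<le> s\<^sup>2" using d(2) exp_le_cancel_iff order_trans by (smt (verit))
  then have "(exp (sqd n x' x / N) - 1) / (2 * s) + s / 2 \<le> s\<^sup>2 / (2 * s) + s / 2"
    using s by (intro add_right_mono divide_right_mono) auto
  also have "\<dots> = s" using s by (simp add: power2_eq_square)
  finally have le: "(exp (sqd n x' x / N) - 1) / (2 * s) + s / 2 \<le> s" .
  show ?thesis
    using awgn_close[OF N B s, of x x'] awgn_close[OF N B s, of x' x] le sqd_commute[of n x x'] by simp
qed

text \<open>With mesh 1/n each of the n coordinates errs by at most 1/n, so the squared error 1/n
  tends to 0, while the integers that occur stay polynomial in n. Their range comes from 2|t| \<le>
  t^2 + 1 for a coordinate t, whose square is at most n P.\<close>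

lemma quantization_bounds:
  assumes "n > 0" "P > 0" "x \<in> cost_set n P"
  shows "sqd n (\<lambda>l. real_of_int \<lfloor>real n * x l\<rfloor> / real n) x \<le> 1 / real n"
    and "l < n \<Longrightarrow> \<bar>\<lfloor>real n * x l\<rfloor>\<bar> \<le> \<lceil>real n * (real n * P + 1)\<rceil> + 1"
proof -
  have "(t - real_of_int \<lfloor>real n * t\<rfloor> / real n)\<^sup>2 \<le> 1 / (real n)\<^sup>2" for t
  proof -
    have "t - real_of_int \<lfloor>real n * t\<rfloor> / real n = frac (real n * t) / real n"
      using assms(1) by (simp add: frac_def field_simps)
    moreover have "(frac (real n * t))\<^sup>2 \<le> 1\<^sup>2" by (intro power_mono) (auto simp: frac_ge_0 frac_lt_1 less_imp_le)
    ultimately show ?thesis by (simp add: power_divide divide_right_mono)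
  qed
  then have "sqd n (\<lambda>l. real_of_int \<lfloor>real n * x l\<rfloor> / real n) x \<le> (\<Sum>l<n. 1 / (real n)\<^sup>2)"
    unfolding sqd_def by (intro sum_mono)
  then show "sqd n (\<lambda>l. real_of_int \<lfloor>real n * x l\<rfloor> / real n) x \<le> 1 / real n"
    using assms(1) by (simp add: power2_eq_square)
  assume l: "l < n"
  have "(x l)\<^sup>2 \<le> nsq n x" unfolding nsq_def using l by (intro member_le_sum) auto
  also have "\<dots> \<le> real n * P" by (rule cost_set_nsq) fact
  finally have x2: "(x l)\<^sup>2 \<le> real n * P" .
  have "0 \<le> (\<bar>x l\<bar> - 1)\<^sup>2" by simp
  then have "2 * \<bar>x l\<bar> \<le> (x l)\<^sup>2 + 1" by (simp add: power2_eq_square algebra_simps)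
  then have "\<bar>x l\<bar> \<le> real n * P + 1" using x2 by linarith
  then have "real n * \<bar>x l\<bar> \<le> real n * (real n * P + 1)" by (intro mult_left_mono) auto
  then have "\<bar>real n * x l\<bar> \<le> real n * (real n * P + 1)" by (simp add: abs_mult)
  then show "\<bar>\<lfloor>real n * x l\<rfloor>\<bar> \<le> \<lceil>real n * (real n * P + 1)\<rceil> + 1" by linarith
qed

section \<open>Strong converse for identification\<close>

lemma unif_out_close:
  assumes "M \<ge> 1" "\<And>i. i \<in> {1..M} \<Longrightarrow> \<bar>measure (awgn N n (\<phi> i)) B - measure (awgn N n (\<phi>' i)) B\<bar> \<le> s"
  shows "\<bar>unif_out N n M \<phi> B - unif_out N n M \<phi>' B\<bar> \<le> s"
proof -
  have "real M * \<bar>unif_out N n M \<phi> B - unif_out N n M \<phi>' B\<bar> =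
      \<bar>\<Sum>i=1..M. measure (awgn N n (\<phi> i)) B - measure (awgn N n (\<phi>' i)) B\<bar>"
    using assms(1) by (simp add: unif_out_def sum_subtractf diff_divide_distrib[symmetric] abs_divide)
  also have "\<dots> \<le> (\<Sum>i=1..M. \<bar>measure (awgn N n (\<phi> i)) B - measure (awgn N n (\<phi>' i)) B\<bar>)" by (rule sum_abs)
  also have "\<dots> \<le> (\<Sum>i=1..M. s)" by (intro sum_mono assms(2))
  also have "\<dots> = real M * s" by simp
  finally show ?thesis using assms(1) by (subst (asm) mult_le_cancel_left_pos) auto
qed

text \<open>Every input distribution is replaced by a quantized codebook with nearly the same output, and
  an identification code cannot use the same codebook twice.\<close>

lemma id_code_card:
  assumes "P > 0" "N > 0" "\<eta> > 0" "\<kappa> > 0" "n > 0" "M \<ge> 1"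
    and code: "id_code N n Nn m l P Q D" and ml: "m + l + 4 * \<kappa> < 1"
    and cov: "sqrt (exp (real n * (awgn_capacity P N + \<eta>)) / real M) + exp (- real n * ((P + N) * \<eta>\<^sup>2 / (2 * P))) \<le> \<kappa>"
    and quant: "exp (1 / real n / N) \<le> 1 + \<kappa>\<^sup>2"
  shows "real Nn \<le> (2 * (real n * (real n * P + 1)) + 5) ^ (M * n)"
proof -
  define Bd :: int where "Bd = \<lceil>real n * (real n * P + 1)\<rceil> + 1"
  have Q: "prob_space (Q i)" "sets (Q i) = sets (Rn n)" "measure (Q i) (cost_set n P) = 1" "D i \<in> sets (Rn n)"
    if "i \<in> {1..Nn}" for i using code that by (auto simp: id_code_def)
  have m: "QW N n (Q i) (space (Rn n) - D i) \<le> m" if "i \<in> {1..Nn}" for i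
    using code that by (auto simp: id_code_def intro!: Max_ge)
  have l: "QW N n (Q j) (D i) \<le> l" if "i \<in> {1..Nn}" "j \<in> {1..Nn}" "i \<noteq> j" for i j
  proof -
    have "{QW N n (Q j) (D i) | i j. i \<in> {1..Nn} \<and> j \<in> {1..Nn} \<and> i \<noteq> j}
        \<subseteq> (\<lambda>(i, j). QW N n (Q j) (D i)) ` ({1..Nn} \<times> {1..Nn})" by auto
    then have "finite {QW N n (Q j) (D i) | i j. i \<in> {1..Nn} \<and> j \<in> {1..Nn} \<and> i \<noteq> j}"
      by (rule finite_subset) auto
    then have "QW N n (Q j) (D i) \<le> Max ({0} \<union> {QW N n (Q j) (D i) | i j. i \<in> {1..Nn} \<and> j \<in> {1..Nn} \<and> i \<noteq> j})"
      using that by (intro Max_ge) auto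
    then show ?thesis using code by (simp add: id_code_def)
  qed
  have "\<exists>\<phi>. (\<forall>k\<in>{1..M}. \<phi> k \<in> cost_set n P) \<and> (\<forall>B\<in>sets (Rn n). \<bar>QW N n (Q i) B - unif_out N n M \<phi> B\<bar> \<le> \<kappa>)"
    if "i \<in> {1..Nn}" for i
    using soft_covering[OF assms(1-3,6) Q(1-3)[OF that]] cov by (meson order_trans)
  then obtain \<phi> where \<phi>: "\<And>i k. i \<in> {1..Nn} \<Longrightarrow> k \<in> {1..M} \<Longrightarrow> \<phi> i k \<in> cost_set n P"
    and \<phi>_close: "\<And>i B. i \<in> {1..Nn} \<Longrightarrow> B \<in> sets (Rn n) \<Longrightarrow> \<bar>QW N n (Q i) B - unif_out N n M (\<phi> i) B\<bar> \<le> \<kappa>"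
    by metis
  \<comment> \<open>Quantized words may leave the cost set; this does no harm, since only their
    outputs are compared. Restricting \<open>z i\<close> to its index set makes it an element of a
    finite function space that can be counted.\<close>
  define z where "z = (\<lambda>i. \<lambda>(k, l)\<in>{1..M} \<times> {..<n}. \<lfloor>real n * \<phi> i k l\<rfloor>)"
  define dequant where "dequant = (\<lambda>z (k::nat) (l::nat). real_of_int (z (k, l)) / real n)"
  have close: "\<bar>QW N n (Q i) B - unif_out N n M (dequant (z i)) B\<bar> \<le> 2 * \<kappa>"
    if i: "i \<in> {1..Nn}" and B: "B \<in> sets (Rn n)" for i B
  proof -
    have "\<bar>unif_out N n M (\<phi> i) B - unif_out N n M (dequant (z i)) B\<bar> \<le> \<kappa>"
    proof (rule unif_out_close)
      fix k assume k: "k \<in> {1..M}"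
      have "sqd n (dequant (z i) k) (\<phi> i k) = sqd n (\<lambda>l. real_of_int \<lfloor>real n * \<phi> i k l\<rfloor> / real n) (\<phi> i k)"
        unfolding sqd_def dequant_def z_def using k by (intro sum.cong) auto
      also have "\<dots> \<le> 1 / real n" by (rule quantization_bounds(1)[OF assms(5,1) \<phi>[OF i k]])
      finally show "\<bar>measure (awgn N n (\<phi> i k)) B - measure (awgn N n (dequant (z i) k)) B\<bar> \<le> \<kappa>"
        by (rule awgn_abs_close[OF assms(2) B assms(4) _ quant])
    qed fact
    then show ?thesis using \<phi>_close[OF i B] by linarith
  qed
  have inj: "inj_on z {1..Nn}"
  proof (rule inj_onI, rule ccontr)
    \<comment> \<open>Each output moves by at most 2 \<kappa>, one \<kappa> for covering and one for
      quantization. Equal codebooks would bring the probabilities of \<open>D i\<close> under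
      messages i and j within 4 \<kappa>, whereas the code keeps them at least 1 - m - l
      apart.\<close>
    fix i j assume ij: "i \<in> {1..Nn}" "j \<in> {1..Nn}" "z i = z j" "i \<noteq> j"
    note Di = Q(4)[OF ij(1)]
    have "QW N n (Q i) (space (Rn n) - D i) = 1 - QW N n (Q i) (D i)"
    proof -
      interpret Qi: prob_space "Q i" by (rule Q) fact
      have "QW N n (Q i) (space (Rn n) - D i) = (\<integral>x. 1 - measure (awgn N n x) (D i) \<partial>Q i)"
        unfolding QW_def awgn_Diff[OF assms(2) Di] ..
      also have "\<dots> = 1 - QW N n (Q i) (D i)"
        unfolding QW_def using QW_integrable[OF assms(2) Q(1,2)[OF ij(1)] Di] by (simp add: Qi.prob_space)
      finally show ?thesis .
    qed
    then have "QW N n (Q i) (D i) \<ge> 1 - m" using m[OF ij(1)] by simp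
    moreover have "QW N n (Q j) (D i) \<le> l" by (rule l[OF ij(1,2,4)])
    moreover have "\<bar>QW N n (Q i) (D i) - QW N n (Q j) (D i)\<bar> \<le> 4 * \<kappa>"
      using close[OF ij(1) Di] close[OF ij(2) Di] unfolding ij(3) by linarith
    ultimately show False using ml by linarith
  qed
  have "z ` {1..Nn} \<subseteq> ({1..M} \<times> {..<n}) \<rightarrow>\<^sub>E {- Bd..Bd}"
  proof (rule image_subsetI)
    fix i assume i: "i \<in> {1..Nn}"
    have "\<lfloor>real n * \<phi> i k l\<rfloor> \<in> {- Bd..Bd}" if "k \<in> {1..M}" "l < n" for k l
      using quantization_bounds(2)[OF assms(5,1) \<phi>[OF i that(1)] that(2)] unfolding Bd_def by auto
    then show "z i \<in> ({1..M} \<times> {..<n}) \<rightarrow>\<^sub>E {- Bd..Bd}" unfolding z_def by auto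
  qed
  then have "card (z ` {1..Nn}) \<le> card (({1..M} \<times> {..<n}) \<rightarrow>\<^sub>E {- Bd..Bd})"
    by (intro card_mono) (auto intro!: finite_PiE)
  then have "Nn \<le> nat (2 * Bd + 1) ^ (M * n)"
    using card_image[OF inj] by (simp add: card_PiE prod_constant algebra_simps)
  then have "real Nn \<le> real (nat (2 * Bd + 1)) ^ (M * n)" by (metis of_nat_le_iff of_nat_power)
  also have "\<dots> \<le> (2 * (real n * (real n * P + 1)) + 5) ^ (M * n)"
  proof (rule power_mono)
    have "real n * (real n * P + 1) \<ge> 0" using assms by simp
    then have "Bd \<ge> 0" by (simp add: Bd_def)
    then have "real (nat (2 * Bd + 1)) = 2 * real_of_int Bd + 1" by simp
    also have "real_of_int Bd \<le> real n * (real n * P + 1) + 2" unfolding Bd_def by linarith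
    finally show "real (nat (2 * Bd + 1)) \<le> 2 * (real n * (real n * P + 1)) + 5" by simp
  qed simp
  finally show ?thesis .
qed

lemma D_achievable_le_capacity:
  assumes "P > 0" "N > 0" "mu + lam < 1" and R: "D_achievable N mu lam P R"
  shows "R \<le> awgn_capacity P N"
proof (rule ccontr)
  assume "\<not> ?thesis"
  then have gt: "awgn_capacity P N < R" by simp
  obtain Nn Q D m l where code: "\<And>n. id_code N n (Nn n) (m n) (l n) P (Q n) (D n)"
    and m: "limsup (\<lambda>n. ereal (m n)) \<le> ereal mu" and l: "limsup (\<lambda>n. ereal (l n)) \<le> ereal lam"
    and Nn: "ereal R \<le> liminf (\<lambda>n. ereal (ln (ln (real (Nn n))) / real n))"
    using R unfolding D_achievable_def by blast
  \<comment> \<open>The gap is cut into four. Covering codebooks have rate R', one \<eta> above the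
    covering threshold capacity + \<eta>, and the message rate still exceeds R' by \<eta> after
    losing \<eta> to the lower limit.\<close>
  define \<eta> where "\<eta> = (R - awgn_capacity P N) / 4"
  define R' where "R' = awgn_capacity P N + 2 * \<eta>"
  have \<eta>: "\<eta> > 0" "R - \<eta> = R' + \<eta>" using gt by (auto simp: \<eta>_def R'_def field_simps)
  have R': "R' > 0" using awgn_capacity_nonneg[OF assms(1,2)] \<eta> by (simp add: R'_def)
  \<comment> \<open>The two error levels lose 4 \<kappa> each to the upper limits and
    \<open>id_code_card\<close> takes another 4 \<kappa>; these 12 \<kappa> stay below the available
    16 \<kappa>.\<close>
  define \<kappa> where "\<kappa> = (1 - mu - lam) / 16"
  have \<kappa>: "\<kappa> > 0" using assms by (simp add: \<kappa>_def)
  define c where "c = (P + N) * \<eta>\<^sup>2 / (2 * P)"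
  have c: "c > 0" using assms \<eta> by (simp add: c_def)
  have K4: "\<kappa> / 2 > 0" "\<kappa>\<^sup>2 / 8 > 0" using \<kappa> by auto
  have "eventually (\<lambda>n. m n < mu + 4 * \<kappa>) sequentially" by (rule eventually_lt_limsup[OF m]) (use \<kappa> in simp)
  moreover have "eventually (\<lambda>n. l n < lam + 4 * \<kappa>) sequentially" by (rule eventually_lt_limsup[OF l]) (use \<kappa> in simp)
  moreover have "eventually (\<lambda>n. R - \<eta> < ln (ln (real (Nn n))) / real n) sequentially"
    by (rule eventually_gt_liminf[OF Nn]) (use \<eta> in simp)
  moreover have "eventually (\<lambda>n. exp (- real n * c) * (real n + 1) \<le> \<kappa> / 2) sequentially"
     "eventually (\<lambda>n. exp (- real n * \<eta>) * (real n + 1) \<le> \<kappa>\<^sup>2 / 8) sequentially"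
    by (intro eventually_exp_small c \<eta> K4)+
  moreover have "eventually (\<lambda>n. exp (1 / real n / N) \<le> 1 + \<kappa>\<^sup>2) sequentially"
  proof -
    have "(\<lambda>n. exp (1 / real n / N)) \<longlonglongrightarrow> 1" using assms by real_asymp
    from order_tendstoD(2)[OF this, of "1 + \<kappa>\<^sup>2"] \<kappa> show ?thesis by (auto elim: eventually_mono)
  qed
  \<comment> \<open>This is what the factor n in the exponent and the polynomial base of the
    codebook count add to the doubly logarithmic rate beyond ln M / n.\<close>
  moreover have "eventually (\<lambda>n. (ln (real n) + ln (ln (2 * (real n * (real n * P + 1)) + 5))) / real n < \<eta>) sequentially"
  proof -
    have "(\<lambda>n. (ln (real n) + ln (ln (2 * (real n * (real n * P + 1)) + 5))) / real n) \<longlonglongrightarrow> 0"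
      using assms by real_asymp
    from order_tendstoD(2)[OF this \<eta>(1)] show ?thesis .
  qed
  ultimately have "eventually (\<lambda>n::nat. False) sequentially"
    using eventually_gt_at_top[of 0]
  proof eventually_elim
    case (elim n)
    define M where "M = nat \<lfloor>exp (real n * R')\<rfloor>"
    have M: "M \<ge> 1" "real M \<le> exp (real n * R')" "exp (real n * R') / 2 \<le> real M"
      unfolding M_def by (intro floor_exp_bounds; use R' in simp)+
    define b where "b = 2 * (real n * (real n * P + 1)) + 5"
    have "exp (real n * (awgn_capacity P N + \<eta>)) / real M \<le> exp (real n * (awgn_capacity P N + \<eta>)) / (exp (real n * R') / 2)"
      using M by (intro divide_left_mono) auto
    also have "\<dots> = 2 * exp (real n * (awgn_capacity P N + \<eta> - R'))" by (simp add: exp_diff right_diff_distrib)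
    also have "awgn_capacity P N + \<eta> - R' = - \<eta>" by (simp add: R'_def)
    also have "2 * exp (real n * - \<eta>) \<le> 2 * (exp (- real n * \<eta>) * (real n + 1))" by simp
    also have "\<dots> \<le> (\<kappa> / 2)\<^sup>2" using elim(5) by (simp add: power_divide)
    finally have "sqrt (exp (real n * (awgn_capacity P N + \<eta>)) / real M) \<le> sqrt ((\<kappa> / 2)\<^sup>2)" by (rule real_sqrt_le_mono)
    then have c1: "sqrt (exp (real n * (awgn_capacity P N + \<eta>)) / real M) \<le> \<kappa> / 2" using \<kappa> by simp
    have "exp (- real n * c) \<le> exp (- real n * c) * (real n + 1)" by simp
    then have "exp (- real n * c) \<le> \<kappa> / 2" using elim(4) by linarith
    with c1 have cov: "sqrt (exp (real n * (awgn_capacity P N + \<eta>)) / real M) + exp (- real n * ((P + N) * \<eta>\<^sup>2 / (2 * P))) \<le> \<kappa>"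
      unfolding c_def by linarith
    have ml: "m n + l n + 4 * \<kappa> < 1" using elim(1,2) \<kappa> by (simp add: \<kappa>_def field_simps)
    have card: "real (Nn n) \<le> b ^ (M * n)"
      unfolding b_def by (rule id_code_card[OF assms(1,2) \<eta>(1) \<kappa> elim(8) M(1) code ml cov elim(6)])
    have b: "b \<ge> 5" using assms by (simp add: b_def)
    then have lnb: "ln b > 0" by simp
    \<comment> \<open>Since \<open>ln 0 = 0\<close>, a one-message code has doubly logarithmic rate
      0. The positive rate excludes it, so the outer logarithm is applied to a positive number and
      is monotone there.\<close>
    have "ln (real (Nn n)) > 0"
    proof -
      have "ln (ln (real (Nn n))) / real n > 0" using elim(3) \<eta> R' by linarith
      then have "ln (ln (real (Nn n))) \<noteq> 0" by auto
      then have "ln (real (Nn n)) \<noteq> 0" by auto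
      moreover have "ln (real (Nn n)) \<ge> 0" using code[of n] by (simp add: id_code_def)
      ultimately show ?thesis by simp
    qed
    moreover have "Nn n \<ge> 1" using code[of n] by (simp add: id_code_def)
    then have "ln (real (Nn n)) \<le> ln (b ^ (M * n))" using card b by (subst ln_le_cancel_iff) auto
    then have "ln (real (Nn n)) \<le> real M * (real n * ln b)" using b by (simp add: ln_realpow)
    ultimately have "ln (ln (real (Nn n))) \<le> ln (real M * (real n * ln b))" by (intro ln_mono) auto
    also have "\<dots> = ln (real M) + (ln (real n) + ln (ln b))"
      using M elim(8) lnb by (simp add: ln_mult_pos)
    also have "ln (real M) \<le> ln (exp (real n * R'))" using M by (subst ln_le_cancel_iff) auto
    finally have "ln (ln (real (Nn n))) \<le> real n * R' + (ln (real n) + ln (ln b))" by simp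
    moreover have "ln (real n) + ln (ln b) < \<eta> * real n" using elim(7,8) unfolding b_def by (simp add: pos_divide_less_eq)
    moreover have "(R - \<eta>) * real n < ln (ln (real (Nn n)))" using elim(3,8) by (simp add: pos_less_divide_eq)
    ultimately show False unfolding \<eta>(2) by (simp add: algebra_simps)
  qed
  then show False by simp
qed

section \<open>Construction of identification codes\<close>

text \<open>Union bound over the set A of rows in which g is forced to equal f: there are at most
  2^L such sets, each leaving L - card A rows free. As card A is at least L / s, the alphabet size
  4^s makes the forced rows save a factor of at least 4^L. This pays for the 2^L sets here and for
  the 2^L messages wanted in \<open>gilbert_functions\<close>.\<close>

lemma card_agree_ge:
  fixes f :: "nat \<Rightarrow> nat"
  assumes f: "f \<in> {..<L} \<rightarrow>\<^sub>E {..<4 ^ s}" and "s \<ge> 1"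
  shows "card {g \<in> {..<L} \<rightarrow>\<^sub>E {..<4 ^ s}. L \<le> s * card {l \<in> {..<L}. f l = g l}} \<le> 2 ^ L * 4 ^ (s * L - L)"
proof -
  define B where "B = (\<lambda>A. \<Pi>\<^sub>E l\<in>{..<L}. if l \<in> A then {f l} else {..<(4::nat) ^ s})"
  define \<A> where "\<A> = {A. A \<subseteq> {..<L} \<and> L \<le> s * card A}"
  have "\<A> \<subseteq> Pow {..<L}" by (auto simp: \<A>_def)
  then have \<A>: "finite \<A>" "card \<A> \<le> 2 ^ L"
    using finite_subset[of \<A> "Pow {..<L}"] card_mono[of "Pow {..<L}" \<A>] by (auto simp: card_Pow)
  have cB: "card (B A) \<le> 4 ^ (s * L - L)" if A: "A \<in> \<A>" for A
  proof -
    have "card (B A) = (\<Prod>l\<in>{..<L}. if l \<in> A then 1 else 4 ^ s)"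
      unfolding B_def by (subst card_PiE) (auto intro!: prod.cong)
    also have "\<dots> = (\<Prod>l\<in>{..<L} - A. 4 ^ s)"
      by (rule prod.mono_neutral_cong_right) auto
    also have "\<dots> = 4 ^ (s * (L - card A))"
  proof -
    have "finite A" using A finite_subset[of A "{..<L}"] by (auto simp: \<A>_def)
    then show ?thesis using A by (simp add: \<A>_def card_Diff_subset power_mult)
  qed
    also have "\<dots> \<le> 4 ^ (s * L - L)"
      using A by (intro power_increasing) (auto simp: \<A>_def diff_mult_distrib2)
    finally show ?thesis .
  qed
  have "{g \<in> {..<L} \<rightarrow>\<^sub>E {..<4 ^ s}. L \<le> s * card {l \<in> {..<L}. f l = g l}} \<subseteq> (\<Union>A\<in>\<A>. B A)"
  proof
    fix g assume g: "g \<in> {g \<in> {..<L} \<rightarrow>\<^sub>E {..<4 ^ s}. L \<le> s * card {l \<in> {..<L}. f l = g l}}"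
    have "g \<in> B {l \<in> {..<L}. f l = g l}" using g by (auto simp: B_def PiE_iff)
    moreover have "{l \<in> {..<L}. f l = g l} \<in> \<A>" using g by (auto simp: \<A>_def)
    ultimately show "g \<in> (\<Union>A\<in>\<A>. B A)" by blast
  qed
  moreover have "finite (\<Union>A\<in>\<A>. B A)" using \<A>(1) unfolding B_def by (auto intro!: finite_PiE)
  ultimately have "card {g \<in> {..<L} \<rightarrow>\<^sub>E {..<4 ^ s}. L \<le> s * card {l \<in> {..<L}. f l = g l}} \<le> card (\<Union>A\<in>\<A>. B A)"
    by (intro card_mono)
  also have "\<dots> \<le> (\<Sum>A\<in>\<A>. card (B A))" by (rule card_UN_le) (rule \<A>)
  also have "\<dots> \<le> (\<Sum>A\<in>\<A>. 4 ^ (s * L - L))" by (rule sum_mono) (rule cB)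
  also have "\<dots> \<le> 2 ^ L * 4 ^ (s * L - L)" using \<A>(2) by simp
  finally show ?thesis .
qed

text \<open>The functions too close to one of m < 2^L chosen ones number fewer than 2^L 2^L 4^(sL -
  L) = 4^(sL), the number of all functions, so another one can be added.\<close>

lemma gilbert_functions:
  assumes "s \<ge> 1" "m \<le> 2 ^ L"
  shows "\<exists>F \<subseteq> {..<L} \<rightarrow>\<^sub>E {..<(4::nat) ^ s}. finite F \<and> card F = m \<and>
    (\<forall>f\<in>F. \<forall>g\<in>F. f \<noteq> g \<longrightarrow> s * card {l \<in> {..<L}. f l = g l} < L)"
  using assms(2)
proof (induction m)
  case 0
  show ?case by (intro exI[of _ "{}"]) auto
next
  case (Suc m)
  then obtain F where F: "F \<subseteq> {..<L} \<rightarrow>\<^sub>E {..<(4::nat) ^ s}" "finite F" "card F = m"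
    and far: "\<And>f g. f \<in> F \<Longrightarrow> g \<in> F \<Longrightarrow> f \<noteq> g \<Longrightarrow> s * card {l \<in> {..<L}. f l = g l} < L" by auto
  define bad where "bad = (\<lambda>f. {g \<in> {..<L} \<rightarrow>\<^sub>E {..<(4::nat) ^ s}. L \<le> s * card {l \<in> {..<L}. f l = g l}})"
  have "card (\<Union>f\<in>F. bad f) \<le> (\<Sum>f\<in>F. card (bad f))" by (rule card_UN_le) fact
  also have "\<dots> \<le> (\<Sum>f\<in>F. 2 ^ L * 4 ^ (s * L - L))"
    unfolding bad_def using F(1) assms(1) by (intro sum_mono card_agree_ge) auto
  also have "\<dots> = m * (2 ^ L * 4 ^ (s * L - L))" using F by simp
  also have "\<dots> < 2 ^ L * (2 ^ L * 4 ^ (s * L - L))" using Suc by simp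
  also have "\<dots> = 4 ^ L * 4 ^ (s * L - L)"
    by (simp add: power_mult_distrib[symmetric] mult.assoc[symmetric])
  also have "\<dots> = 4 ^ (s * L)" using assms(1) by (simp add: power_add[symmetric])
  also have "\<dots> = card ({..<L} \<rightarrow>\<^sub>E {..<(4::nat) ^ s})" by (simp add: card_PiE power_mult)
  finally have less: "card (\<Union>f\<in>F. bad f) < card ({..<L} \<rightarrow>\<^sub>E {..<(4::nat) ^ s})" .
  have "\<not> ({..<L} \<rightarrow>\<^sub>E {..<(4::nat) ^ s}) \<subseteq> (\<Union>f\<in>F. bad f)"
  proof
    assume sub: "({..<L} \<rightarrow>\<^sub>E {..<(4::nat) ^ s}) \<subseteq> (\<Union>f\<in>F. bad f)"
    have "finite (\<Union>f\<in>F. bad f)"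
      by (rule finite_subset[of _ "{..<L} \<rightarrow>\<^sub>E {..<(4::nat) ^ s}"]) (auto simp: bad_def intro!: finite_PiE)
    from card_mono[OF this sub] less show False by simp
  qed
  then obtain g where g: "g \<in> {..<L} \<rightarrow>\<^sub>E {..<(4::nat) ^ s}" "\<And>f. f \<in> F \<Longrightarrow> g \<notin> bad f" by blast
  have far_g: "s * card {l \<in> {..<L}. f l = g l} < L" "s * card {l \<in> {..<L}. g l = f l} < L" if "f \<in> F" for f
    using g that by (auto simp: bad_def not_le eq_commute[of "g _"])
  have "g \<notin> F"
  proof
    assume "g \<in> F"
    from far_g(1)[OF this] have "s * L < L" by simp
    then show False using assms(1) by simp
  qed
  then show ?case
    using F far far_g g(1) by (intro exI[of _ "insert g F"]) auto
qed

text \<open>The decoder for f accepts the cells (l, f l) of all rows l. When g is sent, acceptance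
  requires a channel error or a row in which f and g agree, and such rows make up a fraction below 1
  / s.\<close>

lemma id_code_of_tx_codebook:
  fixes \<phi> :: "nat \<Rightarrow> nat \<Rightarrow> real"
  assumes N: "N > 0" and L: "L \<ge> 1" and s: "s \<ge> 1"
    and \<phi>: "\<And>i. i < L * 4 ^ s \<Longrightarrow> \<phi> i \<in> cost_set n P" and cost: "cost_set n P \<in> sets (Rn n)"
    and D: "\<And>i. i < L * 4 ^ s \<Longrightarrow> D i \<in> sets (Rn n)" "disjoint_family_on D {..<L * 4 ^ s}"
    and err: "\<And>i. i < L * 4 ^ s \<Longrightarrow> measure (awgn N n (\<phi> i)) (D i) \<ge> 1 - \<epsilon>" and \<epsilon>: "\<epsilon> \<ge> 0"
  shows "\<exists>m l Q E. id_code N n (2 ^ L) m l P Q E \<and> m \<le> \<epsilon> \<and> l \<le> \<epsilon> + 1 / real s"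
proof -
  define k where "k = (4::nat) ^ s"
  obtain F where F: "F \<subseteq> {..<L} \<rightarrow>\<^sub>E {..<k}" "finite F" "card F = 2 ^ L"
    and far: "\<And>f g. f \<in> F \<Longrightarrow> g \<in> F \<Longrightarrow> f \<noteq> g \<Longrightarrow> s * card {l \<in> {..<L}. f l = g l} < L"
    using gilbert_functions[OF s order_refl, of L] unfolding k_def by blast
  have "\<exists>e. bij_betw e {1..2 ^ L :: nat} F"
    using F(2,3) by (intro finite_same_card_bij) auto
  then obtain e where e: "bij_betw e {1..2 ^ L :: nat} F" ..
  define ix where "ix = (\<lambda>f l. l * k + f l)"
  have ix: "ix f l < L * 4 ^ s" if "f \<in> F" "l < L" for f l
  proof -
    have "f l < k" using F(1) that by auto
    then have "ix f l < Suc l * k" by (simp add: ix_def)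
    also have "\<dots> \<le> L * k" using that by (intro mult_right_mono) auto
    finally show ?thesis by (simp add: k_def)
  qed
  have ix_inj: "l = l' \<and> f l = g l'" if "ix f l = ix g l'" "f \<in> F" "l < L" "g \<in> F" "l' < L" for f g l l'
  proof -
    have *: "f l < k" "g l' < k" using F(1) that by auto
    then have "(l * k + f l) div k = l" "(l' * k + g l') div k = l'" by auto
    then have "l = l'" using that(1) by (simp add: ix_def)
    then show ?thesis using that(1) by (simp add: ix_def)
  qed
  \<comment> \<open>Row numbers from L on carry no mass; mapping them to the word of row 0 keeps all
    values in the cost set, so that the map is measurable on its whole domain.\<close>
  define Q where "Q = (\<lambda>f. distr (measure_pmf (pmf_of_set {..<L})) (Rn n) (\<lambda>l. \<phi> (if l < L then ix f l else ix f 0)))"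
  define E where "E = (\<lambda>f. \<Union>l<L. D (ix f l))"
  have L0: "{..<L} \<noteq> {}" using L by (auto simp: lessThan_empty_iff)
  have \<phi>_meas: "(\<lambda>l. \<phi> (if l < L then ix f l else ix f 0)) \<in> measurable (measure_pmf (pmf_of_set {..<L})) (Rn n)"
    if "f \<in> F" for f
    using \<phi>[OF ix[OF that]] L by (auto simp: cost_set_def measurable_pmf_measure1)
  have Q: "prob_space (Q f)" "sets (Q f) = sets (Rn n)" if "f \<in> F" for f
    unfolding Q_def by (auto intro!: measure_pmf.prob_space_distr \<phi>_meas that)
  have Q_cost: "measure (Q f) (cost_set n P) = 1" if f: "f \<in> F" for f
  proof -
    have "measure (Q f) (cost_set n P) = measure (measure_pmf (pmf_of_set {..<L})) ((\<lambda>l. \<phi> (if l < L then ix f l else ix f 0)) -` cost_set n P)"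
      unfolding Q_def by (subst measure_distr[OF \<phi>_meas[OF f] cost]) auto
    also have "(\<lambda>l. \<phi> (if l < L then ix f l else ix f 0)) -` cost_set n P = UNIV"
      using \<phi>[OF ix[OF f]] L by auto
    finally show ?thesis by simp
  qed
  have QW_eq: "QW N n (Q f) B = (\<Sum>l<L. measure (awgn N n (\<phi> (ix f l))) B) / real L"
    if f: "f \<in> F" and B: "B \<in> sets (Rn n)" for f B
  proof -
    have "QW N n (Q f) B = (\<integral>l. measure (awgn N n (\<phi> (if l < L then ix f l else ix f 0))) B \<partial>measure_pmf (pmf_of_set {..<L}))"
      unfolding QW_def Q_def by (rule integral_distr[OF \<phi>_meas[OF f] awgn_measurable[OF N B]])
    also have "\<dots> = (\<Sum>l<L. measure (awgn N n (\<phi> (ix f l))) B) / real L"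
      using L0 by (subst integral_pmf_of_set) auto
    finally show ?thesis .
  qed
  have E: "E f \<in> sets (Rn n)" if "f \<in> F" for f unfolding E_def using D(1)[OF ix[OF that]] by auto
  have miss: "measure (awgn N n (\<phi> (ix f l))) B \<le> \<epsilon>"
    if f: "f \<in> F" "l < L" and B: "B \<in> sets (Rn n)" "B \<inter> D (ix f l) = {}" for f l B
  proof -
    interpret W: prob_space "awgn N n (\<phi> (ix f l))" by (rule prob_space_awgn) fact
    have "measure (awgn N n (\<phi> (ix f l))) B \<le> measure (awgn N n (\<phi> (ix f l))) (space (Rn n) - D (ix f l))"
      using B sets.sets_into_space[OF B(1)] D(1)[OF ix[OF f]] by (intro W.finite_measure_mono) auto
    also have "\<dots> \<le> \<epsilon>" unfolding awgn_Diff[OF N D(1)[OF ix[OF f]]] using err[OF ix[OF f]] by simp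
    finally show ?thesis .
  qed
  have first: "QW N n (Q f) (space (Rn n) - E f) \<le> \<epsilon>" if f: "f \<in> F" for f
  proof -
    have c: "space (Rn n) - E f \<in> sets (Rn n)" using E[OF f] by auto
    have "(\<Sum>l<L. measure (awgn N n (\<phi> (ix f l))) (space (Rn n) - E f)) \<le> (\<Sum>l<L. \<epsilon>)"
      by (intro sum_mono miss f c) (auto simp: E_def)
    then show ?thesis unfolding QW_eq[OF f c] using L by (simp add: field_simps)
  qed
  have second: "QW N n (Q g) (E f) \<le> \<epsilon> + 1 / real s" if f: "f \<in> F" and g: "g \<in> F" and ne: "f \<noteq> g" for f g
  proof -
    have "measure (awgn N n (\<phi> (ix g l))) (E f) \<le> \<epsilon> + (if f l = g l then 1 else 0)" if l: "l < L" for l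
    proof (cases "f l = g l")
      case True
      have "measure (awgn N n (\<phi> (ix g l))) (E f) \<le> 1" by (intro prob_space.prob_le_1 prob_space_awgn N)
      then show ?thesis using True \<epsilon> by simp
    next
      case False
      \<comment> \<open>No cell of f coincides with the cell of g in row l: for another row the row
        index differs, and in row l itself the column does.\<close>
      have "D (ix f l') \<inter> D (ix g l) = {}" if l': "l' < L" for l'
      proof -
        have "ix f l' \<noteq> ix g l" using ix_inj[OF _ f l' g l] False by auto
        then show ?thesis using D(2) ix[OF f l'] ix[OF g l] by (auto simp: disjoint_family_on_def)
      qed
      then have "E f \<inter> D (ix g l) = {}" by (auto simp: E_def)
      then show ?thesis using miss[OF g l E[OF f]] False by simp
    qed
    then have "(\<Sum>l<L. measure (awgn N n (\<phi> (ix g l))) (E f)) \<le> (\<Sum>l<L. \<epsilon> + (if f l = g l then 1 else 0))"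
      by (intro sum_mono) auto
    also have "\<dots> = real L * \<epsilon> + real (card {l \<in> {..<L}. f l = g l})"
      by (simp add: sum.distrib sum.If_cases Int_def)
    also have "real (card {l \<in> {..<L}. f l = g l}) \<le> real L / real s"
    proof -
      have "real (s * card {l \<in> {..<L}. f l = g l}) \<le> real L" using far[OF f g ne] by linarith
      then show ?thesis using s by (simp add: field_simps)
    qed
    finally show ?thesis unfolding QW_eq[OF g E[OF f]] using L by (simp add: field_simps)
  qed
  have eF: "e i \<in> F" if "i \<in> {1..(2::nat) ^ L}" for i using e that by (auto simp: bij_betw_def)
  have e_ne: "e i \<noteq> e j" if "i \<in> {1..(2::nat) ^ L}" "j \<in> {1..(2::nat) ^ L}" "i \<noteq> j" for i j
    using e that by (auto simp: bij_betw_def inj_on_def)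
  define m where "m = Max ((\<lambda>i. QW N n (Q (e i)) (space (Rn n) - E (e i))) ` {1..(2::nat) ^ L})"
  define S where "S = {QW N n (Q (e j)) (E (e i)) | i j. i \<in> {1..(2::nat) ^ L} \<and> j \<in> {1..(2::nat) ^ L} \<and> i \<noteq> j}"
  define l where "l = Max ({0} \<union> S)"
  have "id_code N n (2 ^ L) m l P (\<lambda>i. Q (e i)) (\<lambda>i. E (e i))"
    unfolding id_code_def m_def l_def S_def using Q Q_cost E eF by auto
  moreover have "m \<le> \<epsilon>"
    unfolding m_def using first eF by (subst Max_le_iff) (auto simp: Suc_le_eq)
  moreover have "l \<le> \<epsilon> + 1 / real s"
  proof -
    have "S \<subseteq> (\<lambda>(i, j). QW N n (Q (e j)) (E (e i))) ` ({1..(2::nat) ^ L} \<times> {1..(2::nat) ^ L})" by (auto simp: S_def)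
    then have "finite S" by (rule finite_subset) auto
    moreover have "x \<le> \<epsilon> + 1 / real s" if "x \<in> S" for x
      using that second eF e_ne by (fastforce simp: S_def)
    ultimately show ?thesis unfolding l_def using \<epsilon> by (subst Max_le_iff) auto
  qed
  ultimately show ?thesis by blast
qed

lemma cost_set_sets: "P > 0 \<Longrightarrow> cost_set n P \<in> sets (Rn n)"
proof -
  assume "P > 0"
  then have "cost_set n P = {x \<in> space (Rn n). nsq n x \<le> real n * P}"
    using cost_set_nsq cost_setI by (auto simp: cost_set_def)
  then show ?thesis by simp
qed

lemma trivial_input:
  assumes "P > 0"
  shows "prob_space (return (Rn n) (\<lambda>i\<in>{..<n}. 0))" "measure (return (Rn n) (\<lambda>i\<in>{..<n}. 0)) (cost_set n P) = 1"
proof -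
  have "(\<lambda>i\<in>{..<n}. 0) \<in> space (Rn n)" using zero_in_cost_set[OF assms, of n] by (auto simp: cost_set_def)
  then show "prob_space (return (Rn n) (\<lambda>i\<in>{..<n}. 0))" by (rule prob_space_return)
  show "measure (return (Rn n) (\<lambda>i\<in>{..<n}. 0)) (cost_set n P) = 1"
    using zero_in_cost_set[OF assms, of n] cost_set_sets[OF assms, of n] by (simp add: measure_return)
qed

lemma D_achievable_below_capacity:
  assumes "P > 0" "N > 0" "mu \<ge> 0" "lam \<ge> 0" and R: "R < awgn_capacity P N"
  shows "D_achievable N mu lam P R"
proof -
  obtain R' where R': "max R 0 < R'" "R' < awgn_capacity P N"
    using dense[of "max R 0" "awgn_capacity P N"] R awgn_capacity_nonneg[OF assms(1,2)]
    by (metis max_less_iff_conj)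
  obtain R'' where R'': "R' < R''" "R'' < awgn_capacity P N" using dense[OF R'(2)] by blast
  \<comment> \<open>The columns receive the surplus rate, as 4^(n d) = exp(n (R'' - R')). Hence s
    grows linearly and 1 / s vanishes, while the rows keep the rate R' that determines the number
    2^L of messages.\<close>
  define d where "d = (R'' - R') / ln 4"
  have d: "d > 0" using R'' by (simp add: d_def)
  define L where "L = (\<lambda>n::nat. nat \<lfloor>exp (real n * R')\<rfloor>)"
  define s where "s = (\<lambda>n::nat. nat \<lfloor>real n * d\<rfloor>)"
  have L: "L n \<ge> 1" "real (L n) \<le> exp (real n * R')" "exp (real n * R') / 2 \<le> real (L n)" for n
    unfolding L_def by (intro floor_exp_bounds; use R' in simp)+
  define good where "good = (\<lambda>n Nn m l. Nn = (2::nat) ^ L n \<and> m \<le> 1 / (real n + 1) \<and> l \<le> 1 / (real n + 1) + 1 / (real n * d - 1))"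
  have "eventually (\<lambda>n. real n * d > 1) sequentially"
    using d by real_asymp
  then have ev: "eventually (\<lambda>n. \<exists>Nn m l Q D. id_code N n Nn m l P Q D \<and> good n Nn m l) sequentially"
    using max_error_codes[OF assms(1,2) R''(2)]
  proof eventually_elim
    case (elim n)
    have s: "s n \<ge> 1" "real (s n) \<le> real n * d" "real (s n) \<ge> real n * d - 1"
      using elim(1) d by (auto simp: s_def le_nat_iff)
    have "real (s n) * ln 4 \<le> real n * d * ln 4" using s by (intro mult_right_mono) auto
    also have "\<dots> = real n * (R'' - R')" by (simp add: d_def)
    finally have "exp (real (s n) * ln 4) \<le> exp (real n * (R'' - R'))" by simp
    then have "4 ^ s n \<le> exp (real n * (R'' - R'))" by (simp add: exp_of_nat_mult)
    then have "real (L n) * 4 ^ s n \<le> exp (real n * R') * exp (real n * (R'' - R'))"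
      using L[of n] by (intro mult_mono) auto
    also have "\<dots> = exp (real n * R'')" by (simp add: exp_add[symmetric] algebra_simps)
    finally have "real (L n * 4 ^ s n) \<le> exp (real n * R'')" by simp
    with elim(2) obtain \<phi> D where D: "\<forall>i<L n * 4 ^ s n. \<phi> i \<in> cost_set n P \<and> D i \<in> sets (Rn n) \<and>
        measure (awgn N n (\<phi> i)) (D i) \<ge> 1 - 1 / (real n + 1)" "disjoint_family_on D {..<L n * 4 ^ s n}"
      by blast
    have "\<exists>m l Q E. id_code N n (2 ^ L n) m l P Q E \<and> m \<le> 1 / (real n + 1) \<and> l \<le> 1 / (real n + 1) + 1 / real (s n)"
      by (rule id_code_of_tx_codebook[OF assms(2) L(1) s(1) _ cost_set_sets[OF assms(1)] _ D(2)])
        (use D(1) in auto)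
    moreover have "1 / real (s n) \<le> 1 / (real n * d - 1)"
      using s elim(1) by (intro divide_left_mono) auto
    ultimately show ?case unfolding good_def by (meson add_left_mono order_trans)
  qed
  have triv: "\<exists>Nn m l Q D. id_code N n Nn m l P Q D" for n
    by (intro exI[of _ 1] exI[of _ "\<lambda>_. return (Rn n) (\<lambda>i\<in>{..<n}. 0)"] exI[of _ "\<lambda>_. {}"] exI)
      (auto simp: id_code_def trivial_input[OF assms(1)])
  have "\<exists>Nn m l Q D. id_code N n Nn m l P Q D \<and> ((\<exists>Nn m l Q D. id_code N n Nn m l P Q D \<and> good n Nn m l) \<longrightarrow> good n Nn m l)" for n
    using triv[of n] by blast
  then obtain Nn m l Q D where code: "\<And>n. id_code N n (Nn n) (m n) (l n) P (Q n) (D n)"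
    and g: "\<And>n. (\<exists>Nn m l Q D. id_code N n Nn m l P Q D \<and> good n Nn m l) \<longrightarrow> good n (Nn n) (m n) (l n)" by metis
  have good: "eventually (\<lambda>n. good n (Nn n) (m n) (l n)) sequentially"
    using ev by eventually_elim (use g in blast)
  have "limsup (\<lambda>n. ereal (m n)) \<le> ereal mu"
  proof (rule limsup_le_of_tendsto)
    show "eventually (\<lambda>n. m n \<le> 1 / (real n + 1)) sequentially" using good by eventually_elim (simp add: good_def)
    show "(\<lambda>n. 1 / (real n + 1)) \<longlonglongrightarrow> 0" by real_asymp
  qed fact
  moreover have "limsup (\<lambda>n. ereal (l n)) \<le> ereal lam"
  proof (rule limsup_le_of_tendsto)
    show "eventually (\<lambda>n. l n \<le> 1 / (real n + 1) + 1 / (real n * d - 1)) sequentially"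
      using good by eventually_elim (simp add: good_def)
    show "(\<lambda>n. 1 / (real n + 1) + 1 / (real n * d - 1)) \<longlonglongrightarrow> 0" using d by real_asymp
  qed fact
  moreover have "ereal R \<le> liminf (\<lambda>n. ereal (ln (ln (real (Nn n))) / real n))"
  proof (rule Liminf_bounded)
    have "eventually (\<lambda>n. R < (real n * R' - ln 2 + ln (ln 2)) / real n) sequentially"
    proof -
      have "(\<lambda>n. (real n * R' - ln 2 + ln (ln 2)) / real n) \<longlonglongrightarrow> R'" by real_asymp
      from order_tendstoD(1)[OF this, of R] R' show ?thesis by simp
    qed
    with good
    show "eventually (\<lambda>n. ereal R \<le> ereal (ln (ln (real (Nn n))) / real n)) sequentially"
    proof eventually_elim
      case (elim n)
      have L0: "real (L n) > 0" using L(1)[of n] by simp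
      have "real n * R' - ln 2 = ln (exp (real n * R') / 2)" by (simp add: ln_div)
      also have "\<dots> \<le> ln (real (L n))" using L[of n] L0 by (subst ln_le_cancel_iff) auto
      finally have "real n * R' - ln 2 + ln (ln 2) \<le> ln (real (L n)) + ln (ln 2)" by simp
      also have "\<dots> = ln (real (L n) * ln 2)" using L0 by (simp add: ln_mult_pos)
      also have "\<dots> = ln (ln (real (Nn n)))" using elim(1) by (simp add: good_def ln_realpow)
      finally have "(real n * R' - ln 2 + ln (ln 2)) / real n \<le> ln (ln (real (Nn n))) / real n"
        by (rule divide_right_mono) simp
      with elim(2) show ?case by simp
    qed
  qed
  ultimately show ?thesis unfolding D_achievable_def using code by blast
qed

section \<open>Lower bound for resolvability\<close>

text \<open>Conditioning on an event of probability at least 1/2 at most doubles every probability,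
  and the unconditioned Gaussian input has output variance u + N.\<close>

lemma QW_uniform_le:
  assumes "N > 0" "u > 0" and B: "B \<in> sets (Rn n)" and C: "C \<in> sets (Rn n)" "measure (awgn u n (\<lambda>_. 0)) C \<ge> 1 / 2"
  shows "QW N n (uniform_measure (awgn u n (\<lambda>_. 0)) C) B \<le> 2 * measure (awgn (u + N) n (\<lambda>_. 0)) B"
proof -
  define G where "G = awgn u n (\<lambda>_. 0)"
  interpret G: prob_space G unfolding G_def by (rule prob_space_awgn) fact
  interpret q: prob_space "awgn (u + N) n (\<lambda>_. 0)" by (rule prob_space_awgn) (use assms in simp)
  note C' = C(2)[folded G_def]
  have [measurable]: "(\<lambda>x. measure (awgn N n x) B) \<in> borel_measurable G"
    using awgn_measurable[OF assms(1) B] by (simp add: G_def)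
  have [measurable]: "C \<in> sets G" using C by (simp add: G_def)
  have "ennreal (QW N n (uniform_measure G C) B) = (\<integral>\<^sup>+x. ennreal (measure (awgn N n x) B) \<partial>uniform_measure G C)"
    unfolding QW_def
  proof (rule nn_integral_eq_integral[symmetric])
    have "prob_space (uniform_measure G C)"
      using C' by (intro prob_space_uniform_measure) (auto simp: G.emeasure_eq_measure)
    then show "integrable (uniform_measure G C) (\<lambda>x. measure (awgn N n x) B)"
      by (rule QW_integrable[OF assms(1) _ _ B]) (simp add: G_def)
  qed simp
  also have "\<dots> = (\<integral>\<^sup>+x. ennreal (measure (awgn N n x) B) * indicator C x \<partial>G) / emeasure G C"
    by (rule nn_integral_uniform_measure) auto
  also have "\<dots> \<le> (\<integral>\<^sup>+x. ennreal (measure (awgn N n x) B) \<partial>G) / emeasure G C"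
    by (intro divide_right_mono_ennreal nn_integral_mono) (auto simp: indicator_def)
  also have "(\<integral>\<^sup>+x. ennreal (measure (awgn N n x) B) \<partial>G) = emeasure (awgn (u + N) n (\<lambda>_. 0)) B"
    unfolding G_def by (rule QW_gauss) (use assms in auto)
  also have "\<dots> / emeasure G C = ennreal (measure (awgn (u + N) n (\<lambda>_. 0)) B / measure G C)"
    using C' by (simp add: G.emeasure_eq_measure q.emeasure_eq_measure divide_ennreal)
  finally have "QW N n (uniform_measure G C) B \<le> measure (awgn (u + N) n (\<lambda>_. 0)) B / measure G C"
    by (simp add: ennreal_le_iff)
  also have "\<dots> \<le> measure (awgn (u + N) n (\<lambda>_. 0)) B / (1 / 2)"
    using C' by (intro divide_left_mono) auto
  finally show ?thesis by (simp add: G_def)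
qed

text \<open>The Gaussian law conditioned on the power constraint. The point mass at 0 makes it an
  admissible input for every n; for u < P that branch is taken for at most finitely many n.\<close>

definition gauss_input :: "real \<Rightarrow> real \<Rightarrow> nat \<Rightarrow> (nat \<Rightarrow> real) measure" where
  "gauss_input u P n = (if measure (awgn u n (\<lambda>_. 0)) (cost_set n P) \<ge> 1 / 2
     then uniform_measure (awgn u n (\<lambda>_. 0)) (cost_set n P)
     else return (Rn n) (\<lambda>i\<in>{..<n}. 0))"

lemma input_process_gauss_input:
  assumes "u > 0" "P > 0"
  shows "input_process P (gauss_input u P)"
  unfolding input_process_def
proof
  fix n
  interpret G: prob_space "awgn u n (\<lambda>_. 0)" by (rule prob_space_awgn) fact
  have C: "cost_set n P \<in> sets (Rn n)" by (rule cost_set_sets) fact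
  show "prob_space (gauss_input u P n) \<and> sets (gauss_input u P n) = sets (Rn n) \<and> measure (gauss_input u P n) (cost_set n P) = 1"
  proof (cases "measure (awgn u n (\<lambda>_. 0)) (cost_set n P) \<ge> 1 / 2")
    case True
    then have "prob_space (uniform_measure (awgn u n (\<lambda>_. 0)) (cost_set n P))"
      by (intro prob_space_uniform_measure) (auto simp: G.emeasure_eq_measure)
    moreover have "measure (uniform_measure (awgn u n (\<lambda>_. 0)) (cost_set n P)) (cost_set n P) = 1"
      using True C by (subst measure_uniform_measure) (auto simp: G.emeasure_eq_measure)
    ultimately show ?thesis using True by (simp add: gauss_input_def)
  qed (use trivial_input[OF assms(2), of n] in \<open>simp add: gauss_input_def\<close>)
qed

text \<open>On B each of the two quadratic terms of the information density misses n by at most n t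
  / N in the unfavourable direction, so the density ratio is at least exp(n (capacity - t / N)).
  Both conditions concern y, so the centre x may be any word.\<close>

lemma awgn_le_ball:
  assumes "u > 0" "N > 0" "t > 0" and B: "B \<in> sets (Rn n)"
    and near: "\<And>y. y \<in> B \<Longrightarrow> sqd n x y \<le> real n * (N + t)" and far: "\<And>y. y \<in> B \<Longrightarrow> real n * (u + N - t) \<le> nsq n y"
  shows "measure (awgn (u + N) n (\<lambda>_. 0)) B \<le> exp (- real n * (awgn_capacity u N - t / N))"
proof (rule awgn_le_const[where v' = N and x' = x])
  fix y assume y: "y \<in> B"
  have "sqd n x y / N \<le> real n * (N + t) / N" using near[OF y] assms by (intro divide_right_mono) auto
  also have "\<dots> = real n + real n * (t / N)" using assms by (simp add: field_simps)
  finally have 1: "sqd n x y / N \<le> real n + real n * (t / N)" .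
  have "real n - real n * (t / N) \<le> real n - real n * (t / (u + N))"
    using assms by (intro diff_left_mono mult_left_mono divide_left_mono) auto
  also have "\<dots> = real n * (u + N - t) / (u + N)"
    using assms by (simp add: diff_divide_distrib right_diff_distrib)
  also have "\<dots> \<le> nsq n y / (u + N)" using far[OF y] assms by (intro divide_right_mono) auto
  finally have 2: "real n - real n * (t / N) \<le> nsq n y / (u + N)" .
  have "0 \<le> c + (a - b) / 2" if "b \<le> real n + c" "real n - c \<le> a" for a b c :: real
    using that by (simp add: field_simps)
  from this[OF 1 2] have "1 \<le> exp (- real n * (awgn_capacity u N - t / N)) *
      exp (real n * awgn_capacity u N + (nsq n y / (u + N) - sqd n x y / N) / 2)"
    unfolding exp_add[symmetric] by (simp add: right_diff_distrib)
  then have "1 * gd (u + N) n (\<lambda>_. 0) y \<le> exp (- real n * (awgn_capacity u N - t / N)) *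
      exp (real n * awgn_capacity u N + (nsq n y / (u + N) - sqd n x y / N) / 2) * gd (u + N) n (\<lambda>_. 0) y"
    using assms by (intro mult_right_mono) (auto intro: less_imp_le gd_pos)
  then show "gd (u + N) n (\<lambda>_. 0) y \<le> exp (- real n * (awgn_capacity u N - t / N)) * gd N n x y"
    using gd_ratio_zero[OF assms(1,2), of n x y] by (simp add: mult.assoc)
qed (use assms in auto)

lemma var_dist_ge:
  assumes "N > 0" "prob_space X" "M \<ge> 1" and B: "B \<in> sets (Rn n)"
  shows "2 * (unif_out N n M \<phi> B - QW N n X B) \<le> var_dist n (QW N n X) (unif_out N n M \<phi>)"
proof -
  have U: "0 \<le> unif_out N n M \<phi> B \<and> unif_out N n M \<phi> B \<le> 1" for B
  proof -
    have "(\<Sum>i=1..M. measure (awgn N n (\<phi> i)) B) \<le> (\<Sum>i=1..M. 1)"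
      by (intro sum_mono prob_space.prob_le_1 prob_space_awgn assms)
    then show ?thesis using assms(3) by (auto simp: unif_out_def sum_nonneg field_simps)
  qed
  have "bdd_above ((\<lambda>B. \<bar>QW N n X B - unif_out N n M \<phi> B\<bar>) ` sets (Rn n))"
  proof (rule bdd_aboveI2)
    show "\<bar>QW N n X B - unif_out N n M \<phi> B\<bar> \<le> 1" for B
      using U[of B] QW_bounds[OF assms(1,2), of n B] by (simp add: abs_le_iff)
  qed
  note cSUP_upper[OF B this]
  moreover have "unif_out N n M \<phi> B - QW N n X B \<le> \<bar>QW N n X B - unif_out N n M \<phi> B\<bar>" by simp
  ultimately have "unif_out N n M \<phi> B - QW N n X B \<le> (SUP B\<in>sets (Rn n). \<bar>QW N n X B - unif_out N n M \<phi> B\<bar>)"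
    by (rule order_trans[rotated])
  then show ?thesis unfolding var_dist_def by simp
qed

text \<open>The codewords' noise balls carry the output of the codebook, but below capacity they have
  negligible mass under the output of the Gaussian input.\<close>

lemma gauss_input_not_resolvable:
  assumes "u > 0" "u < P" "N > 0" "dlt < 1" and R: "R < awgn_capacity u N"
  shows "\<not> res_achievable_for N dlt P (gauss_input u P) R"
proof
  assume "res_achievable_for N dlt P (gauss_input u P) R"
  then obtain M \<phi> where M: "\<And>n. M n \<ge> 1"
    and V: "limsup (\<lambda>n. ereal (var_dist n (QW N n (gauss_input u P n)) (unif_out N n (M n) (\<phi> n)))) \<le> ereal dlt"
    and rate: "limsup (\<lambda>n. ereal (ln (real (M n)) / real n)) \<le> ereal R"
    unfolding res_achievable_for_def by blast
  \<comment> \<open>The gap is 3 z: one z for the upper limit of the codebook rate, one for the ball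
    width t \<le> z N in \<open>awgn_le_ball\<close>, and one left as the decay rate of the total
    mass of the balls.\<close>
  define z where "z = (awgn_capacity u N - R) / 3"
  have z: "z > 0" "awgn_capacity u N - z = R + z + z" using R by (auto simp: z_def field_simps)
  define t where "t = min (z * N) ((u + N) / 2)"
  have "t \<le> (u + N) / 2" unfolding t_def by (rule min.cobounded2)
  then have t: "t > 0" "t < u + N" using z assms by (simp_all add: t_def)
  have "t / N \<le> z * N / N" using assms by (intro divide_right_mono) (auto simp: t_def)
  then have tN: "t / N \<le> z" using assms by simp
  obtain c1 where c1: "c1 > 0" and up1: "\<And>n x. measure (awgn u n x) {y \<in> space (Rn n). sqd n x y \<ge> real n * P} \<le> exp (- real n * c1)"
    using awgn_upper_tail[OF assms(1,2)] by blast
  obtain c2 where c2: "c2 > 0" and up2: "\<And>n x. measure (awgn (u + N) n x) {y \<in> space (Rn n). sqd n x y \<le> real n * (u + N - t)} \<le> exp (- real n * c2)"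
    using awgn_lower_tail[of "u + N - t" "u + N"] t by auto
  obtain c3 where c3: "c3 > 0" and up3: "\<And>n x. measure (awgn N n x) {y \<in> space (Rn n). sqd n x y \<ge> real n * (N + t)} \<le> exp (- real n * c3)"
    using awgn_upper_tail[of N "N + t"] t assms by auto
  have "eventually (\<lambda>n. var_dist n (QW N n (gauss_input u P n)) (unif_out N n (M n) (\<phi> n)) < 1) sequentially"
    by (rule eventually_lt_limsup[OF V]) fact
  moreover have "eventually (\<lambda>n. ln (real (M n)) / real n < R + z) sequentially"
    by (rule eventually_lt_limsup[OF rate]) (use z in simp)
  moreover have "eventually (\<lambda>n. exp (- real n * c1) * (real n + 1) \<le> 1 / 16) sequentially"
    "eventually (\<lambda>n. exp (- real n * c2) * (real n + 1) \<le> 1 / 16) sequentially"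
    "eventually (\<lambda>n. exp (- real n * c3) * (real n + 1) \<le> 1 / 16) sequentially"
    "eventually (\<lambda>n. exp (- real n * z) * (real n + 1) \<le> 1 / 16) sequentially"
    by (intro eventually_exp_small; use c1 c2 c3 z in simp)+
  ultimately have "eventually (\<lambda>n::nat. False) sequentially"
    using eventually_gt_at_top[of 0]
  proof eventually_elim
    case (elim n)
    have "exp (- real n * a) \<le> exp (- real n * a) * (real n + 1)" for a by simp
    then have small: "exp (- real n * c1) \<le> 1 / 16" "exp (- real n * c2) \<le> 1 / 16"
        "exp (- real n * c3) \<le> 1 / 16" "exp (- real n * z) \<le> 1 / 16"
      using elim(3-6) order_trans by blast+
    define q where "q = awgn (u + N) n (\<lambda>_. 0)"
    \<comment> \<open>Outputs of small norm are rare under q and go into B as a whole. An output of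
      codeword i can then miss B only through an overlong noise vector, and the balls in E need to
      cover only outputs of the norm demanded by \<open>awgn_le_ball\<close>.\<close>
    define S where "S = {y \<in> space (Rn n). sqd n (\<lambda>_. 0) y \<le> real n * (u + N - t)}"
    define E where "E = (\<lambda>i. {y \<in> space (Rn n). sqd n (\<phi> n i) y \<le> real n * (N + t) \<and> real n * (u + N - t) \<le> nsq n y})"
    define B where "B = S \<union> (\<Union>i\<in>{1..M n}. E i)"
    have [measurable]: "S \<in> sets (Rn n)" "E i \<in> sets (Rn n)" for i unfolding S_def E_def by measurable
    have B [measurable]: "B \<in> sets (Rn n)" unfolding B_def by measurable
    have PN: "P > 0" "u + N > 0" using assms by auto
    interpret G: prob_space "awgn u n (\<lambda>_. 0)" by (rule prob_space_awgn) fact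
    have "space (Rn n) - cost_set n P \<subseteq> {y \<in> space (Rn n). sqd n (\<lambda>_. 0) y \<ge> real n * P}"
      using cost_setI[OF _ _ PN(1), of _ n] by (force simp: not_le)
    then have "measure (awgn u n (\<lambda>_. 0)) (space (Rn n) - cost_set n P) \<le>
        measure (awgn u n (\<lambda>_. 0)) {y \<in> space (Rn n). sqd n (\<lambda>_. 0) y \<ge> real n * P}"
      by (rule G.finite_measure_mono) simp
    then have "measure (awgn u n (\<lambda>_. 0)) (space (Rn n) - cost_set n P) \<le> 1 / 16"
      using up1[of n "\<lambda>_. 0"] small(1) by linarith
    then have C: "measure (awgn u n (\<lambda>_. 0)) (cost_set n P) \<ge> 1 / 2"
      unfolding awgn_Diff[OF assms(1) cost_set_sets[OF PN(1)]] by linarith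
    have Mn: "real (M n) > 0" using M[of n] by simp
    have "ln (real (M n)) \<le> real n * (R + z)" using elim(2,7) by (simp add: field_simps)
    then have M2: "real (M n) \<le> exp (real n * (R + z))" using Mn by (metis exp_le_cancel_iff exp_ln)
    have qE: "measure q (E i) \<le> exp (- real n * (R + z + z))" for i
    proof -
      have "measure q (E i) \<le> exp (- real n * (awgn_capacity u N - t / N))"
        unfolding q_def by (rule awgn_le_ball[where x = "\<phi> n i"]) (use assms t in \<open>auto simp: E_def\<close>)
      also have "\<dots> \<le> exp (- real n * (R + z + z))"
      proof -
        have "real n * (R + z + z) \<le> real n * (awgn_capacity u N - t / N)"
          unfolding z(2)[symmetric] using tN by (intro mult_left_mono diff_left_mono) auto
        then show ?thesis by simp
      qed
      finally show ?thesis .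
    qed
    have "measure q B \<le> measure q S + measure q (\<Union>i\<in>{1..M n}. E i)"
      unfolding B_def by (rule measure_Un_le) (auto simp: q_def)
    also have "measure q (\<Union>i\<in>{1..M n}. E i) \<le> (\<Sum>i\<in>{1..M n}. measure q (E i))"
      by (rule measure_UNION_le) (auto simp: q_def)
    also have "\<dots> \<le> (\<Sum>i\<in>{1..M n}. exp (- real n * (R + z + z)))" by (intro sum_mono qE)
    also have "\<dots> = real (M n) * exp (- real n * (R + z + z))" by simp
    also have "\<dots> \<le> exp (real n * (R + z)) * exp (- real n * (R + z + z))"
      by (intro mult_right_mono M2) simp
    also have "\<dots> = exp (- real n * z)" by (simp add: exp_add[symmetric] algebra_simps)
    also have "measure q S \<le> exp (- real n * c2)" unfolding q_def S_def by (rule up2)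
    finally have qB: "measure q B \<le> 2 / 16" using small by linarith
    have "QW N n (gauss_input u P n) B \<le> 2 * measure q B"
      using QW_uniform_le[OF assms(3,1) B cost_set_sets[OF PN(1)] C] C by (simp add: gauss_input_def q_def)
    then have QB: "QW N n (gauss_input u P n) B \<le> 4 / 16" using qB by linarith
    have WB: "measure (awgn N n (\<phi> n i)) B \<ge> 15 / 16" if i: "i \<in> {1..M n}" for i
    proof -
      interpret W: prob_space "awgn N n (\<phi> n i)" by (rule prob_space_awgn) fact
      have "space (Rn n) - B \<subseteq> {y \<in> space (Rn n). sqd n (\<phi> n i) y \<ge> real n * (N + t)}"
        using i by (auto simp: B_def S_def E_def)
      then have "measure (awgn N n (\<phi> n i)) (space (Rn n) - B) \<le>
          measure (awgn N n (\<phi> n i)) {y \<in> space (Rn n). sqd n (\<phi> n i) y \<ge> real n * (N + t)}"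
        by (rule W.finite_measure_mono) simp
      then have "measure (awgn N n (\<phi> n i)) (space (Rn n) - B) \<le> 1 / 16"
        using up3[of n "\<phi> n i"] small(3) by linarith
      then show ?thesis unfolding awgn_Diff[OF assms(3) B] by linarith
    qed
    have "(\<Sum>i=1..M n. 15 / 16) \<le> (\<Sum>i=1..M n. measure (awgn N n (\<phi> n i)) B)"
      by (intro sum_mono WB)
    then have "unif_out N n (M n) (\<phi> n) B \<ge> 15 / 16"
      using Mn by (simp add: unif_out_def field_simps)
    moreover have "prob_space (gauss_input u P n)"
      using input_process_gauss_input[OF assms(1) PN(1)] by (simp add: input_process_def)
    \<comment> \<open>The masses 15/16 and 4/16 force a variation distance of at least 22/16, while
      the assumed upper limit keeps it below 1.\<close>
    from var_dist_ge[OF assms(3) this M[of n] B, where \<phi> = "\<phi> n"]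
    have "2 * (unif_out N n (M n) (\<phi> n) B - QW N n (gauss_input u P n) B) < 1" using elim(1) by linarith
    ultimately show False using QB by (simp add: field_simps)
  qed
  then show False by simp
qed

theorem Did_eq_capacity:
  assumes "P > 0" "N > 0" "mu \<ge> 0" "lam \<ge> 0" "mu + lam < 1"
  shows "Did N mu lam P = ereal (awgn_capacity P N)"
  unfolding Did_def
  using D_achievable_below_capacity[OF assms(1-4)] D_achievable_le_capacity[OF assms(1,2,5)]
  by (rule Sup_ereal_eq)

theorem Sres_eq_capacity:
  assumes "P > 0" "N > 0" "dlt \<ge> 0" "dlt < 1"
  shows "Sres N dlt P = ereal (awgn_capacity P N)"
  unfolding Sres_def
proof (rule Inf_ereal_eq)
  fix R assume "R > awgn_capacity P N"
  then show "\<forall>X. input_process P X \<longrightarrow> res_achievable_for N dlt P X R"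
    using res_achievable_above_capacity[OF assms(1-3)] by blast
next
  fix R assume R: "\<forall>X. input_process P X \<longrightarrow> res_achievable_for N dlt P X R"
  show "R \<ge> awgn_capacity P N"
  proof (rule ccontr)
    assume "\<not> ?thesis"
    \<comment> \<open>A rate below capacity is still below the capacity for some smaller power u,
      and the conditioned Gaussian input of variance u is the process that codebooks of this rate
      fail to simulate.\<close>
    then obtain u where u: "0 < u" "u < P" "R < awgn_capacity u N"
      using ex_lower_power[OF assms(1,2), of R] by force
    from R input_process_gauss_input[OF u(1) assms(1)] gauss_input_not_resolvable[OF u(1,2) assms(2,4) u(3)]
    show False by blast
  qed
qed

theorem theorem6p3:
  fixes P N eps dlt mu lam :: real
  assumes "P > 0" and "N > 0"
    and "eps \<ge> 0" and "dlt \<ge> 0" and "mu \<ge> 0" and "lam \<ge> 0"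
    and "eps < 1" and "mu + lam < 1" and "dlt < 1"
  shows "Cs N eps P = ereal (1/2 * ln (1 + P / N))
       \<and> Did N mu lam P = ereal (1/2 * ln (1 + P / N))
       \<and> Sres N dlt P = ereal (1/2 * ln (1 + P / N))
       \<and> Cs N 0 P = ereal (1/2 * ln (1 + P / N))"
  using Cs_eq_capacity[OF assms(1,2,3,7)] Cs_eq_capacity[OF assms(1,2) order_refl zero_less_one]
    Did_eq_capacity[OF assms(1,2,5,6,8)] Sres_eq_capacity[OF assms(1,2,4,9)] by simp

end
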